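(* Let $K=\{x\in\mathbb{R}^n:c_j(x)=0\ (j\in\mathcal{E}),\ c_j(x)\ge0\ (j\in\mathcal{I})\}$ for given polynomials $c_j$ ($\mathcal{E},\mathcal{I}$ finite disjoint index sets), $c_{eq}=(c_j)_{j\in\mathcal{E}}$, $c_{in}=(c_j)_{j\in\mathcal{I}}$, let $a_1,\dots,a_m\in\mathbb{R}[x]_d$ be linearly independent as functions on $K$, and let $b\in\mathbb{R}^m$. Let problems (S), (SD), $(S_k)$, $(SD_k)$ and their optimal values $\phi^*,\vartheta^*,\phi_k,\vartheta_k$ be as defined in the context. Suppose $\mathrm{Ideal}[c_{eq}]+\mathrm{QM}[c_{in}]$ is archimedean and $\theta^*=(\theta_1^*,\dots,\theta_m^* )$ is a maximizer of (SD). If the LICQC, SCC and SOSC hold at every (global) minimizer of each of the two problems $$\min\ 1-\sum_{i=1}^m\theta_i^*a_i(x)\quad\text{s.t.}\quad c_j(x)=0\ (j\in\mathcal{E}),\ c_j(x)\ge0\ (j\in\mathcal{I}),$$ $$\min\ 1+\sum_{i=1}^m\theta_i^*a_i(x)\quad\text{s.t.}\quad c_j(x)=0\ (j\in\mathcal{E}),\ c_j(x)\ge0\ (j\in\mathcal{I}),$$ then: (i) $\vartheta_k=\phi_k=\vartheta^*=\phi^*$ for all $k$ big enough. (ii) When $k$ is sufficiently large, every minimizer $(v,w)$ of the moment relaxation $(S_k)$ has a flat truncation, i.e., both $v$ and $w$ have flat truncations.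
   Context: Notation. $\mathbb{R}[x]=\mathbb{R}[x_1,\dots,x_n]$; $\mathbb{R}[x]_d$ is the space of polynomials of degree at most $d$; $\mathbb{N}^n_d=\{\alpha\in\mathbb{N}^n:|\alpha|\le d\}$. For $p=\sum_\alpha p_\alpha x^\alpha$ and a vector $y$ indexed by $\mathbb{N}^n_s$ with $s\ge\deg p$, $\langle p,y\rangle=\sum_\alpha p_\alpha y_\alpha$. Cones. $\mathscr{P}_d(K)=\{p\in\mathbb{R}[x]_d:p\ge0\text{ on }K\}$. $\mathscr{R}_d(K)$ is the set of $y\in\mathbb{R}^{\mathbb{N}^n_d}$ for which there is a (nonnegative) Borel measure $\mu$ with $\mathrm{supp}(\mu)\subseteq K$ and $y_\alpha=\int x^\alpha d\mu$ for all $\alpha\in\mathbb{N}^n_d$. Ideals and quadratic modules. $\Sigma[x]$ is the set of sums of squares, $\Sigma[x]_k=\Sigma[x]\cap\mathbb{R}[x]_k$. For $h=(h_1,\dots,h_t)$, $\mathrm{Ideal}[h]=\sum_ih_i\mathbb{R}[x]$, $\mathrm{Ideal}[h]_k=\sum_ih_i\,\mathbb{R}[x]_{k-\deg h_i}$. For $g=(g_1,\dots,g_\ell)$, $\mathrm{QM}[g]=\Sigma[x]+\sum_ig_i\Sigma[x]$, $\mathrm{QM}[g]_k=\Sigma[x]_k+\sum_ig_i\,\Sigma[x]_{k-\deg g_i}$. $\mathrm{Ideal}[h]+\mathrm{QM}[g]$ is archimedean if it contains $R-\|x\|^2$ for some $R>0$. Localizing objects. For $w\in\mathbb{R}^{\mathbb{N}^n_{2k}}$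 and a polynomial $q$ with $\deg q\le 2k$: $L_q^{(k)}[w]$ is the symmetric matrix with $\mathrm{vec}(p)^TL_q^{(k)}[w]\mathrm{vec}(p)=\langle qp^2,w\rangle$ for all $p$ with $2\deg p\le2k-\deg q$ ($\mathrm{vec}(p)$ is the coefficient vector); $M_k[w]=L_1^{(k)}[w]$; $\mathscr{V}_q^{(2k)}[w]$ is the vector with $\langle qp,w\rangle=(\mathscr{V}_q^{(2k)}[w])^T\mathrm{vec}(p)$ for all $p$ with $\deg p\le2k-\deg q$. Problems (optimal values are infima/suprema). (S): $\min\langle1,y\rangle+\langle1,z\rangle$ s.t. $\langle a_i,y\rangle-\langle a_i,z\rangle=b_i$ ($1\le i\le m$), $y,z\in\mathscr{R}_d(K)$; value $\phi^*$. (SD): $\max\sum_ib_i\theta_i$ s.t. $1-\sum_i\theta_ia_i\in\mathscr{P}_d(K)$, $1+\sum_i\theta_ia_i\in\mathscr{P}_d(K)$, $\theta\in\mathbb{R}^m$; value $\vartheta^*$. Let $d_K=\max_{j\in\mathcal{E}\cup\mathcal{I}}\lceil\deg(c_j)/2\rceil$ and $d_0=\max\{d_K,\max_i\lceil\deg(a_i)/2\rceil\}$. For $k\ge\max\{d,d_K\}$: $(S_k)$: $\min\langle1,v\rangle+\langle1,w\rangle$ s.t. $\langle a_i,v\rangle-\langle a_i,w\rangle=b_i$ ($1\le i\le m$), $\mathscr{V}_{c_j}^{(2k)}[v]=0$, $\mathscr{V}_{c_j}^{(2k)}[w]=0$ ($j\in\mathcal{E}$), $L_{c_j}^{(k)}[v]\succeq0$,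 $L_{c_j}^{(k)}[w]\succeq0$ ($j\in\mathcal{I}$), $M_k[v]\succeq0$, $M_k[w]\succeq0$, $v,w\in\mathbb{R}^{\mathbb{N}^n_{2k}}$; value $\phi_k$. $(SD_k)$: $\max\sum_ib_i\theta_i$ s.t. $1-\sum_i\theta_ia_i$ and $1+\sum_i\theta_ia_i$ both lie in $\mathrm{Ideal}[c_{eq}]_{2k}+\mathrm{QM}[c_{in}]_{2k}$, $\theta\in\mathbb{R}^m$; value $\vartheta_k$. Flat truncation. $w\in\mathbb{R}^{\mathbb{N}^n_{2k}}$ has a flat truncation if there is an integer $t\in[d_0,k]$ with $\mathrm{rank}\,M_{t-d_K}[w|_{2t}]=\mathrm{rank}\,M_t[w|_{2t}]$, where $w|_{2t}$ is the restriction of $w$ to indices in $\mathbb{N}^n_{2t}$. Optimality conditions. For $\min F(x)$ s.t. $c_j(x)=0$ ($j\in\mathcal{E}$), $c_j(x)\ge0$ ($j\in\mathcal{I}$), and a minimizer $x^*$, let $J(x^* )=\{j\in\mathcal{E}\cup\mathcal{I}:c_j(x^* )=0\}$. LICQC: the gradients $\nabla c_j(x^* )$, $j\in J(x^* )$, are linearly independent; then there are (unique) multipliers $\lambda_j$ with $\nabla F(x^* )=\sum_{j\in\mathcal{E}\cup\mathcal{I}}\lambda_j\nabla c_j(x^* )$, and $\lambda_j\ge0$, $\lambda_jc_j(x^* )=0$ for $j\in\mathcal{I}$. SCC: $\lambda_j+c_j(x^* )>0$ for all $j\in\mathcal{I}$. SOSC: with $\mathscr{L}=F-\sum_j\lambda_jc_j$,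 $v^T\nabla^2\mathscr{L}(x^* )v>0$ for every nonzero $v\in\mathbb{R}^n$ with $v^T\nabla c_j(x^* )=0$ for all $j\in J(x^* )$. *)

theory Defs
  imports
    "HOL-Analysis.Analysis"
    "HOL-Library.Poly_Mapping"
    "HOL-Library.Function_Algebras"
begin

section \<open>Polynomials\<close>

text \<open>
  \<open>\<real>[x\<^sub>1,\<dots>,x\<^sub>n]\<close> is the monoid algebra of the exponent vectors, with variables
  indexed by the finite type \<open>'n\<close>.  Points are elements of \<open>real ^ 'n\<close>.
\<close>

type_synonym 'n expo = "'n \<Rightarrow>\<^sub>0 nat"
type_synonym 'n mpoly = "'n expo \<Rightarrow>\<^sub>0 real"

definition expo_size :: "'n::finite expo \<Rightarrow> nat" where
  "expo_size \<alpha> = (\<Sum>i\<in>UNIV. Poly_Mapping.lookup \<alpha> i)"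

definition expos :: "nat \<Rightarrow> 'n::finite expo set" where
  "expos s = {\<alpha>. expo_size \<alpha> \<le> s}"

definition pconst :: "real \<Rightarrow> 'n mpoly" where
  "pconst r = Poly_Mapping.single 0 r"

definition pmonom :: "'n expo \<Rightarrow> 'n mpoly" where
  "pmonom \<alpha> = Poly_Mapping.single \<alpha> 1"

definition pvar :: "'n \<Rightarrow> 'n mpoly" where
  "pvar i = pmonom (Poly_Mapping.single i 1)"

definition monom_eval :: "'n::finite expo \<Rightarrow> real ^ 'n \<Rightarrow> real" where
  "monom_eval \<alpha> x = (\<Prod>i\<in>UNIV. (x $ i) ^ Poly_Mapping.lookup \<alpha> i)"

definition peval :: "'n::finite mpoly \<Rightarrow> real ^ 'n \<Rightarrow> real" where
  "peval p x = (\<Sum>\<alpha>\<in>Poly_Mapping.keys p. Poly_Mapping.lookup p \<alpha> * monom_eval \<alpha> x)"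

text \<open>Total degree; the zero polynomial gets degree \<open>0\<close>.\<close>

definition tdeg :: "'n::finite mpoly \<Rightarrow> nat" where
  "tdeg p = Max (insert 0 (expo_size ` Poly_Mapping.keys p))"

text \<open>
  The space \<open>\<real>[x]\<^sub>d\<close>.  The bound is an integer, so that \<open>\<real>[x]\<^bsub>k - deg h\<^esub>\<close> is the zero
  space when \<open>k < deg h\<close>.
\<close>

definition polys_le :: "int \<Rightarrow> 'n::finite mpoly set" where
  "polys_le d = {p. \<forall>\<alpha>\<in>Poly_Mapping.keys p. int (expo_size \<alpha>) \<le> d}"

definition half_deg :: "'n::finite mpoly \<Rightarrow> nat" where
  "half_deg p = nat \<lceil>real (tdeg p) / 2\<rceil>"

definition plin :: "real ^ 'm \<Rightarrow> ('m::finite \<Rightarrow> 'n mpoly) \<Rightarrow> 'n mpoly" where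
  "plin \<theta> a = (\<Sum>i\<in>UNIV. pconst (\<theta> $ i) * a i)"

definition lin_indep_on :: "(real ^ 'n) set \<Rightarrow> ('m::finite \<Rightarrow> 'n::finite mpoly) \<Rightarrow> bool" where
  "lin_indep_on K a \<longleftrightarrow>
     (\<forall>u. (\<forall>x\<in>K. (\<Sum>i\<in>UNIV. u i * peval (a i) x) = 0) \<longrightarrow> (\<forall>i. u i = 0))"

section \<open>Sums of squares, ideals and quadratic modules\<close>

definition SOS :: "'n mpoly set" where
  "SOS = {\<Sum>i<N. (q i)\<^sup>2 |(N::nat) q. True}"

definition SOS_le :: "int \<Rightarrow> 'n::finite mpoly set" where
  "SOS_le k = SOS \<inter> polys_le k"

definition Ideal_of :: "('j \<Rightarrow> 'n mpoly) \<Rightarrow> 'j set \<Rightarrow> 'n mpoly set" where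
  "Ideal_of h E = {\<Sum>j\<in>E. h j * p j |p. True}"

definition Ideal_le :: "('j \<Rightarrow> 'n::finite mpoly) \<Rightarrow> 'j set \<Rightarrow> int \<Rightarrow> 'n mpoly set" where
  "Ideal_le h E k =
     {\<Sum>j\<in>E. h j * p j |p. \<forall>j\<in>E. p j \<in> polys_le (k - int (tdeg (h j)))}"

definition QM :: "('j \<Rightarrow> 'n mpoly) \<Rightarrow> 'j set \<Rightarrow> 'n mpoly set" where
  "QM g I = {\<sigma>0 + (\<Sum>j\<in>I. g j * \<sigma> j) |\<sigma>0 \<sigma>. \<sigma>0 \<in> SOS \<and> (\<forall>j\<in>I. \<sigma> j \<in> SOS)}"

definition QM_le :: "('j \<Rightarrow> 'n::finite mpoly) \<Rightarrow> 'j set \<Rightarrow> int \<Rightarrow> 'n mpoly set" where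
  "QM_le g I k =
     {\<sigma>0 + (\<Sum>j\<in>I. g j * \<sigma> j) |\<sigma>0 \<sigma>.
        \<sigma>0 \<in> SOS_le k \<and> (\<forall>j\<in>I. \<sigma> j \<in> SOS_le (k - int (tdeg (g j))))}"

definition archimedean :: "'n::finite mpoly set \<Rightarrow> bool" where
  "archimedean Q \<longleftrightarrow> (\<exists>R>0. pconst R - (\<Sum>i\<in>UNIV. (pvar i)\<^sup>2) \<in> Q)"

section \<open>The feasible set and the cones of polynomials and moments\<close>

text \<open>Throughout, \<open>E\<close> indexes the equality constraints and \<open>I\<close> the inequality constraints.\<close>

definition feas_set :: "'j set \<Rightarrow> 'j set \<Rightarrow> ('j \<Rightarrow> 'n::finite mpoly) \<Rightarrow> (real ^ 'n) set" where
  "feas_set E I c = {x. (\<forall>j\<in>E. peval (c j) x = 0) \<and> (\<forall>j\<in>I. peval (c j) x \<ge> 0)}"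

definition nonneg_polys :: "nat \<Rightarrow> (real ^ 'n::finite) set \<Rightarrow> 'n mpoly set" where
  "nonneg_polys d K = {p \<in> polys_le (int d). \<forall>x\<in>K. peval p x \<ge> 0}"

text \<open>
  A vector indexed by \<open>\<nat>\<^sup>n\<^sub>s\<close> is a function in \<open>extensional (expos s)\<close>; restricting it to
  smaller indices is \<^const>\<open>restrict\<close>.
\<close>

definition pairing :: "'n mpoly \<Rightarrow> ('n expo \<Rightarrow> real) \<Rightarrow> real" where
  "pairing p y = (\<Sum>\<alpha>\<in>Poly_Mapping.keys p. Poly_Mapping.lookup p \<alpha> * y \<alpha>)"

definition msupport :: "'a::topological_space measure \<Rightarrow> 'a set" where
  "msupport \<mu> = {x. \<forall>U. open U \<and> x \<in> U \<longrightarrow> emeasure \<mu> U > 0}"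

definition moment_cone :: "nat \<Rightarrow> (real ^ 'n::finite) set \<Rightarrow> ('n expo \<Rightarrow> real) set" where
  "moment_cone d K =
     {y \<in> extensional (expos d).
        \<exists>\<mu>. sets \<mu> = sets borel \<and> msupport \<mu> \<subseteq> K \<and>
            (\<forall>\<alpha>\<in>expos d. has_bochner_integral \<mu> (monom_eval \<alpha>) (y \<alpha>))}"

section \<open>Localizing matrices and vectors\<close>

definition sym_on :: "'i set \<Rightarrow> ('i \<Rightarrow> 'i \<Rightarrow> real) \<Rightarrow> bool" where
  "sym_on S A \<longleftrightarrow> (\<forall>\<alpha>\<in>S. \<forall>\<beta>\<in>S. A \<alpha> \<beta> = A \<beta> \<alpha>)"

definition quad_form :: "'i set \<Rightarrow> ('i \<Rightarrow> 'i \<Rightarrow> real) \<Rightarrow> ('i \<Rightarrow> real) \<Rightarrow> real" where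
  "quad_form S A u = (\<Sum>\<alpha>\<in>S. \<Sum>\<beta>\<in>S. u \<alpha> * A \<alpha> \<beta> * u \<beta>)"

definition psd_on :: "'i set \<Rightarrow> ('i \<Rightarrow> 'i \<Rightarrow> real) \<Rightarrow> bool" where
  "psd_on S A \<longleftrightarrow> sym_on S A \<and> (\<forall>u. quad_form S A u \<ge> 0)"

text \<open>The rank of an \<open>S \<times> S\<close> matrix is the dimension of its row space inside \<open>'i \<Rightarrow> real\<close>.\<close>

definition rank_on :: "'i set \<Rightarrow> ('i \<Rightarrow> 'i \<Rightarrow> real) \<Rightarrow> nat" where
  "rank_on S A =
     vector_space.dim (\<lambda>(r::real) f i. r * f i)
       ((\<lambda>\<alpha> \<beta>. if \<beta> \<in> S then A \<alpha> \<beta> else 0) ` S)"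

lemma vector_space_fun: "vector_space (\<lambda>(r::real) (f::'i \<Rightarrow> real) i. r * f i)"
  by unfold_locales (auto simp: fun_eq_iff algebra_simps)

text \<open>
  The coefficients of the \<open>p\<close> with \<open>2 deg p \<le> 2k - deg q\<close> are indexed by \<open>loc_expos k q\<close>,
  those of the \<open>p\<close> with \<open>deg p \<le> 2k - deg q\<close> by \<open>locvec_expos k q\<close>.
\<close>

definition loc_expos :: "nat \<Rightarrow> 'n::finite mpoly \<Rightarrow> 'n expo set" where
  "loc_expos k q = {\<alpha>. 2 * expo_size \<alpha> + tdeg q \<le> 2 * k}"

definition loc_mat ::
  "nat \<Rightarrow> 'n::finite mpoly \<Rightarrow> ('n expo \<Rightarrow> real) \<Rightarrow> 'n expo \<Rightarrow> 'n expo \<Rightarrow> real" where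
  "loc_mat k q w =
     (\<lambda>\<alpha>\<in>loc_expos k q. \<lambda>\<beta>\<in>loc_expos k q. pairing (q * pmonom \<alpha> * pmonom \<beta>) w)"

definition locvec_expos :: "nat \<Rightarrow> 'n::finite mpoly \<Rightarrow> 'n expo set" where
  "locvec_expos k q = {\<alpha>. expo_size \<alpha> + tdeg q \<le> 2 * k}"

definition loc_vec ::
  "nat \<Rightarrow> 'n::finite mpoly \<Rightarrow> ('n expo \<Rightarrow> real) \<Rightarrow> 'n expo \<Rightarrow> real" where
  "loc_vec k q w = (\<lambda>\<alpha>\<in>locvec_expos k q. pairing (q * pmonom \<alpha>) w)"

abbreviation loc_psd :: "nat \<Rightarrow> 'n::finite mpoly \<Rightarrow> ('n expo \<Rightarrow> real) \<Rightarrow> bool" where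
  "loc_psd k q w \<equiv> psd_on (loc_expos k q) (loc_mat k q w)"

abbreviation moment_rank :: "nat \<Rightarrow> ('n::finite expo \<Rightarrow> real) \<Rightarrow> nat" where
  "moment_rank k w \<equiv> rank_on (loc_expos k 1) (loc_mat k 1 w)"

subsection \<open>The entries above are those determined by the defining identities\<close>

lemma finite_expos: "finite (expos s :: 'n::finite expo set)"
proof -
  have "inj_on Poly_Mapping.lookup (expos s :: 'n expo set)"
    by (intro inj_onI poly_mapping_eqI) simp
  moreover have "Poly_Mapping.lookup ` (expos s :: 'n expo set) \<subseteq> PiE UNIV (\<lambda>_. {..s})"
  proof -
    have "Poly_Mapping.lookup \<alpha> i \<le> s" if "\<alpha> \<in> expos s" for \<alpha> :: "'n expo" and i
      using that member_le_sum[of i UNIV "Poly_Mapping.lookup \<alpha>"] by (simp add: expos_def expo_size_def)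
    then show ?thesis by auto
  qed
  moreover have "finite (PiE UNIV (\<lambda>_::'n. {..s}))"
    by (intro finite_PiE) auto
  ultimately show ?thesis
    using finite_imageD finite_subset by blast
qed

lemma finite_loc_expos [simp]: "finite (loc_expos k q)"
  by (rule finite_subset[OF _ finite_expos[of "k"]]) (auto simp: loc_expos_def expos_def)

lemma finite_locvec_expos [simp]: "finite (locvec_expos k q)"
  by (rule finite_subset[OF _ finite_expos[of "2 * k"]]) (auto simp: locvec_expos_def expos_def)

lemma pairing_superset:
  assumes "finite S" "Poly_Mapping.keys p \<subseteq> S"
  shows "pairing p y = (\<Sum>\<alpha>\<in>S. Poly_Mapping.lookup p \<alpha> * y \<alpha>)"
  unfolding pairing_def
  by (rule sum.mono_neutral_left) (use assms in \<open>auto simp: in_keys_iff\<close>)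

lemma pairing_add: "pairing (p + q) y = pairing p y + pairing q y"
proof -
  let ?S = "Poly_Mapping.keys p \<union> Poly_Mapping.keys q"
  have "Poly_Mapping.keys (p + q) \<subseteq> ?S" by (rule keys_add)
  then show ?thesis
    by (simp add: pairing_superset[of ?S] lookup_add sum.distrib algebra_simps)
qed

lemma pairing_pconst: "pairing (pconst r * p) y = r * pairing p y"
proof -
  have l: "Poly_Mapping.lookup (pconst r * p) \<alpha> = r * Poly_Mapping.lookup p \<alpha>" for \<alpha>
    unfolding pconst_def mult_map_scale_conv_mult[symmetric]
    by (simp add: Poly_Mapping.map.rep_eq when_def)
  then have "Poly_Mapping.keys (pconst r * p) \<subseteq> Poly_Mapping.keys p" by (auto simp: in_keys_iff)
  then show ?thesis
    by (simp add: pairing_superset[of "Poly_Mapping.keys p"] l sum_distrib_left mult.assoc)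
qed

lemma pairing_sum: "finite S \<Longrightarrow> pairing (\<Sum>i\<in>S. f i) y = (\<Sum>i\<in>S. pairing (f i) y)"
  by (induction S rule: finite_induct) (simp_all add: pairing_add, simp add: pairing_def)

lemma poly_expand:
  assumes "finite S" "Poly_Mapping.keys p \<subseteq> S"
  shows "p = (\<Sum>\<alpha>\<in>S. pconst (Poly_Mapping.lookup p \<alpha>) * pmonom \<alpha>)"
proof (rule poly_mapping_eqI)
  fix \<beta>
  have "Poly_Mapping.lookup (\<Sum>\<alpha>\<in>S. pconst (Poly_Mapping.lookup p \<alpha>) * pmonom \<alpha>) \<beta> =
        (\<Sum>\<alpha>\<in>S. if \<alpha> = \<beta> then Poly_Mapping.lookup p \<alpha> else 0)"
    by (simp add: lookup_sum pconst_def pmonom_def mult_single lookup_single when_def)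
  also have "\<dots> = Poly_Mapping.lookup p \<beta>"
    using assms by (auto simp: in_keys_iff)
  finally show "Poly_Mapping.lookup p \<beta> = Poly_Mapping.lookup (\<Sum>\<alpha>\<in>S. pconst (Poly_Mapping.lookup p \<alpha>) * pmonom \<alpha>) \<beta>" by simp
qed

lemma loc_vec_identity:
  assumes "p \<in> polys_le (2 * int k - int (tdeg q))"
  shows "pairing (q * p) w = (\<Sum>\<alpha>\<in>locvec_expos k q. loc_vec k q w \<alpha> * Poly_Mapping.lookup p \<alpha>)"
proof -
  let ?S = "locvec_expos k q"
  have S: "finite ?S" "Poly_Mapping.keys p \<subseteq> ?S"
    using assms by (simp, force simp: polys_le_def locvec_expos_def)
  have "q * p = (\<Sum>\<alpha>\<in>?S. pconst (Poly_Mapping.lookup p \<alpha>) * (q * pmonom \<alpha>))"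
    by (subst poly_expand[OF S]) (simp add: sum_distrib_left algebra_simps)
  then show ?thesis
    by (simp add: pairing_sum pairing_pconst loc_vec_def mult.commute)
qed

lemma loc_mat_identity:
  assumes "\<forall>\<alpha>\<in>Poly_Mapping.keys p. 2 * int (expo_size \<alpha>) \<le> 2 * int k - int (tdeg q)"
  shows "quad_form (loc_expos k q) (loc_mat k q w) (Poly_Mapping.lookup p) = pairing (q * p\<^sup>2) w"
proof -
  let ?S = "loc_expos k q"
  have S: "finite ?S" "Poly_Mapping.keys p \<subseteq> ?S"
    using assms by (simp, force simp: loc_expos_def)
  have "q * p\<^sup>2 = q * (\<Sum>\<alpha>\<in>?S. pconst (Poly_Mapping.lookup p \<alpha>) * pmonom \<alpha>)
                     * (\<Sum>\<beta>\<in>?S. pconst (Poly_Mapping.lookup p \<beta>) * pmonom \<beta>)"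
    using poly_expand[OF S] by (simp add: power2_eq_square mult.assoc)
  also have "\<dots> = (\<Sum>\<alpha>\<in>?S. \<Sum>\<beta>\<in>?S. pconst (Poly_Mapping.lookup p \<alpha>) *
                     (pconst (Poly_Mapping.lookup p \<beta>) * (q * pmonom \<alpha> * pmonom \<beta>)))"
    by (simp add: sum_distrib_left sum_distrib_right algebra_simps)
  finally have "pairing (q * p\<^sup>2) w = (\<Sum>\<alpha>\<in>?S. \<Sum>\<beta>\<in>?S. Poly_Mapping.lookup p \<alpha> *
                     (Poly_Mapping.lookup p \<beta> * pairing (q * pmonom \<alpha> * pmonom \<beta>) w))"
    by (simp add: pairing_sum pairing_pconst)
  then show ?thesis
    by (simp add: quad_form_def loc_mat_def mult_ac(2,3))
qed

lemma loc_mat_sym: "sym_on (loc_expos k q) (loc_mat k q w)"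
  by (simp add: sym_on_def loc_mat_def ac_simps)

section \<open>The optimization problems\<close>

text \<open>
  Optimal values are infima and suprema in \<^typ>\<open>ereal\<close>: an infeasible minimization has
  value \<open>\<infinity>\<close>, and equality of values does not presuppose attainment.
\<close>

definition S_feasible ::
  "nat \<Rightarrow> (real ^ 'n) set \<Rightarrow> ('m::finite \<Rightarrow> 'n::finite mpoly) \<Rightarrow> real ^ 'm \<Rightarrow>
   (('n expo \<Rightarrow> real) \<times> ('n expo \<Rightarrow> real)) set" where
  "S_feasible d K a b =
     {(y, z). y \<in> moment_cone d K \<and> z \<in> moment_cone d K \<and>
              (\<forall>i. pairing (a i) y - pairing (a i) z = b $ i)}"

definition S_objective :: "('n expo \<Rightarrow> real) \<times> ('n expo \<Rightarrow> real) \<Rightarrow> real" where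
  "S_objective = (\<lambda>(y, z). pairing 1 y + pairing 1 z)"

definition S_value ::
  "nat \<Rightarrow> (real ^ 'n) set \<Rightarrow> ('m::finite \<Rightarrow> 'n::finite mpoly) \<Rightarrow> real ^ 'm \<Rightarrow> ereal" where
  "S_value d K a b = (INF yz\<in>S_feasible d K a b. ereal (S_objective yz))"

definition SD_feasible ::
  "nat \<Rightarrow> (real ^ 'n) set \<Rightarrow> ('m::finite \<Rightarrow> 'n::finite mpoly) \<Rightarrow> (real ^ 'm) set" where
  "SD_feasible d K a =
     {\<theta>. 1 - plin \<theta> a \<in> nonneg_polys d K \<and> 1 + plin \<theta> a \<in> nonneg_polys d K}"

definition SD_objective :: "real ^ 'm::finite \<Rightarrow> real ^ 'm \<Rightarrow> real" where
  "SD_objective b \<theta> = (\<Sum>i\<in>UNIV. b $ i * \<theta> $ i)"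

definition SD_value ::
  "nat \<Rightarrow> (real ^ 'n) set \<Rightarrow> ('m::finite \<Rightarrow> 'n::finite mpoly) \<Rightarrow> real ^ 'm \<Rightarrow> ereal" where
  "SD_value d K a b = (SUP \<theta>\<in>SD_feasible d K a. ereal (SD_objective b \<theta>))"

definition relax_cone ::
  "nat \<Rightarrow> 'j set \<Rightarrow> 'j set \<Rightarrow> ('j \<Rightarrow> 'n::finite mpoly) \<Rightarrow> ('n expo \<Rightarrow> real) set" where
  "relax_cone k E I c =
     {w \<in> extensional (expos (2 * k)).
        (\<forall>j\<in>E. \<forall>\<alpha>\<in>locvec_expos k (c j). loc_vec k (c j) w \<alpha> = 0) \<and>
        (\<forall>j\<in>I. loc_psd k (c j) w) \<and> loc_psd k 1 w}"

definition Sk_feasible ::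
  "nat \<Rightarrow> 'j set \<Rightarrow> 'j set \<Rightarrow> ('j \<Rightarrow> 'n::finite mpoly) \<Rightarrow>
   ('m::finite \<Rightarrow> 'n mpoly) \<Rightarrow> real ^ 'm \<Rightarrow>
   (('n expo \<Rightarrow> real) \<times> ('n expo \<Rightarrow> real)) set" where
  "Sk_feasible k E I c a b =
     {(v, w). v \<in> relax_cone k E I c \<and> w \<in> relax_cone k E I c \<and>
              (\<forall>i. pairing (a i) v - pairing (a i) w = b $ i)}"

definition Sk_value ::
  "nat \<Rightarrow> 'j set \<Rightarrow> 'j set \<Rightarrow> ('j \<Rightarrow> 'n::finite mpoly) \<Rightarrow>
   ('m::finite \<Rightarrow> 'n mpoly) \<Rightarrow> real ^ 'm \<Rightarrow> ereal" where
  "Sk_value k E I c a b = (INF vw\<in>Sk_feasible k E I c a b. ereal (S_objective vw))"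

definition SDk_feasible ::
  "nat \<Rightarrow> 'j set \<Rightarrow> 'j set \<Rightarrow> ('j \<Rightarrow> 'n::finite mpoly) \<Rightarrow>
   ('m::finite \<Rightarrow> 'n mpoly) \<Rightarrow> (real ^ 'm) set" where
  "SDk_feasible k E I c a =
     {\<theta>. 1 - plin \<theta> a \<in> Ideal_le c E (2 * int k) + QM_le c I (2 * int k) \<and>
         1 + plin \<theta> a \<in> Ideal_le c E (2 * int k) + QM_le c I (2 * int k)}"

definition SDk_value ::
  "nat \<Rightarrow> 'j set \<Rightarrow> 'j set \<Rightarrow> ('j \<Rightarrow> 'n::finite mpoly) \<Rightarrow>
   ('m::finite \<Rightarrow> 'n mpoly) \<Rightarrow> real ^ 'm \<Rightarrow> ereal" where
  "SDk_value k E I c a b = (SUP \<theta>\<in>SDk_feasible k E I c a. ereal (SD_objective b \<theta>))"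

section \<open>Flat truncation\<close>

text \<open>The inserted \<open>0\<close> matters only without constraints, and then nothing is archimedean.\<close>

definition d_K :: "'j set \<Rightarrow> 'j set \<Rightarrow> ('j \<Rightarrow> 'n::finite mpoly) \<Rightarrow> nat" where
  "d_K E I c = Max (insert 0 ((\<lambda>j. half_deg (c j)) ` (E \<union> I)))"

definition d_0 ::
  "'j set \<Rightarrow> 'j set \<Rightarrow> ('j \<Rightarrow> 'n::finite mpoly) \<Rightarrow> ('m::finite \<Rightarrow> 'n mpoly) \<Rightarrow> nat" where
  "d_0 E I c a = max (d_K E I c) (Max ((\<lambda>i. half_deg (a i)) ` UNIV))"

text \<open>Here \<open>dK \<le> d0\<close>, so the subtraction does not truncate.\<close>

definition flat_truncation :: "nat \<Rightarrow> nat \<Rightarrow> nat \<Rightarrow> ('n::finite expo \<Rightarrow> real) \<Rightarrow> bool" where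
  "flat_truncation dK d0 k w \<longleftrightarrow>
     (\<exists>t. d0 \<le> t \<and> t \<le> k \<and>
          moment_rank (t - dK) (restrict w (expos (2 * t))) =
          moment_rank t (restrict w (expos (2 * t))))"

section \<open>Optimality conditions\<close>

definition gradient :: "('a::real_inner \<Rightarrow> real) \<Rightarrow> 'a \<Rightarrow> 'a" where
  "gradient f x = (THE g. GDERIV f x :> g)"

definition hessian :: "(real ^ 'n::finite \<Rightarrow> real) \<Rightarrow> real ^ 'n \<Rightarrow> real ^ 'n ^ 'n" where
  "hessian f x = jacobian (gradient f) (at x)"

definition active ::
  "'j set \<Rightarrow> 'j set \<Rightarrow> ('j \<Rightarrow> 'n::finite mpoly) \<Rightarrow> real ^ 'n \<Rightarrow> 'j set" where
  "active E I c x = {j \<in> E \<union> I. peval (c j) x = 0}"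

definition licqc ::
  "'j set \<Rightarrow> 'j set \<Rightarrow> ('j \<Rightarrow> 'n::finite mpoly) \<Rightarrow> real ^ 'n \<Rightarrow> bool" where
  "licqc E I c x \<longleftrightarrow>
     (\<forall>u. (\<Sum>j\<in>active E I c x. u j *\<^sub>R gradient (peval (c j)) x) = 0 \<longrightarrow>
          (\<forall>j\<in>active E I c x. u j = 0))"

definition multipliers ::
  "'j set \<Rightarrow> 'j set \<Rightarrow> ('j \<Rightarrow> 'n::finite mpoly) \<Rightarrow> 'n mpoly \<Rightarrow> real ^ 'n \<Rightarrow> ('j \<Rightarrow> real) \<Rightarrow> bool" where
  "multipliers E I c F x lam \<longleftrightarrow>
     gradient (peval F) x = (\<Sum>j\<in>E \<union> I. lam j *\<^sub>R gradient (peval (c j)) x) \<and>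
     (\<forall>j\<in>I. lam j \<ge> 0 \<and> lam j * peval (c j) x = 0)"

definition scc ::
  "'j set \<Rightarrow> ('j \<Rightarrow> 'n::finite mpoly) \<Rightarrow> real ^ 'n \<Rightarrow> ('j \<Rightarrow> real) \<Rightarrow> bool" where
  "scc I c x lam \<longleftrightarrow> (\<forall>j\<in>I. lam j + peval (c j) x > 0)"

definition lagrangian ::
  "'j set \<Rightarrow> 'j set \<Rightarrow> ('j \<Rightarrow> 'n mpoly) \<Rightarrow> 'n mpoly \<Rightarrow> ('j \<Rightarrow> real) \<Rightarrow> 'n mpoly" where
  "lagrangian E I c F lam = F - (\<Sum>j\<in>E \<union> I. pconst (lam j) * c j)"

definition sosc ::
  "'j set \<Rightarrow> 'j set \<Rightarrow> ('j \<Rightarrow> 'n::finite mpoly) \<Rightarrow> 'n mpoly \<Rightarrow> real ^ 'n \<Rightarrow> ('j \<Rightarrow> real) \<Rightarrow> bool" where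
  "sosc E I c F x lam \<longleftrightarrow>
     (\<forall>v. v \<noteq> 0 \<and> (\<forall>j\<in>active E I c x. v \<bullet> gradient (peval (c j)) x = 0) \<longrightarrow>
          v \<bullet> (hessian (peval (lagrangian E I c F lam)) x *v v) > 0)"

text \<open>
  At a minimizer, the first condition makes the multipliers exist and be unique, so
  the quantifier over \<open>lam\<close> ranges over exactly one multiplier vector on \<open>E \<union> I\<close>.
\<close>

definition optimality_conditions ::
  "'j set \<Rightarrow> 'j set \<Rightarrow> ('j \<Rightarrow> 'n::finite mpoly) \<Rightarrow> 'n mpoly \<Rightarrow> real ^ 'n \<Rightarrow> bool" where
  "optimality_conditions E I c F x \<longleftrightarrow>
     licqc E I c x \<and>
     (\<forall>lam. multipliers E I c F x lam \<longrightarrow> scc I c x lam \<and> sosc E I c F x lam)"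

end

theory Submission
  imports Defs
begin

text \<open>
  Write \<open>p\<close> for either of the polynomials \<open>1 \<plusminus> \<Sum> \<theta>\<^sub>i a\<^sub>i\<close> at the maximizer. The core is that
  \<open>p - \<epsilon> h\<^sup>2\<close> lies in the quadratic module for some \<open>\<epsilon> > 0\<close> whenever \<open>h\<close> vanishes at the zeros
  of \<open>p\<close> on \<open>K\<close>. With \<open>h = 0\<close> this makes the maximizer feasible for (SDk) when \<open>k\<close> is large;
  with \<open>h = x\<^sup>\<alpha> - q\<^sub>\<alpha>\<close>, where \<open>q\<^sub>\<alpha>\<close> interpolates \<open>x\<^sup>\<alpha>\<close> at the finitely many zeros, it gives
  \<open>\<langle>h\<^sup>2, v\<rangle> = 0\<close> for every \<open>v\<close> with \<open>\<langle>p, v\<rangle> = 0\<close>, hence linear relations among the columns of the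
  moment matrices.

  For the core, the optimality conditions allow us to subtract from \<open>p\<close> an element of the quadratic
  module so that the difference \<open>p'\<close> stays positive on \<open>K\<close> off the zeros and has positive definite
  Hessian at them. Then \<open>p'\<close> lies in the ideal of all polynomials that vanish to second order at
  the zeros. If it were not in the quadratic module, Zorn's lemma would give a pure state \<open>\<phi>\<close> on
  this ideal with \<open>\<phi> p' \<le> 0\<close> and \<open>\<phi> (a b) = a(x) \<phi> b\<close> for some \<open>x \<in> K\<close>. But off the zeros \<open>\<phi>\<close> is
  a positive multiple of the evaluation at \<open>x\<close>, and at a zero it pairs the second order coefficients
  with a nonzero positive semidefinite matrix, so that \<open>\<phi> p' > 0\<close>.
\<close>

section \<open>Evaluation of polynomials and sums of squares\<close>

text \<open>The obstacle is that \<open>p\<close> has zeros on \<open>K\<close>, so the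
  representation results for strictly positive polynomials do not apply: a state on the whole ring
  may be evaluation at a zero, where \<open>p\<close> gives 0. Passing to polynomials with double
  zeros removes these states, since evaluation at a zero is trivial there and only second order
  behaviour is left. The price is that 1 is lost as order unit; the product of the squared distances
  to the zeros takes its place. This also forces the passage from \<open>p\<close> to
  \<open>p'\<close>: at a boundary zero \<open>p\<close> may have a nonzero gradient and so lie
  outside the ideal, and the multiplier terms that cancel the gradient have to be extended to
  elements of the module that fit all zeros at once. Finiteness of the zeros, used in the product
  and in the interpolation, is again a consequence of the optimality conditions. On the moment side,
  finitely many atoms in \<open>K\<close> represent \<open>b\<close> with total mass equal to the
  optimal value; they serve at every relaxation order, so no gap can open, and at a minimizer both
  pairings with the polynomials \<open>p\<close> vanish.\<close>

lemma pconst_0 [simp]: "pconst 0 = 0" by (simp add: pconst_def)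
lemma pconst_1 [simp]: "pconst 1 = 1" by (simp add: pconst_def)
lemma pconst_add: "pconst (r + s) = pconst r + pconst s" by (simp add: pconst_def single_add)
lemma pconst_mult: "pconst (r * s) = pconst r * pconst s" by (simp add: pconst_def mult_single)
lemma pconst_minus: "pconst (- r) = - pconst r" by (simp add: pconst_def single_uminus)
lemma pconst_diff: "pconst (r - s) = pconst r - pconst s" by (simp add: pconst_def single_diff)
lemma pconst_power: "pconst (r ^ k) = pconst r ^ k"
  by (induction k) (simp_all add: pconst_mult)
lemma pconst_numeral [simp]: "pconst (numeral k) = numeral k"
  by (simp add: pconst_def)

lemma pmonom_add: "pmonom (\<alpha> + \<beta>) = pmonom \<alpha> * pmonom \<beta>"
  by (simp add: pmonom_def mult_single)
lemma pmonom_0: "pmonom 0 = 1" by (simp add: pmonom_def)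

lemma monom_eval_add: "monom_eval (\<alpha> + \<beta>) x = monom_eval \<alpha> x * monom_eval \<beta> x"
  by (simp add: monom_eval_def lookup_add power_add prod.distrib)
lemma monom_eval_0 [simp]: "monom_eval 0 x = 1" by (simp add: monom_eval_def)

lemma peval_pairing: "peval p x = pairing p (\<lambda>\<alpha>. monom_eval \<alpha> x)"
  by (simp add: peval_def pairing_def)

lemma pairing_pmonom: "pairing (pmonom \<alpha>) y = y \<alpha>"
  by (simp add: pairing_def pmonom_def)

lemma pairing_0 [simp]: "pairing 0 y = 0" by (simp add: pairing_def)

lemma pairing_minus: "pairing (- p) y = - pairing p y"
  using pairing_pconst[of "-1" p y] by (simp add: pconst_minus)

lemma pairing_diff: "pairing (p - q) y = pairing p y - pairing q y"
  using pairing_add[of p "- q" y] by (simp add: pairing_minus)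

lemma peval_add [simp]: "peval (p + q) x = peval p x + peval q x"
  by (simp add: peval_pairing pairing_add)
lemma peval_diff [simp]: "peval (p - q) x = peval p x - peval q x"
  by (simp add: peval_pairing pairing_diff)
lemma peval_minus [simp]: "peval (- p) x = - peval p x"
  by (simp add: peval_pairing pairing_minus)
lemma peval_0 [simp]: "peval 0 x = 0" by (simp add: peval_def)
lemma peval_sum [simp]: "peval (\<Sum>i\<in>S. f i) x = (\<Sum>i\<in>S. peval (f i) x)"
  by (induction S rule: infinite_finite_induct) simp_all
lemma peval_pconst_mult: "peval (pconst r * p) x = r * peval p x"
  by (simp add: peval_pairing pairing_pconst)
lemma peval_pmonom: "peval (pmonom \<alpha>) x = monom_eval \<alpha> x"
  by (simp add: peval_pairing pairing_pmonom)
lemma peval_1 [simp]: "peval 1 x = 1"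
  using peval_pmonom[of 0 x] by (simp add: pmonom_0)
lemma peval_pconst [simp]: "peval (pconst r) x = r"
  using peval_pconst_mult[of r 1 x] by simp

lemma peval_mult [simp]: "peval (p * q) x = peval p x * peval q x"
proof -
  have e: "p = (\<Sum>\<alpha>\<in>Poly_Mapping.keys p. pconst (Poly_Mapping.lookup p \<alpha>) * pmonom \<alpha>)" for p :: "'a mpoly"
    by (rule poly_expand) auto
  have m: "peval (pmonom \<alpha> * pmonom \<beta>) x = monom_eval \<alpha> x * monom_eval \<beta> x" for \<alpha> \<beta>
    by (simp add: pmonom_add[symmetric] peval_pmonom monom_eval_add)
  have "p * q = (\<Sum>\<alpha>\<in>Poly_Mapping.keys p. \<Sum>\<beta>\<in>Poly_Mapping.keys q.
      pconst (Poly_Mapping.lookup p \<alpha>) * (pconst (Poly_Mapping.lookup q \<beta>) * (pmonom \<alpha> * pmonom \<beta>)))"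
    by (subst e[of p], subst e[of q]) (simp add: sum_product mult_ac)
  then have "peval (p * q) x = (\<Sum>\<alpha>\<in>Poly_Mapping.keys p. \<Sum>\<beta>\<in>Poly_Mapping.keys q.
      Poly_Mapping.lookup p \<alpha> * (Poly_Mapping.lookup q \<beta> * (monom_eval \<alpha> x * monom_eval \<beta> x)))"
    by (simp add: peval_pconst_mult m)
  then show ?thesis
    by (simp add: peval_def sum_product algebra_simps)
qed

lemma peval_power [simp]: "peval (p ^ k) x = peval p x ^ k"
  by (induction k) simp_all
lemma peval_prod [simp]: "peval (\<Prod>i\<in>S. f i) x = (\<Prod>i\<in>S. peval (f i) x)"
  by (induction S rule: infinite_finite_induct) simp_all
lemma peval_pvar [simp]: "peval (pvar i) x = x $ i"
proof -
  have "monom_eval (Poly_Mapping.single i 1) x = (\<Prod>j\<in>UNIV. if j = i then x $ i else 1)"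
    unfolding monom_eval_def by (rule prod.cong) (auto simp: lookup_single when_def)
  then show ?thesis by (simp add: pvar_def peval_pmonom)
qed
lemma peval_plin: "peval (plin \<theta> a) x = (\<Sum>i\<in>UNIV. \<theta> $ i * peval (a i) x)"
  by (simp add: plin_def peval_pconst_mult)

lemma pairing_plin: "pairing (plin \<theta> a) y = (\<Sum>i\<in>UNIV. \<theta> $ i * pairing (a i) y)"
  by (simp add: plin_def pairing_sum pairing_pconst)

lemma pmonom_prod: "pmonom (\<Sum>i\<in>S. f i) = (\<Prod>i\<in>S. pmonom (f i))"
  by (induction S rule: infinite_finite_induct) (simp_all add: pmonom_add pmonom_0)

lemma expo_sum: "(\<alpha> :: 'n::finite expo) = (\<Sum>i\<in>UNIV. Poly_Mapping.single i (Poly_Mapping.lookup \<alpha> i))"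
  by (rule poly_mapping_eqI) (simp add: lookup_sum lookup_single when_def)

lemma pmonom_single: "pmonom (Poly_Mapping.single i k) = pvar i ^ k"
proof (induction k)
  case (Suc k)
  have "Poly_Mapping.single i (Suc k) = Poly_Mapping.single i 1 + Poly_Mapping.single i k"
    by (simp add: single_add[symmetric])
  then show ?case by (simp add: pmonom_add Suc pvar_def)
qed (simp add: pmonom_0)

lemma pmonom_eq_prod: "pmonom \<alpha> = (\<Prod>i\<in>UNIV. pvar (i::'n::finite) ^ Poly_Mapping.lookup \<alpha> i)"
  by (subst expo_sum) (simp add: pmonom_prod pmonom_single)

text \<open>The variables generate the algebra. Continuity, differentiability, first order
  expansions and boundedness modulo \<open>M\<close> pass to sums and products, so this rule spares
  arguments on coefficients.\<close>

lemma mpoly_induct [case_names const var add mult]: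
  fixes p :: "'n::finite mpoly"
  assumes c: "\<And>r. P (pconst r)" and v: "\<And>i. P (pvar i)"
    and a: "\<And>p q. P p \<Longrightarrow> P q \<Longrightarrow> P (p + q)" and m: "\<And>p q. P p \<Longrightarrow> P q \<Longrightarrow> P (p * q)"
  shows "P p"
proof -
  have pw: "P (q ^ k)" if "P q" for q k
    by (induction k) (use c[of 1] m that in auto)
  have pr: "P (\<Prod>i\<in>S. f i)" if "\<And>i. P (f i)" for f :: "'n \<Rightarrow> 'n mpoly" and S
    by (induction S rule: infinite_finite_induct) (use c[of 1] m that in auto)
  have mon: "P (pmonom \<alpha>)" for \<alpha>
    by (simp add: pmonom_eq_prod pr pw v)
  have sm: "P (\<Sum>\<alpha>\<in>S. f \<alpha>)" if "\<And>\<alpha>. P (f \<alpha>)" for f :: "'n expo \<Rightarrow> 'n mpoly" and S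
    by (induction S rule: infinite_finite_induct) (use c[of 0] a that in auto)
  have "P (\<Sum>\<alpha>\<in>Poly_Mapping.keys p. pconst (Poly_Mapping.lookup p \<alpha>) * pmonom \<alpha>)"
    by (intro sm m c mon)
  then show ?thesis using poly_expand[of "Poly_Mapping.keys p" p] by simp
qed

text \<open>Turns the character obtained from a pure state into a point of the space, whose
  coordinates are the values on the variables.\<close>

lemma ring_hom_eq_peval:
  fixes h :: "'n::finite mpoly \<Rightarrow> real"
  assumes "\<And>r. h (pconst r) = r" "\<And>p q. h (p + q) = h p + h q" "\<And>p q. h (p * q) = h p * h q"
  shows "h p = peval p (\<chi> i. h (pvar i))"
  by (induction p rule: mpoly_induct) (simp_all add: assms)

lemma continuous_on_peval [continuous_intros]: "continuous_on A (peval p)"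
proof (induction p rule: mpoly_induct)
  case (const r) show ?case by simp
next
  case (var i) show ?case by (simp add: continuous_intros)
next
  case (add p q) then show ?case by (simp add: continuous_intros)
next
  case (mult p q) then show ?case by (simp add: continuous_intros)
qed

lemma isCont_peval: "isCont (peval p) x"
  using continuous_on_peval[of UNIV p] by (simp add: continuous_on_eq_continuous_at)

section \<open>The semiring of sums of squares\<close>

lemma SOS_0 [simp]: "0 \<in> SOS"
  unfolding SOS_def by (simp, rule exI[of _ 0], simp)

lemma SOS_sq [simp]: "q\<^sup>2 \<in> SOS"
  unfolding SOS_def by (simp, rule exI[of _ 1], rule exI[of _ "\<lambda>_. q"], simp)

lemma SOS_add: "p \<in> SOS \<Longrightarrow> q \<in> SOS \<Longrightarrow> p + q \<in> SOS"
proof -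
  assume "p \<in> SOS" "q \<in> SOS"
  then obtain N f N' g where pq: "p = (\<Sum>i<(N::nat). (f i)\<^sup>2)" "q = (\<Sum>i<(N'::nat). (g i)\<^sup>2)"
    unfolding SOS_def by auto
  let ?h = "\<lambda>i. if i < N then f i else g (i - N)"
  have d: "{..<N + N'} = {..<N} \<union> {N..<N + N'}" by auto
  have "(\<Sum>i<N + N'. (?h i)\<^sup>2) = (\<Sum>i<N. (?h i)\<^sup>2) + (\<Sum>i=N..<N+N'. (?h i)\<^sup>2)"
    unfolding d by (rule sum.union_disjoint) auto
  also have "(\<Sum>i=N..<N+N'. (?h i)\<^sup>2) = (\<Sum>i<N'. (g i)\<^sup>2)"
    using sum.shift_bounds_nat_ivl[of "\<lambda>i. (?h i)\<^sup>2" 0 N N'] by (simp add: add.commute atLeast0LessThan)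
  finally have "p + q = (\<Sum>i<N + N'. (?h i)\<^sup>2)" by (simp add: pq)
  then show ?thesis
    unfolding SOS_def mem_Collect_eq by (intro exI[of _ "N + N'"] exI[of _ ?h]) simp
qed

lemma SOS_sum: "(\<And>i. i \<in> S \<Longrightarrow> f i \<in> SOS) \<Longrightarrow> (\<Sum>i\<in>S. f i) \<in> SOS"
  by (induction S rule: infinite_finite_induct) (auto intro: SOS_add)

lemma SOS_induct [consumes 1, case_names zero add]:
  assumes "s \<in> SOS" and z: "P 0" and a: "\<And>q s. s \<in> SOS \<Longrightarrow> P s \<Longrightarrow> P (q\<^sup>2 + s)"
  shows "P s"
proof -
  have "P (\<Sum>i<(N::nat). (q i)\<^sup>2)" for N q
    by (induction N) (simp_all add: z a add.commute SOS_sum)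
  then show ?thesis using assms(1) unfolding SOS_def by auto
qed

lemma SOS_mult_sq: "s \<in> SOS \<Longrightarrow> q\<^sup>2 * s \<in> SOS"
  by (induction rule: SOS_induct)
    (simp_all add: distrib_left power_mult_distrib[symmetric] SOS_add)

lemma SOS_mult: "s \<in> SOS \<Longrightarrow> t \<in> SOS \<Longrightarrow> s * t \<in> SOS"
  by (induction rule: SOS_induct) (auto simp: distrib_right intro: SOS_add SOS_mult_sq)

lemma SOS_pconst: "r \<ge> 0 \<Longrightarrow> pconst r \<in> SOS"
  using SOS_sq[of "pconst (sqrt r)"] by (simp add: pconst_power[symmetric])

lemma SOS_1 [simp]: "1 \<in> SOS" using SOS_sq[of 1] by simp

lemma SOS_prod: "(\<And>i. i \<in> S \<Longrightarrow> f i \<in> SOS) \<Longrightarrow> (\<Prod>i\<in>S. f i) \<in> SOS"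
  by (induction S rule: infinite_finite_induct) (auto intro: SOS_mult)

section \<open>Archimedean quadratic modules and pure states on ideals\<close>

locale quadratic_module =
  fixes M :: "'n::finite mpoly set"
  assumes one_mem: "1 \<in> M"
    and add_mem: "p \<in> M \<Longrightarrow> q \<in> M \<Longrightarrow> p + q \<in> M"
    and sq_mult_mem: "p \<in> M \<Longrightarrow> q\<^sup>2 * p \<in> M"
begin

lemma zero_mem: "0 \<in> M"
  using sq_mult_mem[OF one_mem, of 0] by simp

lemma SOS_mult_mem: "s \<in> SOS \<Longrightarrow> m \<in> M \<Longrightarrow> s * m \<in> M"
  by (induction rule: SOS_induct) (simp_all add: zero_mem distrib_right add_mem sq_mult_mem)

lemma SOS_mem: "s \<in> SOS \<Longrightarrow> s \<in> M"
  using SOS_mult_mem[OF _ one_mem] by simp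

text \<open>In the preorder defined by \<open>M\<close>, \<open>b\<close> lies between
  \<open>-N u\<close> and \<open>N u\<close>. For \<open>u = 1\<close> these are the bounded
  elements of the ring; for \<open>u = node_poly S\<close> the relation will express that
  \<open>u\<close> is an order unit.\<close>

definition bdd_by :: "'n mpoly \<Rightarrow> 'n mpoly \<Rightarrow> bool" where
  "bdd_by u b \<longleftrightarrow> (\<exists>N\<ge>0. pconst N * u - b \<in> M \<and> pconst N * u + b \<in> M)"

lemma pconst_mult_mem: "p \<in> M \<Longrightarrow> r \<ge> 0 \<Longrightarrow> pconst r * p \<in> M"
  by (intro SOS_mult_mem SOS_pconst)

lemma bdd_by_0: "bdd_by u 0" unfolding bdd_by_def by (rule exI[of _ 0]) (simp add: zero_mem)

lemma bdd_by_minus: "bdd_by u b \<Longrightarrow> bdd_by u (- b)" by (auto simp: bdd_by_def)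

lemma bdd_by_add:
  assumes "bdd_by u a" "bdd_by u b" shows "bdd_by u (a + b)"
proof -
  obtain N1 where 1: "N1 \<ge> 0" "pconst N1 * u - a \<in> M" "pconst N1 * u + a \<in> M"
    using assms(1) by (auto simp: bdd_by_def)
  obtain N2 where 2: "N2 \<ge> 0" "pconst N2 * u - b \<in> M" "pconst N2 * u + b \<in> M"
    using assms(2) by (auto simp: bdd_by_def)
  have "pconst (N1 + N2) * u - (a + b) \<in> M" "pconst (N1 + N2) * u + (a + b) \<in> M"
    using add_mem[OF 1(2) 2(2)] add_mem[OF 1(3) 2(3)] by (simp_all add: pconst_add algebra_simps)
  then show ?thesis using 1(1) 2(1) unfolding bdd_by_def by (auto intro!: exI[of _ "N1 + N2"])
qed

lemma bdd_by_sum: "(\<And>i. i \<in> S \<Longrightarrow> bdd_by u (f i)) \<Longrightarrow> bdd_by u (\<Sum>i\<in>S. f i)"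
  by (induction S rule: infinite_finite_induct) (auto simp: bdd_by_0 bdd_by_add)

lemma bdd_by_sq: "bdd_by u b \<Longrightarrow> bdd_by (q\<^sup>2 * u) (q\<^sup>2 * b)"
proof -
  assume "bdd_by u b"
  then obtain N where N: "N \<ge> 0" "pconst N * u - b \<in> M" "pconst N * u + b \<in> M" by (auto simp: bdd_by_def)
  then show ?thesis unfolding bdd_by_def
    using sq_mult_mem[OF N(2), of q] sq_mult_mem[OF N(3), of q]
    by (intro exI[of _ N]) (simp add: algebra_simps)
qed

lemma bdd_by_mono:
  assumes "bdd_by u b" "pconst r * u' - u \<in> M" "r \<ge> 0" shows "bdd_by u' b"
proof -
  obtain N where N: "N \<ge> 0" "pconst N * u - b \<in> M" "pconst N * u + b \<in> M"
    using assms(1) by (auto simp: bdd_by_def)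
  have "pconst N * (pconst r * u' - u) \<in> M" by (intro pconst_mult_mem assms N)
  from add_mem[OF this N(2)] add_mem[OF this N(3)]
  show ?thesis unfolding bdd_by_def using N(1) assms(3)
    by (intro exI[of _ "N * r"]) (simp add: pconst_mult algebra_simps)
qed

lemma bdd_by_pconst: "bdd_by u b \<Longrightarrow> bdd_by u (pconst r * b)"
proof -
  assume b: "bdd_by u b"
  have p: "bdd_by u (pconst r * b)" if "r \<ge> 0" for r
  proof -
    obtain N where N: "N \<ge> 0" "pconst N * u - b \<in> M" "pconst N * u + b \<in> M"
      using b by (auto simp: bdd_by_def)
    show ?thesis unfolding bdd_by_def
      using pconst_mult_mem[OF N(2) that] pconst_mult_mem[OF N(3) that] that N(1)
      by (intro exI[of _ "r * N"]) (simp add: pconst_mult algebra_simps)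
  qed
  show ?thesis
    using p[of r] bdd_by_minus[OF p[of "- r"]] by (cases "r \<ge> 0") (auto simp: pconst_minus)
qed

text \<open>\<open>M\<close> need not be closed under products, so \<open>N^2 - p^2\<close> cannot
  be obtained by multiplying \<open>N - p\<close> and \<open>N + p\<close>. The identity
  \<open>(N + p)^2 (N - p) + (N - p)^2 (N + p) = 2 N (N^2 - p^2)\<close> uses only squares as
  factors.\<close>

lemma bdd_by_one_square:
  assumes "bdd_by 1 p" shows "bdd_by 1 (p\<^sup>2)"
proof -
  obtain N0 where 0: "N0 \<ge> 0" "pconst N0 - p \<in> M" "pconst N0 + p \<in> M"
    using assms by (auto simp: bdd_by_def)
  \<comment> \<open>Adding 1 makes the bound positive, since the identity is divided by
    \<open>2 N\<close>.\<close>
  define N where "N = N0 + 1"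
  have N: "N > 0" "pconst N - p \<in> M" "pconst N + p \<in> M"
    using 0 add_mem[OF 0(2) one_mem] add_mem[OF 0(3) one_mem] by (auto simp: N_def pconst_add algebra_simps)
  have "(pconst N + p)\<^sup>2 * (pconst N - p) + (pconst N - p)\<^sup>2 * (pconst N + p) \<in> M"
    by (intro add_mem sq_mult_mem N)
  then have "pconst (inverse (2 * N)) *
      ((pconst N + p)\<^sup>2 * (pconst N - p) + (pconst N - p)\<^sup>2 * (pconst N + p)) \<in> M"
    by (rule pconst_mult_mem) (use N(1) in simp)
  also have "(pconst N + p)\<^sup>2 * (pconst N - p) + (pconst N - p)\<^sup>2 * (pconst N + p) =
      pconst (2 * N) * (pconst (N\<^sup>2) - p\<^sup>2)"
    by (simp add: pconst_mult pconst_power algebra_simps power2_eq_square)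
  also have "pconst (inverse (2 * N)) * (pconst (2 * N) * (pconst (N\<^sup>2) - p\<^sup>2)) =
      pconst (inverse (2 * N) * (2 * N)) * (pconst (N\<^sup>2) - p\<^sup>2)"
    by (simp only: pconst_mult mult.assoc)
  finally have "pconst (N\<^sup>2) - p\<^sup>2 \<in> M" using N(1) by simp
  moreover have "pconst (N\<^sup>2) + p\<^sup>2 \<in> M" by (intro add_mem SOS_mem SOS_pconst SOS_sq) simp
  ultimately show ?thesis unfolding bdd_by_def by (intro exI[of _ "N\<^sup>2"]) simp
qed

end

locale arch_qm = quadratic_module M for M :: "'n::finite mpoly set" +
  assumes arch: "\<exists>N. pconst N - q \<in> M"

context quadratic_module
begin

text \<open>The elements bounded by constants form a subring: products reduce to squares by
  \<open>4 p q = (p + q)^2 - (p - q)^2\<close>. It contains the variables, because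
  \<open>R - x_i^2\<close> lies in \<open>M\<close> and adding \<open>(x_i + r)^2\<close> with
  \<open>r = 1\<close> or \<open>r = -1\<close> leaves \<open>R + 1 + 2 r x_i\<close>.\<close>

lemma archimedean_arch_qm:
  assumes ar: "archimedean M"
  shows "arch_qm M"
proof -
  have mult: "bdd_by 1 (p * q)" if "bdd_by 1 p" "bdd_by 1 q" for p q
  proof -
    have "bdd_by 1 (pconst (1/4) * ((p + q)\<^sup>2 + pconst (-1) * (p + pconst (-1) * q)\<^sup>2))"
      by (intro bdd_by_pconst bdd_by_add bdd_by_one_square that)
    also have "(p + q)\<^sup>2 + pconst (-1) * (p + pconst (-1) * q)\<^sup>2 = pconst 4 * (p * q)"
      by (simp add: pconst_minus power2_eq_square algebra_simps)
    also have "pconst (1/4) * \<dots> = pconst (1/4 * 4) * (p * q)"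
      by (simp only: pconst_mult mult.assoc)
    finally show ?thesis by simp
  qed
  obtain R where R: "R > 0" "pconst R - (\<Sum>i\<in>UNIV. (pvar i)\<^sup>2) \<in> M"
    using ar by (auto simp: archimedean_def)
  have var: "bdd_by 1 (pvar i)" for i
  proof -
    have e: "(\<Sum>j\<in>UNIV. (pvar j)\<^sup>2) = (pvar i)\<^sup>2 + (\<Sum>j\<in>UNIV-{i}. (pvar j :: 'n mpoly)\<^sup>2)"
      by (simp add: sum.remove)
    have "(\<Sum>j\<in>UNIV-{i}. (pvar j)\<^sup>2) \<in> M" by (intro SOS_mem SOS_sum SOS_sq)
    from add_mem[OF R(2) this] have 1: "pconst R - (pvar i)\<^sup>2 \<in> M" by (simp add: e)
    have half: "pconst ((R + 1) / 2) + r * pvar i \<in> M" if "r = 1 \<or> r = -1" for r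
    proof -
      have "pconst R - (pvar i)\<^sup>2 + (pvar i + r)\<^sup>2 \<in> M" by (intro add_mem 1 SOS_mem SOS_sq)
      moreover have "pconst R - (pvar i)\<^sup>2 + (pvar i + r)\<^sup>2 = pconst (R + 1) + pconst 2 * (r * pvar i)"
        using that by (auto simp: pconst_add power2_eq_square algebra_simps)
      ultimately have "pconst (R + 1) + pconst 2 * (r * pvar i) \<in> M" by (simp only:)
      then have "pconst (1/2) * (pconst (R + 1) + pconst 2 * (r * pvar i)) \<in> M"
        by (rule pconst_mult_mem) simp
      then show ?thesis
        by (simp only: distrib_left mult.assoc[symmetric] pconst_mult[symmetric]) (simp add: add_divide_distrib)
    qed
    show ?thesis unfolding bdd_by_def
      using half[of 1] half[of "-1"] R(1) by (auto intro!: exI[of _ "(R + 1) / 2"])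
  qed
  have "bdd_by 1 q" for q
  proof (induction q rule: mpoly_induct)
    case (const r)
    then show ?case unfolding bdd_by_def
      by (auto intro!: exI[of _ "\<bar>r\<bar>"] SOS_mem SOS_pconst simp: pconst_diff[symmetric] pconst_add[symmetric])
  qed (use var bdd_by_add mult in auto)
  then have "\<exists>N. pconst N - q \<in> M" for q unfolding bdd_by_def by auto
  then show ?thesis by unfold_locales
qed

end

text \<open>In the application \<open>J\<close> consists of the polynomials with double zeros at
  prescribed nodes, so \<open>u\<close> takes over the role of 1 as order unit.
  \<open>u_mult\<close> makes \<open>m \<mapsto> h (m * u)\<close> nonnegative on \<open>M\<close>
  for a state \<open>h\<close>, which places the evaluation point in the set where \<open>M\<close>
  is nonnegative.\<close>

locale pure_state = arch_qm M for M :: "'n::finite mpoly set" +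
  fixes J :: "'n::finite mpoly set" and u :: "'n mpoly"
  assumes J_add: "p \<in> J \<Longrightarrow> q \<in> J \<Longrightarrow> p + q \<in> J"
    and J_mult: "p \<in> J \<Longrightarrow> q * p \<in> J"
    and u_J: "u \<in> J"
    and order_unit: "p \<in> J \<Longrightarrow> \<exists>N. pconst N * u - p \<in> M"
    and u_mult: "p \<in> M \<Longrightarrow> u * p \<in> M"
begin

text \<open>The counterpart, inside \<open>J\<close>, of a quadratic module containing
  \<open>M\<close>.\<close>

definition cone :: "'n mpoly set \<Rightarrow> bool" where
  "cone P \<longleftrightarrow> M \<inter> J \<subseteq> P \<and> P \<subseteq> J \<and> (\<forall>p\<in>P. \<forall>q\<in>P. p + q \<in> P) \<and> (\<forall>p\<in>P. \<forall>q. q\<^sup>2 * p \<in> P)"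

lemma J_zero: "0 \<in> J" using J_mult[OF u_J, of 0] by simp
lemma J_minus: "p \<in> J \<Longrightarrow> - p \<in> J" using J_mult[of p "- 1"] by simp
lemma J_diff: "p \<in> J \<Longrightarrow> q \<in> J \<Longrightarrow> p - q \<in> J" using J_add[of p "- q"] J_minus by simp
lemma J_mult': "p \<in> J \<Longrightarrow> p * q \<in> J" using J_mult[of p q] by (simp add: mult.commute)

lemma u_mem: "u \<in> M" using u_mult[OF one_mem] by simp

context
  fixes P assumes P: "cone P"
begin

lemma cone_add: "p \<in> P \<Longrightarrow> q \<in> P \<Longrightarrow> p + q \<in> P" using P by (auto simp: cone_def)
lemma cone_sq: "p \<in> P \<Longrightarrow> q\<^sup>2 * p \<in> P" using P by (auto simp: cone_def)
lemma cone_J: "p \<in> P \<Longrightarrow> p \<in> J" using P by (auto simp: cone_def)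
lemma cone_M: "p \<in> M \<Longrightarrow> p \<in> J \<Longrightarrow> p \<in> P" using P by (auto simp: cone_def)
lemma cone_0: "0 \<in> P" by (intro cone_M zero_mem J_zero)
lemma cone_SOS: "s \<in> SOS \<Longrightarrow> p \<in> P \<Longrightarrow> s * p \<in> P"
  by (induction rule: SOS_induct) (simp_all add: cone_0 distrib_right cone_add cone_sq)
lemma cone_pconst: "p \<in> P \<Longrightarrow> r \<ge> 0 \<Longrightarrow> pconst r * p \<in> P"
  by (intro cone_SOS SOS_pconst)
lemma cone_u: "r \<ge> 0 \<Longrightarrow> pconst r * u \<in> P"
  by (intro cone_pconst cone_M u_mem u_J)

lemma cone_order_unit:
  assumes "p \<in> J" shows "\<exists>N0. \<forall>N\<ge>N0. pconst N * u - p \<in> P"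
proof -
  obtain N0 where N0: "pconst N0 * u - p \<in> M" using order_unit[OF assms] by blast
  have "pconst N * u - p \<in> P" if "N \<ge> N0" for N
  proof -
    have "(pconst N0 * u - p) + pconst (N - N0) * u \<in> P"
      by (intro cone_add cone_M N0 cone_u J_diff J_mult u_J assms) (use that in auto)
    then show ?thesis by (simp add: pconst_diff algebra_simps)
  qed
  then show ?thesis by blast
qed

text \<open>Replaces division by \<open>s\<close>. If \<open>g + r u\<close> is in \<open>P\<close>
  with \<open>r \<ge> 0\<close>, then \<open>(N - s)^2 (g + r u) + 2 N (s g - u) + (2 N u - s^2 g -
  u) + r u s (2 N - s)\<close> equals \<open>N^2 (g + r u) - u\<close>, so \<open>r\<close> can be
  lowered by \<open>1 / N^2\<close>. From a large initial \<open>r\<close>, which the order unit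
  provides, finitely many such steps reach \<open>r \<le> 0\<close>.\<close>

lemma cone_absorb:
  assumes s: "s \<in> SOS" and g: "g \<in> J" and sg: "s * g - u \<in> P"
  shows "g \<in> P"
proof -
  obtain N1 where N1: "\<And>N. N \<ge> N1 \<Longrightarrow> pconst N * u - (s\<^sup>2 * g + u) \<in> P"
    using cone_order_unit[of "s\<^sup>2 * g + u"] J_add J_mult g u_J by blast
  obtain N2 where N2: "pconst N2 - s \<in> M" using arch by blast
  \<comment> \<open>\<open>2 N\<close> has to bound \<open>s^2 g + u\<close> in terms of
    \<open>u\<close> and \<open>s\<close> in terms of 1, so that the last two summands of the
    identity are in \<open>P\<close>.\<close>
  define N where "N = max 1 (max N1 N2)"
  have N: "N \<ge> 1" "2 * N \<ge> N1" "2 * N \<ge> N2" by (auto simp: N_def)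
  have a: "pconst (2 * N) * u - (s\<^sup>2 * g + u) \<in> P" using N1 N by blast
  have "(pconst N2 - s) + pconst (2 * N - N2) \<in> M"
    by (intro add_mem N2 SOS_mem SOS_pconst) (use N in auto)
  then have "pconst (2 * N) - s \<in> M" by (simp add: pconst_diff)
  then have b: "u * (s * (pconst (2 * N) - s)) \<in> P"
    by (intro cone_M u_mult SOS_mult_mem s J_mult' u_J)
  have step: "g + pconst (r - 1 / N\<^sup>2) * u \<in> P" if r: "r \<ge> 0" "g + pconst r * u \<in> P" for r
  proof -
    have "(pconst N - s)\<^sup>2 * (g + pconst r * u) + pconst (2 * N) * (s * g - u)
        + (pconst (2 * N) * u - (s\<^sup>2 * g + u)) + pconst r * (u * (s * (pconst (2 * N) - s))) \<in> P"
      by (intro cone_add cone_sq cone_pconst a b sg r) (use N in auto)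
    also have "(pconst N - s)\<^sup>2 * (g + pconst r * u) + pconst (2 * N) * (s * g - u)
        + (pconst (2 * N) * u - (s\<^sup>2 * g + u)) + pconst r * (u * (s * (pconst (2 * N) - s)))
        = pconst (N\<^sup>2) * (g + pconst r * u) - u"
      by (simp add: pconst_mult pconst_power power2_eq_square algebra_simps)
    finally have "pconst (1 / N\<^sup>2) * (pconst (N\<^sup>2) * (g + pconst r * u) - u) \<in> P"
      by (rule cone_pconst) simp
    also have "pconst (1 / N\<^sup>2) * (pconst (N\<^sup>2) * (g + pconst r * u) - u)
       = (pconst (1 / N\<^sup>2) * pconst (N\<^sup>2)) * (g + pconst r * u) - pconst (1 / N\<^sup>2) * u"
      by (simp add: algebra_simps)
    also have "\<dots> = g + pconst (r - 1 / N\<^sup>2) * u"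
      using N(1) by (simp add: pconst_mult[symmetric] pconst_diff algebra_simps)
    finally show ?thesis .
  qed
  obtain R where R: "pconst (max 0 R) * u - (- g) \<in> P"
    using cone_order_unit[OF J_minus[OF g]] by (meson max.cobounded2)
  have "\<exists>r\<le>0. g + pconst r * u \<in> P"
  proof (rule ccontr)
    assume neg: "\<not> ?thesis"
    have "g + pconst (max 0 R - real j / N\<^sup>2) * u \<in> P" for j
    proof (induction j)
      case (Suc j)
      then have "max 0 R - real j / N\<^sup>2 \<ge> 0" using neg by (meson linear)
      from step[OF this Suc] show ?case by (simp add: add_divide_distrib algebra_simps)
    qed (use R in \<open>simp add: algebra_simps\<close>)
    moreover obtain j where "real j > max 0 R * N\<^sup>2" using reals_Archimedean2 by blast
    then have "max 0 R - real j / N\<^sup>2 \<le> 0" using N(1) by (simp add: field_simps)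
    ultimately show False using neg by blast
  qed
  then obtain r where r: "r \<le> 0" "g + pconst r * u \<in> P" by blast
  have "g + pconst r * u + pconst (- r) * u \<in> P"
    by (intro cone_add r cone_u) (use r in auto)
  then show ?thesis by (simp add: pconst_minus)
qed

lemma cone_adjoin_subset: "P \<subseteq> {p + s * g |p s. p \<in> P \<and> s \<in> SOS}"
proof
  fix p assume "p \<in> P"
  then show "p \<in> {p + s * g |p s. p \<in> P \<and> s \<in> SOS}"
    by (intro CollectI exI[of _ p] exI[of _ 0]) simp
qed

lemma cone_adjoin:
  assumes "g \<in> J"
  shows "cone {p + s * g |p s. p \<in> P \<and> s \<in> SOS}"
proof -
  have 1: "p \<in> {p + s * g |p s. p \<in> P \<and> s \<in> SOS}" if "p \<in> P" for p
    using that by (intro CollectI exI[of _ p] exI[of _ 0]) simp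
  have "\<exists>p' s'. p + s * g + (q + t * g) = p' + s' * g \<and> p' \<in> P \<and> s' \<in> SOS"
    if "p \<in> P" "q \<in> P" "s \<in> SOS" "t \<in> SOS" for p q s t
    by (rule exI[of _ "p + q"], rule exI[of _ "s + t"]) (use that in \<open>simp add: algebra_simps cone_add SOS_add\<close>)
  moreover have "\<exists>p' s'. q\<^sup>2 * (p + s * g) = p' + s' * g \<and> p' \<in> P \<and> s' \<in> SOS"
    if "p \<in> P" "s \<in> SOS" for p q s
    by (rule exI[of _ "q\<^sup>2 * p"], rule exI[of _ "q\<^sup>2 * s"]) (use that in \<open>simp add: distrib_left mult.assoc cone_sq SOS_mult_sq\<close>)
  moreover have "p + s * g \<in> J" if "p \<in> P" for p s
    using that by (intro J_add J_mult assms cone_J)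
  ultimately show ?thesis
    unfolding cone_def using 1 cone_M by auto
qed

end

section \<open>Maximal cones in the ideal and the states they define\<close>

lemma cone_base: "cone (M \<inter> J)"
  by (auto simp: cone_def add_mem J_add sq_mult_mem J_mult)

text \<open>If \<open>-g\<close> is not in a maximal \<open>P\<close>, adjoining \<open>-g\<close>
  must produce \<open>-u\<close>, that is \<open>s g - u \<in> P\<close> for some sum of squares
  \<open>s\<close>, and \<open>cone_absorb\<close> yields \<open>g \<in> P\<close>. So a maximal
  cone decides the sign of every element of \<open>J\<close>.\<close>

lemma maximal_cone:
  assumes "cone P0" "- u \<notin> P0"
  obtains P where "cone P" "P0 \<subseteq> P" "- u \<notin> P" "\<And>g. g \<in> J \<Longrightarrow> g \<in> P \<or> - g \<in> P"
proof -
  define A where "A = {P. cone P \<and> P0 \<subseteq> P \<and> - u \<notin> P}"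
  have "\<exists>P\<in>A. \<forall>X\<in>A. P \<subseteq> X \<longrightarrow> X = P"
  proof (rule subset_Zorn_nonempty)
    show "A \<noteq> {}" using assms by (auto simp: A_def)
  next
    fix C assume C: "C \<noteq> {}" "subset.chain A C"
    have CA: "cone P" "P0 \<subseteq> P" "- u \<notin> P" if "P \<in> C" for P
      using that C(2) by (auto simp: subset.chain_def A_def)
    have "p + q \<in> \<Union>C" if "p \<in> \<Union>C" "q \<in> \<Union>C" for p q
    proof -
      obtain X Y where XY: "X \<in> C" "Y \<in> C" "p \<in> X" "q \<in> Y" using \<open>p \<in> \<Union>C\<close> \<open>q \<in> \<Union>C\<close> by auto
      then have "X \<subseteq> Y \<or> Y \<subseteq> X" using C(2) by (auto simp: subset.chain_def)
      then show ?thesis using XY cone_add[OF CA(1)[OF XY(1)], of p q] cone_add[OF CA(1)[OF XY(2)], of p q] by blast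
    qed
    moreover have "q\<^sup>2 * p \<in> \<Union>C" if "p \<in> \<Union>C" for p q
      using that CA(1) cone_sq by blast
    moreover have "M \<inter> J \<subseteq> \<Union>C" "P0 \<subseteq> \<Union>C" "\<Union>C \<subseteq> J" "- u \<notin> \<Union>C"
      using C(1) CA cone_M cone_J by blast+
    ultimately show "\<Union>C \<in> A" by (auto simp: A_def cone_def)
  qed
  then obtain P where P: "cone P" "P0 \<subseteq> P" "- u \<notin> P" and max: "\<And>X. X \<in> A \<Longrightarrow> P \<subseteq> X \<Longrightarrow> X = P"
    by (auto simp: A_def)
  have "g \<in> P \<or> - g \<in> P" if g: "g \<in> J" for g
  proof (rule disjCI)
    assume ng: "- g \<notin> P"
    let ?X = "{p + s * (- g) |p s. p \<in> P \<and> s \<in> SOS}"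
    have sub: "P \<subseteq> ?X" using cone_adjoin_subset[OF P(1)] .
    have "- g \<in> ?X" using cone_0[OF P(1)] SOS_1 by (intro CollectI exI[of _ 0] exI[of _ 1]) simp
    then have "?X \<noteq> P" using ng by blast
    then have "?X \<notin> A" using max sub by blast
    then have "- u \<in> ?X" using cone_adjoin[OF P(1) J_minus[OF g]] P(2) sub by (auto simp: A_def)
    then obtain p s where ps: "- u = p + s * (- g)" "p \<in> P" "s \<in> SOS" by auto
    then have "s * g - u = p" by (simp add: algebra_simps)
    then show "g \<in> P" using cone_absorb[OF P(1) ps(3) g] ps(2) by simp
  qed
  then show thesis using that P by blast
qed


text \<open>\<open>-f\<close> is adjoined to \<open>M \<inter> J\<close>, and \<open>h\<close> is
  read off from a maximal cone as a Dedekind cut relative to \<open>u\<close>. Multiplicativity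
  comes from the kernel of \<open>h\<close>: it is stable under multiplication by arbitrary
  polynomials, and it contains \<open>p - h(p) u\<close>.\<close>

lemma state:
  assumes f: "f \<in> J" "f \<notin> M"
  obtains h x where "\<And>p q. p \<in> J \<Longrightarrow> q \<in> J \<Longrightarrow> h (p + q) = h p + (h q :: real)" "h u = 1"
    "\<And>p. p \<in> M \<Longrightarrow> p \<in> J \<Longrightarrow> h p \<ge> 0"
    "\<And>a p. p \<in> J \<Longrightarrow> h (a * p) = peval a x * h p"
    "h f \<le> 0" "\<And>m. m \<in> M \<Longrightarrow> peval m x \<ge> 0"
proof -
  \<comment> \<open>If \<open>-u\<close> were reached, \<open>s f - u\<close> would lie in
    \<open>M \<inter> J\<close>, and \<open>cone_absorb\<close> for this smallest cone would put
    \<open>f\<close> into \<open>M\<close>.\<close>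
  have "- u \<notin> {p + s * (- f) |p s. p \<in> M \<inter> J \<and> s \<in> SOS}"
  proof
    assume "- u \<in> {p + s * (- f) |p s. p \<in> M \<inter> J \<and> s \<in> SOS}"
    then obtain p s where ps: "- u = p + s * (- f)" "p \<in> M \<inter> J" "s \<in> SOS" by auto
    then have "s * f - u = p" by (simp add: algebra_simps)
    then show False using cone_absorb[OF cone_base ps(3) f(1)] ps(2) f(2) by simp
  qed
  from maximal_cone[OF cone_adjoin[OF cone_base J_minus[OF f(1)]] this]
  obtain P where P: "cone P" and sub: "{p + s * (- f) |p s. p \<in> M \<inter> J \<and> s \<in> SOS} \<subseteq> P"
    and nu: "- u \<notin> P" and tot: "\<And>g. g \<in> J \<Longrightarrow> g \<in> P \<or> - g \<in> P" by blast
  have fP: "- f \<in> P"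
    by (rule subsetD[OF sub], intro CollectI exI[of _ 0] exI[of _ 1]) (simp add: zero_mem J_zero)
  have upos: "r \<ge> 0" if "pconst r * u \<in> P" for r
  proof (rule ccontr)
    assume r: "\<not> r \<ge> 0"
    have "pconst (- (1 / r)) * (pconst r * u) \<in> P" by (rule cone_pconst[OF P that]) (use r in auto)
    moreover have "pconst (- (1 / r)) * (pconst r * u) = pconst (- (1 / r) * r) * u"
      by (simp only: pconst_mult mult.assoc)
    ultimately show False using r nu by (simp add: pconst_minus)
  qed
  \<comment> \<open>The lower half of the cut that compares \<open>a\<close> with the multiples of
    \<open>u\<close>. Since \<open>P\<close> decides signs, the cuts of \<open>a\<close> and
    \<open>-a\<close> are opposite, which makes \<open>h\<close> odd; together with superadditivity
    this gives additivity.\<close>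
  define A where "A a = {r. a - pconst r * u \<in> P}" for a
  define h where "h a = Sup (A a)" for a
  have Aadd: "r + s \<in> A (a + b)" if "r \<in> A a" "s \<in> A b" for a b r s
    using cone_add[OF P, of "a - pconst r * u" "b - pconst s * u"] that
    by (simp add: A_def pconst_add algebra_simps)
  have A0: "r \<in> A 0" if "r \<le> 0" for r
    using cone_u[OF P, of "- r"] that by (simp add: A_def pconst_minus)
  have Adown: "s \<in> A a" if "r \<in> A a" "s \<le> r" for a r s
    using Aadd[OF that(1) A0[of "s - r"]] that(2) by simp
  have Adich: "- r \<in> A (- a)" if "a \<in> J" "r \<notin> A a" for a r
    using tot[of "a - pconst r * u"] that J_diff J_mult u_J by (auto simp: A_def pconst_minus)
  have Aneg: "r \<le> - s" if "r \<in> A a" "s \<in> A (- a)" for a r s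
    using upos[of "- r - s"] Aadd[OF that] by (simp add: A_def pconst_diff pconst_minus pconst_add algebra_simps)
  have ne: "\<exists>r. r \<in> A a" if a: "a \<in> J" for a
  proof -
    obtain N where "pconst N * u - (- a) \<in> P" using cone_order_unit[OF P J_minus[OF a]] by blast
    then have "- N \<in> A a" by (simp add: A_def pconst_minus algebra_simps)
    then show ?thesis by blast
  qed
  have bdd: "bdd_above (A a)" if "a \<in> J" for a
    using ne[OF J_minus[OF that]] Aneg[of _ a] by (metis bdd_aboveI)
  have hge: "r \<le> h a" if "a \<in> J" "r \<in> A a" for a r
    unfolding h_def by (rule cSup_upper[OF that(2) bdd[OF that(1)]])
  have hlt: "r \<in> A a" if "a \<in> J" "r < h a" for a r
    using less_cSupD[of "A a" r] that ne[OF that(1)] Adown unfolding h_def by (metis empty_iff less_imp_le)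
  have hneg: "h (- a) = - h a" if a: "a \<in> J" for a
  proof (rule antisym)
    show "h (- a) \<le> - h a"
    proof (rule dense_le)
      fix s assume s: "s < h (- a)"
      have "h a \<le> - s"
        by (rule dense_le) (use Aneg hlt[OF a] hlt[OF J_minus[OF a] s] in blast)
      then show "s \<le> - h a" by simp
    qed
    show "- h a \<le> h (- a)"
    proof (rule dense_le)
      fix s assume s: "s < - h a"
      then have "- s \<notin> A a" using hge[OF a] by force
      from Adich[OF a this] show "s \<le> h (- a)" using hge[OF J_minus[OF a]] by simp
    qed
  qed
  have hsuper: "h a + h b \<le> h (a + b)" if ab: "a \<in> J" "b \<in> J" for a b
  proof (rule field_le_epsilon)
    fix e :: real assume e: "e > 0"
    have "(h a - e/2) + (h b - e/2) \<in> A (a + b)" by (intro Aadd hlt ab) (use e in auto)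
    from hge[OF J_add[OF ab] this] show "h a + h b \<le> h (a + b) + e" by simp
  qed
  have hadd: "h (a + b) = h a + h b" if ab: "a \<in> J" "b \<in> J" for a b
    using hsuper[OF ab] hsuper[OF J_minus[OF ab(1)] J_minus[OF ab(2)]] hneg[OF ab(1)] hneg[OF ab(2)]
      hneg[OF J_add[OF ab]] by simp
  have hpos: "h a \<ge> 0" if "a \<in> P" for a
    by (rule hge) (use that cone_J[OF P] in \<open>auto simp: A_def\<close>)
  have hu: "h u = 1"
  proof (rule antisym)
    have "1 \<in> A u" using cone_0[OF P] by (simp add: A_def)
    then show "1 \<le> h u" using hge u_J by blast
    have "- 1 \<in> A (- u)" using cone_0[OF P] by (simp add: A_def pconst_minus)
    then have "- 1 \<le> h (- u)" using hge J_minus[OF u_J] by blast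
    then show "h u \<le> 1" using hneg[OF u_J] by simp
  qed
  have hcpos: "h (pconst r * a) \<ge> r * h a" if a: "a \<in> J" and r: "r > 0" for a r
  proof (rule dense_le)
    fix s assume "s < r * h a"
    then have "s / r < h a" using r by (simp add: field_simps)
    then have "a - pconst (s / r) * u \<in> P" using hlt[OF a] by (simp add: A_def)
    from cone_pconst[OF P this, of r] have "pconst r * a - pconst (r * (s / r)) * u \<in> P"
      using r by (simp only: pconst_mult right_diff_distrib mult.assoc less_imp_le)
    then have "s \<in> A (pconst r * a)" using r by (simp add: A_def)
    then show "s \<le> h (pconst r * a)" by (rule hge[OF J_mult[OF a]])
  qed
  have hcp: "h (pconst r * a) = r * h a" if a: "a \<in> J" and r: "r > 0" for a r
    using hcpos[OF a r] hcpos[OF J_minus[OF a] r] hneg[OF a] hneg[OF J_mult[OF a, of "pconst r"]]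
    by simp
  have h0: "h 0 = 0" using hadd[OF J_zero J_zero] by simp
  have hc: "h (pconst r * a) = r * h a" if a: "a \<in> J" for a r
  proof -
    consider "r = 0" | "r > 0" | "- r > 0" by linarith
    then show ?thesis
    proof cases
      case 3
      then show ?thesis using hcp[OF a 3] hneg[OF J_mult[OF a, of "pconst r"]] by (simp add: pconst_minus)
    qed (use hcp[OF a] h0 in auto)
  qed
  \<comment> \<open>In the order of \<open>P\<close>, an element of the kernel exceeds
    \<open>-d u\<close> for every \<open>d > 0\<close>, so its product with \<open>q^2\<close>
    exceeds \<open>-d q^2 u\<close>, whose value \<open>-d C\<close> is as close to 0 as
    desired.\<close>
  have hker_sq: "h (q\<^sup>2 * a) \<ge> 0" if a: "a \<in> J" and h: "h a = 0" for a q
  proof (rule field_le_epsilon)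
    fix e :: real assume e: "e > 0"
    define C where "C = h (q\<^sup>2 * u)"
    have C: "C \<ge> 0" unfolding C_def by (intro hpos cone_sq[OF P] cone_M[OF P] u_mem u_J)
    define d where "d = e / (C + 1)"
    have d0: "d > 0" unfolding d_def using C e by (intro divide_pos_pos) auto
    have "d * C + d = e" using C distrib_left[of d C 1] by (simp add: d_def)
    then have d: "d * C \<le> e" using d0 by simp
    have "- d \<in> A a" by (rule hlt[OF a]) (use h d0 in auto)
    then have "q\<^sup>2 * (a - pconst (- d) * u) \<in> P" by (intro cone_sq[OF P]) (simp add: A_def)
    then have "0 \<le> h (q\<^sup>2 * a + pconst d * (q\<^sup>2 * u))"
      by (intro hpos) (simp add: pconst_minus algebra_simps)
    also have "\<dots> = h (q\<^sup>2 * a) + d * C"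
      by (simp add: hadd hc J_mult a u_J C_def)
    finally show "0 \<le> h (q\<^sup>2 * a) + e" using d by simp
  qed
  \<comment> \<open>Polarization: the squares of \<open>q + 1\<close>, \<open>q\<close> and 1
    isolate \<open>2 q\<close>.\<close>
  have hker: "h (q * a) = 0" if a: "a \<in> J" and h: "h a = 0" for a q
  proof -
    have sq0: "h (q\<^sup>2 * a) = 0" for q
      using hker_sq[OF a h, of q] hker_sq[OF J_minus[OF a], of q] hneg[OF a] h hneg[OF J_mult[OF a, of "q\<^sup>2"]]
      by simp
    have "h ((q + 1)\<^sup>2 * a) = h (q\<^sup>2 * a + (pconst 2 * (q * a) + 1\<^sup>2 * a))"
      by (simp add: power2_eq_square algebra_simps)
    also have "\<dots> = h (q\<^sup>2 * a) + (2 * h (q * a) + h (1\<^sup>2 * a))"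
      by (simp add: hadd hc J_mult J_add a del: pconst_numeral)
    finally show ?thesis using sq0[of "q + 1"] sq0[of q] sq0[of 1] by simp
  qed
  define k where "k a = h (a * u)" for a
  have hmult: "h (a * p) = k a * h p" if p: "p \<in> J" for a p
  proof -
    have J1: "p - pconst (h p) * u \<in> J" by (intro J_diff J_mult p u_J)
    have "h (p - pconst (h p) * u) = 0"
      using hadd[OF p J_minus[OF J_mult[OF u_J, of "pconst (h p)"]]] hneg[OF J_mult[OF u_J, of "pconst (h p)"]]
        hc[OF u_J] hu by simp
    from hker[OF J1 this, of a] have "0 = h (a * (p - pconst (h p) * u))" by simp
    also have "a * (p - pconst (h p) * u) = a * p + pconst (- h p) * (a * u)"
      by (simp add: pconst_minus algebra_simps)
    also have "h \<dots> = h (a * p) - h p * k a"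
      by (simp add: hadd hc J_mult p u_J k_def)
    finally show ?thesis by simp
  qed
  define x where "x = (\<chi> i. k (pvar i))"
  have k: "k a = peval a x" for a
    unfolding x_def
  proof (rule ring_hom_eq_peval)
    show "k (pconst r) = r" for r using hc[OF u_J] hu by (simp add: k_def)
    show "k (p + q) = k p + k q" for p q
      by (simp add: k_def distrib_right hadd J_mult u_J)
    show "k (p * q) = k p * k q" for p q
      using hmult[OF J_mult[OF u_J, of q], of p] by (simp add: k_def mult.assoc)
  qed
  have "peval m x \<ge> 0" if "m \<in> M" for m
    using hpos[OF cone_M[OF P u_mult[OF that] J_mult'[OF u_J]]] k[of m] by (simp add: k_def mult.commute)
  moreover have "h f \<le> 0" using hpos[OF fP] hneg[OF f(1)] by simp
  ultimately show thesis
    using that[of h x] hadd hu hpos[OF cone_M[OF P]] hmult k by metis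
qed

end

section \<open>Second order expansions of polynomials\<close>

definition shift :: "real ^ 'n \<Rightarrow> 'n \<Rightarrow> 'n::finite mpoly" where
  "shift z i = pvar i - pconst (z $ i)"

text \<open>The coefficients are polynomials, so the remainder of a second order expansion is kept
  inside them. \<open>A\<close> may be asymmetric and is not determined by the polynomial.\<close>

definition quad :: "real ^ 'n \<Rightarrow> ('n \<Rightarrow> 'n \<Rightarrow> 'n mpoly) \<Rightarrow> 'n::finite mpoly" where
  "quad z A = (\<Sum>i\<in>UNIV. \<Sum>k\<in>UNIV. shift z i * shift z k * A i k)"

text \<open>The square of the maximal ideal at \<open>z\<close>; \<open>van3\<close> is its cube,
  whose elements leave leading forms unchanged.\<close>

definition van2 :: "real ^ 'n \<Rightarrow> 'n::finite mpoly set" where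
  "van2 z = range (quad z)"

definition van3 :: "real ^ 'n \<Rightarrow> 'n::finite mpoly set" where
  "van3 z = quad z ` {A. \<forall>i k. peval (A i k) z = 0}"

definition form_at :: "real ^ 'n \<Rightarrow> ('n \<Rightarrow> 'n \<Rightarrow> 'n mpoly) \<Rightarrow> real ^ 'n \<Rightarrow> real" where
  "form_at z A v = (\<Sum>i\<in>UNIV. \<Sum>k\<in>UNIV. v $ i * v $ k * peval (A i k) z)"

definition posdef :: "real ^ 'n \<Rightarrow> 'n::finite mpoly set" where
  "posdef z = quad z ` {A. \<forall>v. v \<noteq> 0 \<longrightarrow> form_at z A v > 0}"

lemma peval_shift [simp]: "peval (shift z i) x = x $ i - z $ i"
  by (simp add: shift_def)

lemma quad_add: "quad z A + quad z B = quad z (\<lambda>i k. A i k + B i k)"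
  by (simp add: quad_def sum.distrib distrib_left)

lemma quad_mult: "q * quad z A = quad z (\<lambda>i k. q * A i k)"
  by (simp add: quad_def sum_distrib_left mult_ac)

lemma peval_quad: "peval (quad z A) x = (\<Sum>i\<in>UNIV. \<Sum>k\<in>UNIV. (x - z) $ i * (x - z) $ k * peval (A i k) x)"
  by (simp add: quad_def)

text \<open>Hadamard's lemma in polynomial form; for a product it follows from
  \<open>p q = p(z) q + (p - p(z)) q\<close>.\<close>

lemma taylor1:
  obtains q where "p = pconst (peval p z) + (\<Sum>i\<in>UNIV. shift z i * q i)"
proof -
  have "\<exists>q. p = pconst (peval p z) + (\<Sum>i\<in>UNIV. shift z i * q i)"
  proof (induction p rule: mpoly_induct)
    case (const r)
    show ?case by (rule exI[of _ "\<lambda>_. 0"]) simp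
  next
    case (var j)
    have "(\<Sum>i\<in>UNIV. shift z i * (if i = j then 1 else 0)) = shift z j"
      by (simp add: if_distrib cong: if_cong)
    then show ?case by (intro exI[of _ "\<lambda>i. if i = j then 1 else 0"]) (simp add: shift_def)
  next
    case (add p q)
    then obtain f g where f: "p = pconst (peval p z) + (\<Sum>i\<in>UNIV. shift z i * f i)"
      and g: "q = pconst (peval q z) + (\<Sum>i\<in>UNIV. shift z i * g i)" by blast
    show ?case
      by (rule exI[of _ "\<lambda>i. f i + g i"])
        (subst f, subst g, simp add: pconst_add distrib_left sum.distrib)
  next
    case (mult p q)
    then obtain f g where f: "p = pconst (peval p z) + (\<Sum>i\<in>UNIV. shift z i * f i)"
      and g: "q = pconst (peval q z) + (\<Sum>i\<in>UNIV. shift z i * g i)" by blast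
    have "p * q = pconst (peval p z) * q + (\<Sum>i\<in>UNIV. shift z i * (f i * q))"
      by (subst f) (simp add: distrib_right sum_distrib_right mult.assoc)
    also have "pconst (peval p z) * q = pconst (peval (p * q) z) + (\<Sum>i\<in>UNIV. shift z i * (pconst (peval p z) * g i))"
      by (subst g) (simp add: distrib_left sum_distrib_left pconst_mult mult_ac)
    finally show ?case
      by (intro exI[of _ "\<lambda>i. pconst (peval p z) * g i + f i * q"]) (simp add: distrib_left sum.distrib add.assoc)
  qed
  then show thesis using that by blast
qed

lemma taylor_van:
  assumes "peval p z = 0"
  obtains q where "p = (\<Sum>i\<in>UNIV. shift z i * q i)"
  using taylor1[of p z] assms by auto

lemma van_prod:
  assumes "p = (\<Sum>i\<in>UNIV. shift z i * f i)" "q = (\<Sum>i\<in>UNIV. shift z i * g i)"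
  shows "p * q = quad z (\<lambda>i k. f i * g k)"
  by (simp add: assms sum_product quad_def mult_ac)

lemma van2_iff: "p \<in> van2 z \<longleftrightarrow> (\<exists>A. p = quad z A)" by (auto simp: van2_def)
lemma van2_I: "quad z A \<in> van2 z" by (simp add: van2_def)
lemma van2_add: "p \<in> van2 z \<Longrightarrow> q \<in> van2 z \<Longrightarrow> p + q \<in> van2 z"
  by (auto simp: van2_iff quad_add)
lemma van2_mult: "p \<in> van2 z \<Longrightarrow> q * p \<in> van2 z"
  by (auto simp: van2_iff quad_mult)
lemma van2_mult': "p \<in> van2 z \<Longrightarrow> p * q \<in> van2 z"
  using van2_mult[of p z q] by (simp add: mult.commute)
lemma van2_0: "0 \<in> van2 z" using van2_mult[OF van2_I, of 0] by simp
lemma van2_sum: "(\<And>i. i \<in> S \<Longrightarrow> f i \<in> van2 z) \<Longrightarrow> (\<Sum>i\<in>S. f i) \<in> van2 z"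
  by (induction S rule: infinite_finite_induct) (auto simp: van2_0 van2_add)
lemma van2_prod: "peval p z = 0 \<Longrightarrow> peval q z = 0 \<Longrightarrow> p * q \<in> van2 z"
  by (erule taylor_van, erule taylor_van) (simp only: van_prod van2_I)
lemma van2_peval: "p \<in> van2 z \<Longrightarrow> peval p z = 0"
  by (auto simp: van2_iff peval_quad)

lemma van3_I: "(\<And>i k. peval (A i k) z = 0) \<Longrightarrow> quad z A \<in> van3 z" by (auto simp: van3_def)
lemma van3_prod: "p \<in> van2 z \<Longrightarrow> peval q z = 0 \<Longrightarrow> q * p \<in> van3 z"
  by (auto simp: van2_iff quad_mult intro!: van3_I)
lemma van3_add: "p \<in> van3 z \<Longrightarrow> q \<in> van3 z \<Longrightarrow> p + q \<in> van3 z"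
  by (auto simp: van3_def quad_add)
lemma van3_mult: "p \<in> van3 z \<Longrightarrow> q * p \<in> van3 z"
  by (auto simp: van3_def quad_mult)
lemma van3_0: "0 \<in> van3 z" using van3_prod[OF van2_I, of 0] by simp
lemma van3_minus: "p \<in> van3 z \<Longrightarrow> - p \<in> van3 z"
  using van3_mult[of p z "- 1"] by simp
lemma van3_diff: "p \<in> van3 z \<Longrightarrow> q \<in> van3 z \<Longrightarrow> p - q \<in> van3 z"
  using van3_add[of p z "- q"] van3_minus[of q z] by simp
lemma van3_sum: "(\<And>i. i \<in> S \<Longrightarrow> f i \<in> van3 z) \<Longrightarrow> (\<Sum>i\<in>S. f i) \<in> van3 z"
  by (induction S rule: infinite_finite_induct) (auto simp: van3_0 van3_add)

lemma form_at_add: "form_at z (\<lambda>i k. A i k + B i k) v = form_at z A v + form_at z B v"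
  by (simp add: form_at_def sum.distrib distrib_left)

lemma posdef_van2: "p \<in> posdef z \<Longrightarrow> p \<in> van2 z" by (auto simp: posdef_def van2_def)

lemma posdef_add_van3:
  assumes "p \<in> posdef z" "q \<in> van3 z" shows "p + q \<in> posdef z"
proof -
  obtain A where A: "p = quad z A" "\<And>v. v \<noteq> 0 \<Longrightarrow> form_at z A v > 0" using assms by (auto simp: posdef_def)
  obtain B where B: "q = quad z B" "\<And>i k. peval (B i k) z = 0" using assms by (auto simp: van3_def)
  have "form_at z B v = 0" for v by (simp add: form_at_def B)
  then show ?thesis using A by (auto simp: posdef_def A(1) B(1) quad_add form_at_add)
qed

lemma form_at_scale: "form_at z A (r *\<^sub>R v) = r\<^sup>2 * form_at z A v"
  by (simp add: form_at_def sum_distrib_left power2_eq_square mult_ac)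

lemma continuous_on_form_at: "continuous_on X (form_at z A)"
  unfolding form_at_def by (intro continuous_intros)

text \<open>The maximum of \<open>f\<close> and \<open>g\<close> is positive on \<open>S\<close>,
  hence has a positive minimum. Where \<open>f\<close> is not positive this minimum bounds
  \<open>g\<close> from below, so a large multiple of \<open>g\<close> beats the lower bound of
  \<open>f\<close>. The same argument serves to perturb forms, to augment the Lagrangian, to show
  that penalty minimizers converge and to choose the final \<open>\<epsilon>\<close>.\<close>

lemma penalty_pos:
  fixes f g :: "'a::topological_space \<Rightarrow> real"
  assumes S: "compact S" and f: "continuous_on S f" and g: "continuous_on S g"
    and g0: "\<And>x. x \<in> S \<Longrightarrow> g x \<ge> 0" and pos: "\<And>x. x \<in> S \<Longrightarrow> g x = 0 \<Longrightarrow> f x > 0"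
  obtains N where "N \<ge> 0" "\<And>n x. n \<ge> N \<Longrightarrow> x \<in> S \<Longrightarrow> f x + n * g x > 0"
proof (cases "S = {}")
  case True then show thesis using that[of 0] by simp
next
  case False
  obtain a where a: "a \<in> S" "\<And>x. x \<in> S \<Longrightarrow> f a \<le> f x"
    using continuous_attains_inf[OF S False f] by blast
  let ?m = "\<lambda>x. max (f x) (g x)"
  obtain b where b: "b \<in> S" "\<And>x. x \<in> S \<Longrightarrow> ?m b \<le> ?m x"
    using continuous_attains_inf[OF S False continuous_on_max[OF f g]] by blast
  have m: "?m b > 0" using g0[OF b(1)] pos[OF b(1)] by (cases "g b = 0") auto
  define N where "N = (\<bar>f a\<bar> + 1) / ?m b"
  have N: "N \<ge> 0" "N * ?m b = \<bar>f a\<bar> + 1" using m by (auto simp: N_def)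
  have "f x + n * g x > 0" if "n \<ge> N" "x \<in> S" for n x
  proof (cases "f x > 0")
    case True then show ?thesis using g0[OF that(2)] that(1) N(1) by (simp add: add_pos_nonneg)
  next
    case False
    then have "?m b \<le> g x" using b(2)[OF that(2)] m by linarith
    then have "N * ?m b \<le> n * g x" using that N(1) m by (intro mult_mono) auto
    then show ?thesis using a(2)[OF that(2)] N(2) by linarith
  qed
  then show thesis using that N(1) by blast
qed

lemma form_pos_of_sphere:
  fixes f :: "real ^ 'n::finite \<Rightarrow> real"
  assumes "\<And>r v. f (r *\<^sub>R v) = r\<^sup>2 * f v" "\<And>v. v \<in> sphere 0 1 \<Longrightarrow> f v > 0" "v \<noteq> 0"
  shows "f v > 0"
proof -
  have "f v = (norm v)\<^sup>2 * f ((1 / norm v) *\<^sub>R v)"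
    using assms(1)[of "norm v" "(1 / norm v) *\<^sub>R v"] assms(3) by simp
  moreover have "f ((1 / norm v) *\<^sub>R v) > 0" by (rule assms(2)) (use assms(3) in simp)
  ultimately show ?thesis using assms(3) by simp
qed

text \<open>The form with coefficients taken at \<open>x\<close> instead of \<open>z\<close> is
  continuous in \<open>x\<close> and the direction. The pairs where it is not positive, with
  \<open>x\<close> in a closed unit ball and the direction on the sphere, form a compact set whose
  projection misses \<open>z\<close>. A ball around \<open>z\<close> avoids this projection, and
  \<open>p(x)\<close> is the squared distance times the form in the direction of
  \<open>x - z\<close>.\<close>

lemma posdef_local_pos:
  fixes p :: "'n::finite mpoly"
  assumes "p \<in> posdef z"
  obtains r where "r > 0" "\<And>x. dist x z < r \<Longrightarrow> x \<noteq> z \<Longrightarrow> peval p x > 0"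
proof -
  obtain A where A: "p = quad z A" "\<And>v. v \<noteq> 0 \<Longrightarrow> form_at z A v > 0" using assms by (auto simp: posdef_def)
  define f where "f y = (\<Sum>i\<in>UNIV. \<Sum>k\<in>UNIV. snd y $ i * snd y $ k * peval (A i k) (fst y))"
    for y :: "(real ^ 'n) \<times> (real ^ 'n)"
  have "continuous_on UNIV f" unfolding f_def
    by (intro continuous_intros continuous_on_compose2[OF continuous_on_peval[of UNIV]]) auto
  then have "closed {y. f y \<le> 0}" by (intro closed_Collect_le continuous_on_const)
  then have "compact ((cball z 1 \<times> sphere 0 1) \<inter> {y. f y \<le> 0})"
    by (intro compact_Int_closed compact_Times compact_cball compact_sphere)
  then have "compact (fst ` ((cball z 1 \<times> sphere 0 1) \<inter> {y. f y \<le> 0}))" (is "compact ?C")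
    by (rule compact_continuous_image[rotated]) (rule continuous_on_fst[OF continuous_on_id])
  moreover have "f (z, v) > 0" if "norm v = 1" for v
    using A(2)[of v] that by (force simp: f_def form_at_def)
  then have "z \<notin> ?C" by (force simp: not_le)
  ultimately obtain r where r: "r > 0" "ball z r \<subseteq> - ?C"
    by (metis ComplI compact_imp_closed open_Compl openE)
  have "peval p x > 0" if x: "dist x z < min r 1" "x \<noteq> z" for x
  proof -
    let ?u = "(1 / norm (x - z)) *\<^sub>R (x - z)"
    have "(x, ?u) \<in> cball z 1 \<times> sphere 0 1" using x by (simp add: dist_commute)
    moreover have "x \<in> ball z r" using x(1) by (simp add: dist_commute)
    then have "x \<notin> ?C" using r(2) by blast
    ultimately have "f (x, ?u) > 0" by (metis (no_types, lifting) IntI fst_conv image_eqI mem_Collect_eq not_le)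
    moreover have "peval p x = (norm (x - z))\<^sup>2 * f (x, ?u)"
      using x(2) by (simp add: A(1) peval_quad f_def sum_distrib_left power2_eq_square)
    ultimately show ?thesis using x(2) by simp
  qed
  then show thesis using that[of "min r 1"] r(1) by simp
qed

text \<open>After division by \<open>e\<close> the new form is \<open>1 / e\<close> times the form
  of \<open>p\<close> minus that of \<open>q\<close>, so \<open>penalty_pos\<close> on the unit
  sphere handles all large weights \<open>1 / e\<close> at once.\<close>

lemma posdef_perturb:
  assumes "p \<in> posdef z" "q \<in> van2 z"
  obtains d where "d > 0" "\<And>e. 0 \<le> e \<Longrightarrow> e \<le> d \<Longrightarrow> p - pconst e * q \<in> posdef z"
proof -
  obtain A where A: "p = quad z A" "\<And>v. v \<noteq> 0 \<Longrightarrow> form_at z A v > 0" using assms by (auto simp: posdef_def)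
  obtain B where B: "q = quad z B" using assms by (auto simp: van2_iff)
  have Apos: "form_at z A v > 0" if "v \<in> sphere 0 1" for v by (rule A(2)) (use that in auto)
  obtain N where N: "N \<ge> 0" "\<And>n v. n \<ge> N \<Longrightarrow> v \<in> sphere 0 1 \<Longrightarrow> - form_at z B v + n * form_at z A v > 0"
    by (rule penalty_pos[of "sphere 0 1" "\<lambda>v. - form_at z B v" "form_at z A"])
      (use Apos in \<open>force intro: less_imp_le continuous_intros continuous_on_form_at\<close>)+
  have "p - pconst e * q \<in> posdef z" if e: "0 \<le> e" "e \<le> 1 / (N + 1)" for e
  proof (cases "e = 0")
    case True then show ?thesis using assms(1) by simp
  next
    case False
    have eq: "p - pconst e * q = quad z (\<lambda>i k. A i k + pconst (- e) * B i k)"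
      by (simp only: A(1) B quad_add[symmetric] quad_mult[symmetric] pconst_minus) simp
    have f: "form_at z (\<lambda>i k. A i k + pconst (- e) * B i k) v = e * (- form_at z B v + (1 / e) * form_at z A v)" for v
      using False by (simp add: form_at_def sum.distrib sum_subtractf sum_distrib_left sum_negf algebra_simps)
    have "1 / e \<ge> N" using e False N(1) by (simp add: field_simps)
    then have "e * (- form_at z B v + (1 / e) * form_at z A v) > 0" if "v \<in> sphere 0 1" for v
      using e False by (intro mult_pos_pos N(2) that) auto
    then have "form_at z (\<lambda>i k. A i k + pconst (- e) * B i k) v > 0" if "v \<noteq> 0" for v
      by (intro form_pos_of_sphere[OF form_at_scale _ that]) (simp only: f)
    then show ?thesis unfolding eq posdef_def by auto
  qed
  moreover have "1 / (N + 1) > 0" using N(1) by simp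
  ultimately show thesis using that by blast
qed

section \<open>Positive definite zeros\<close>

definition sqdist :: "real ^ 'n \<Rightarrow> 'n::finite mpoly" where
  "sqdist z = (\<Sum>i\<in>UNIV. (shift z i)\<^sup>2)"

lemma peval_sqdist: "peval (sqdist z) x = (norm (x - z))\<^sup>2"
  by (simp add: sqdist_def norm_vec_def L2_set_def real_sqrt_pow2 sum_nonneg)

lemma sqdist_quad: "sqdist z = quad z (\<lambda>i k. if i = k then 1 else 0)"
  by (simp add: sqdist_def quad_def power2_eq_square if_distrib cong: if_cong)

lemma sqdist_van2: "sqdist z \<in> van2 z" by (simp add: sqdist_quad van2_I)

lemma sqdist_SOS: "sqdist z \<in> SOS" by (simp add: sqdist_def SOS_sum)

text \<open>A sum of squares with double zeros on \<open>S\<close> and positive elsewhere: the order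
  unit of the ideal of polynomials with double zeros on \<open>S\<close>. Omitting one point gives
  functions that localize at that point.\<close>

definition node_poly :: "(real ^ 'n) set \<Rightarrow> 'n::finite mpoly" where
  "node_poly S = (\<Prod>z\<in>S. sqdist z)"

lemma node_poly_SOS: "node_poly S \<in> SOS" by (simp add: node_poly_def SOS_prod sqdist_SOS)
lemma node_poly_insert: "finite S \<Longrightarrow> z \<notin> S \<Longrightarrow> node_poly (insert z S) = sqdist z * node_poly S"
  by (simp add: node_poly_def)
lemma node_poly_van2: "finite S \<Longrightarrow> z \<in> S \<Longrightarrow> node_poly S \<in> van2 z"
  by (simp add: node_poly_def prod.remove van2_mult' sqdist_van2)
lemma node_poly_nz: "finite S \<Longrightarrow> x \<notin> S \<Longrightarrow> peval (node_poly S) x > 0"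
  by (auto simp: node_poly_def peval_sqdist intro!: prod_pos)

text \<open>Induction over the index set with Schur complements instead of a spectral decomposition.
  If the pivot \<open>A j j\<close> vanishes, so does its row. Otherwise \<open>A\<close> splits
  into a rank one matrix built from its \<open>j\<close>-th row, which pairs nonnegatively with
  \<open>m\<close> by the hypothesis on \<open>m\<close>, and a positive semidefinite complement on
  the smaller index set.\<close>

lemma trace_prod_nonneg:
  fixes A m :: "'i \<Rightarrow> 'i \<Rightarrow> real"
  assumes "finite J" and "\<And>i k. A i k = A k i"
    and "\<And>v. (\<Sum>i\<in>J. \<Sum>k\<in>J. v i * v k * A i k) \<ge> 0"
    and m: "\<And>v. (\<Sum>i\<in>J. \<Sum>k\<in>J. v i * v k * m i k) \<ge> 0"
  shows "(\<Sum>i\<in>J. \<Sum>k\<in>J. A i k * m i k) \<ge> 0"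
  using assms
proof (induction J arbitrary: A rule: finite_induct)
  case empty then show ?case by simp
next
  case (insert j J)
  let ?F = "\<lambda>v B. \<Sum>i\<in>J. \<Sum>k\<in>J. v i * v k * B i k"
  note sym = insert.prems(1) and psd = insert.prems(2) and m = insert.prems(3)
  have split: "(\<Sum>i\<in>insert j J. \<Sum>k\<in>insert j J. g i k) =
      g j j + (\<Sum>k\<in>J. g j k) + (\<Sum>i\<in>J. g i j) + (\<Sum>i\<in>J. \<Sum>k\<in>J. g i k)" for g :: "'i \<Rightarrow> 'i \<Rightarrow> real"
    using insert.hyps by (simp add: sum.distrib)
  have restr: "?F v B \<ge> 0"
    if B: "\<And>v. (\<Sum>i\<in>insert j J. \<Sum>k\<in>insert j J. v i * v k * B i k) \<ge> 0" for B :: "'i \<Rightarrow> 'i \<Rightarrow> real" and v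
  proof -
    let ?w = "\<lambda>i. if i = j then 0 else v i"
    have "(\<Sum>i\<in>J. \<Sum>k\<in>J. ?w i * ?w k * B i k) = ?F v B"
      by (intro sum.cong refl) (use insert.hyps in auto)
    then show ?thesis using B[of ?w] by (simp add: split)
  qed
  have form: "0 \<le> t\<^sup>2 * A j j + 2 * t * (\<Sum>k\<in>J. v k * A j k) + ?F v A" for t v
  proof -
    let ?w = "\<lambda>i. if i = j then t else v i"
    have "(\<Sum>i\<in>J. \<Sum>k\<in>J. ?w i * ?w k * A i k) = ?F v A"
      by (intro sum.cong refl) (use insert.hyps in auto)
    moreover have "(\<Sum>k\<in>J. ?w j * ?w k * A j k) = t * (\<Sum>k\<in>J. v k * A j k)"
      unfolding sum_distrib_left by (intro sum.cong refl) (use insert.hyps in auto)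
    moreover have "(\<Sum>k\<in>J. ?w k * ?w j * A k j) = t * (\<Sum>k\<in>J. v k * A j k)"
      unfolding sum_distrib_left
    proof (intro sum.cong refl)
      fix k assume "k \<in> J"
      then show "?w k * ?w j * A k j = t * (v k * A j k)"
        using sym[of k j] insert.hyps by auto
    qed
    ultimately show ?thesis using psd[of ?w] by (simp add: split power2_eq_square)
  qed
  have psdJ: "?F v A \<ge> 0" for v by (rule restr[OF psd])
  have mJ: "?F v m \<ge> 0" for v by (rule restr[OF m])
  have Ajj: "A j j \<ge> 0" using form[of 1 "\<lambda>_. 0"] by simp
  show ?case
  proof (cases "A j j = 0")
    case True
    have z: "A j k = 0" if k: "k \<in> J" for k
    proof (rule ccontr)
      assume n: "A j k \<noteq> 0"
      let ?v = "\<lambda>i. if i = k then 1 else 0 :: real"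
      have 1: "(\<Sum>i\<in>J. ?v i * A j i) = A j k"
        using k insert.hyps by (simp add: if_distrib[of "\<lambda>x. x * _"] cong: if_cong)
      \<comment> \<open>With first coordinate \<open>-(c + 1) / (2 A j k)\<close> the form would
        take the value -1.\<close>
      define c where "c = (\<Sum>i\<in>J. \<Sum>l\<in>J. ?v i * ?v l * A i l)"
      have "0 \<le> 2 * (- (c + 1) / (2 * A j k)) * A j k + c"
        using form[of "- (c + 1) / (2 * A j k)" ?v] unfolding 1 c_def[symmetric] using True by simp
      then show False using n by (simp add: field_simps)
    qed
    have z': "A k j = 0" if "k \<in> J" for k using z[OF that] sym[of k j] by simp
    show ?thesis using insert.IH[OF sym psdJ mJ] True by (simp add: split z z')
  next
    case False
    with Ajj have pos: "A j j > 0" by simp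
    define B where "B i k = A i k - A j i * A j k / A j j" for i k
    have Bpsd: "?F v B \<ge> 0" for v
    proof -
      define s where "s = (\<Sum>k\<in>J. v k * A j k)"
      have ss: "(\<Sum>i\<in>J. \<Sum>k\<in>J. (v i * A j i) * (v k * A j k)) = s\<^sup>2"
        by (simp add: s_def power2_eq_square sum_product)
      have "?F v B =
          (\<Sum>i\<in>J. \<Sum>k\<in>J. v i * v k * A i k - ((v i * A j i) * (v k * A j k)) / A j j)"
        by (intro sum.cong refl) (simp add: B_def right_diff_distrib mult_ac)
      also have "\<dots> = ?F v A - s\<^sup>2 / A j j"
        by (simp add: sum_subtractf sum_divide_distrib[symmetric] ss)
      also have "\<dots> \<ge> 0"
      proof -
        \<comment> \<open>The minimizer of the form in its \<open>j\<close>-th coordinate; at it the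
          Schur complement remains.\<close>
        define t where "t = - (s / A j j)"
        have "t\<^sup>2 * A j j + 2 * t * s = - (s\<^sup>2 / A j j)"
          using False by (simp add: t_def power2_eq_square)
        then show ?thesis using form[of t v] by (simp add: s_def[symmetric])
      qed
      finally show ?thesis .
    qed
    have IH: "(\<Sum>i\<in>J. \<Sum>k\<in>J. B i k * m i k) \<ge> 0"
      by (rule insert.IH[OF _ Bpsd mJ]) (simp add: B_def sym mult.commute)
    have e: "A i k * m i k = B i k * m i k + (A j i * A j k * m i k) / A j j" for i k
      by (simp add: B_def left_diff_distrib)
    have "(\<Sum>i\<in>insert j J. \<Sum>k\<in>insert j J. A i k * m i k) =
        (\<Sum>i\<in>insert j J. \<Sum>k\<in>insert j J. B i k * m i k) +
        (\<Sum>i\<in>insert j J. \<Sum>k\<in>insert j J. A j i * A j k * m i k) / A j j"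
      unfolding e by (simp only: sum.distrib sum_divide_distrib)
    moreover have "(\<Sum>i\<in>insert j J. \<Sum>k\<in>insert j J. B i k * m i k) = (\<Sum>i\<in>J. \<Sum>k\<in>J. B i k * m i k)"
    proof -
      have "B j k = 0" "B k j = 0" for k
        using False sym[of k j] by (simp_all add: B_def)
      then show ?thesis by (simp add: split)
    qed
    moreover have "(\<Sum>i\<in>insert j J. \<Sum>k\<in>insert j J. A j i * A j k * m i k) / A j j \<ge> 0"
      by (intro divide_nonneg_pos pos m)
    ultimately show ?thesis using IH by linarith
  qed
qed

section \<open>The order unit for double zeros and the membership criterion\<close>

context arch_qm
begin

lemma bdd_by_SOS:
  assumes "u \<in> SOS" shows "bdd_by u (u * q)"
proof -
  obtain N1 N2 where N: "pconst N1 - q \<in> M" "pconst N2 - (- q) \<in> M" using arch by blast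
  define N where "N = max 0 (max N1 N2)"
  have "(pconst N1 - q) + pconst (N - N1) \<in> M" "(pconst N2 + q) + pconst (N - N2) \<in> M"
    using N by (auto intro!: add_mem SOS_mem[OF SOS_pconst] simp: N_def)
  then have "u * (pconst N - q) \<in> M" "u * (pconst N + q) \<in> M"
    by (auto intro!: SOS_mult_mem assms simp: pconst_diff add.commute)
  then show ?thesis unfolding bdd_by_def
    by (intro exI[of _ N]) (simp add: N_def algebra_simps)
qed

text \<open>With \<open>y = shift w\<close>, each \<open>y_i y_k\<close> is the difference of
  \<open>(y_i + y_k)^2 / 4\<close> and \<open>(y_i - y_k)^2 / 4\<close>, and both squares are
  dominated by \<open>sqdist w\<close>. So a bound \<open>u\<close> on the coefficients becomes the
  bound \<open>sqdist w * u\<close>.\<close>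

lemma bdd_by_quad:
  assumes u: "u \<in> SOS" and B: "\<And>i k. bdd_by u (B i k)"
  shows "bdd_by (sqdist w * u) (quad w B)"
proof -
  let ?y = "shift w"
  \<comment> \<open>The factor 4 covers the case \<open>i = k\<close>, in which the square may be
    \<open>4 y_i^2\<close>.\<close>
  have sq: "pconst 4 * (sqdist w * u) - (?y i + r * ?y k)\<^sup>2 * u \<in> M" if r: "r\<^sup>2 = 1" for i k r
  proof -
    have s: "sqdist w = (?y i)\<^sup>2 + (\<Sum>j\<in>UNIV-{i}. (?y j)\<^sup>2)" for i
      unfolding sqdist_def by (rule sum.remove) auto
    have "((?y i - r * ?y k)\<^sup>2 + (pconst 2 * (\<Sum>j\<in>UNIV-{i}. (?y j)\<^sup>2) + pconst 2 * (\<Sum>j\<in>UNIV-{k}. (?y j)\<^sup>2))) * u \<in> SOS"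
      by (intro SOS_mult SOS_add SOS_sum SOS_sq SOS_pconst u) auto
    moreover have "((?y i - r * ?y k)\<^sup>2 + (pconst 2 * (\<Sum>j\<in>UNIV-{i}. (?y j)\<^sup>2) + pconst 2 * (\<Sum>j\<in>UNIV-{k}. (?y j)\<^sup>2))) * u
       = pconst 4 * (sqdist w * u) - (?y i + r * ?y k)\<^sup>2 * u"
    proof -
      have d: "(\<Sum>j\<in>UNIV-{i}. (?y j)\<^sup>2) = sqdist w - (?y i)\<^sup>2" for i by (simp add: s[of i])
      have "(?y i - r * ?y k)\<^sup>2 + (?y i + r * ?y k)\<^sup>2 = 2 * (?y i)\<^sup>2 + 2 * (r\<^sup>2 * (?y k)\<^sup>2)"
        by (simp add: power2_eq_square algebra_simps)
      then have e: "(?y i - r * ?y k)\<^sup>2 = 2 * (?y i)\<^sup>2 + 2 * (?y k)\<^sup>2 - (?y i + r * ?y k)\<^sup>2"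
        by (simp add: r eq_diff_eq)
      show ?thesis unfolding d e by (simp add: algebra_simps)
    qed
    ultimately show ?thesis by (simp add: SOS_mem)
  qed
  have "bdd_by (sqdist w * u) (shift w i * shift w k * B i k)" for i k
  proof -
    have b: "bdd_by (sqdist w * u) ((?y i + r * ?y k)\<^sup>2 * B i k)" if "r\<^sup>2 = 1" for r
      by (rule bdd_by_mono[OF bdd_by_sq[OF B] sq[OF that]]) simp
    have "bdd_by (sqdist w * u) (pconst (1/4) * ((?y i + 1 * ?y k)\<^sup>2 * B i k + - ((?y i + (- 1) * ?y k)\<^sup>2 * B i k)))"
      by (intro bdd_by_pconst bdd_by_add bdd_by_minus b) simp_all
    also have "(?y i + 1 * ?y k)\<^sup>2 * B i k + - ((?y i + (- 1) * ?y k)\<^sup>2 * B i k) = pconst 4 * (?y i * ?y k * B i k)"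
      by (simp add: power2_eq_square algebra_simps)
    also have "pconst (1/4) * \<dots> = pconst (1/4 * 4) * (?y i * ?y k * B i k)"
      by (simp only: pconst_mult mult.assoc)
    finally show ?thesis by simp
  qed
  then show ?thesis unfolding quad_def by (intro bdd_by_sum) auto
qed

text \<open>Induction on the nodes. Let \<open>g\<close> vanish at the new node \<open>w\<close>
  with \<open>1 - g\<close> a multiple of the old unit \<open>?u\<close>, and write
  \<open>b = (1 - g) (1 + g) b + g^2 b\<close>. In the first term \<open>?u\<close> is a factor and
  \<open>b\<close> has the double zero at \<open>w\<close>; in the second \<open>g^2\<close> has it,
  while multiples of \<open>b\<close> are bounded by \<open>?u\<close> by induction. Both terms have
  the shape \<open>quad w B\<close> with \<open>B\<close> bounded by \<open>?u\<close>.\<close>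

lemma node_poly_order_unit:
  assumes "finite S" and "\<forall>z\<in>S. b \<in> van2 z"
  shows "bdd_by (node_poly S) b"
  using assms
proof (induction S arbitrary: b rule: finite_induct)
  case empty
  show ?case using bdd_by_SOS[of 1 b] by (simp add: node_poly_def)
next
  case (insert w S)
  let ?u = "node_poly S"
  define c where "c = peval ?u w"
  have c: "c > 0" unfolding c_def by (rule node_poly_nz) (use insert in auto)
  define g where "g = 1 - pconst (1 / c) * ?u"
  have gw: "peval g w = 0" using c by (simp add: g_def c_def)
  obtain A where A: "b = quad w A" using insert.prems by (auto simp: van2_iff)
  obtain C where C: "g * g = quad w C" using van2_prod[OF gw gw] by (auto simp: van2_iff)
  have "bdd_by (sqdist w * ?u) (quad w (\<lambda>i k. ?u * ((1 + g) * pconst (1 / c) * A i k)))"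
    by (intro bdd_by_quad bdd_by_SOS node_poly_SOS)
  moreover have "bdd_by (sqdist w * ?u) (quad w (\<lambda>i k. b * C i k))"
    by (intro bdd_by_quad node_poly_SOS insert.IH ballI van2_mult') (use insert.prems in auto)
  ultimately have "bdd_by (sqdist w * ?u)
      (quad w (\<lambda>i k. ?u * ((1 + g) * pconst (1 / c) * A i k)) + quad w (\<lambda>i k. b * C i k))"
    by (rule bdd_by_add)
  also have "quad w (\<lambda>i k. ?u * ((1 + g) * pconst (1 / c) * A i k)) = (?u * pconst (1 / c)) * ((1 + g) * b)"
    by (simp add: A quad_mult mult_ac)
  also have "quad w (\<lambda>i k. b * C i k) = b * (g * g)" by (simp add: C quad_mult)
  also have "?u * pconst (1 / c) = 1 - g" by (simp add: g_def)
  also have "(1 - g) * ((1 + g) * b) + b * (g * g) = b" by (simp add: algebra_simps)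
  finally show ?case by (simp add: node_poly_insert insert.hyps)
qed

theorem nonneg_mem:
  fixes f :: "'n mpoly"
  assumes S: "finite S" and fS: "\<And>z. z \<in> S \<Longrightarrow> f \<in> posdef z"
    and pos: "\<And>x. x \<notin> S \<Longrightarrow> (\<And>m. m \<in> M \<Longrightarrow> peval m x \<ge> 0) \<Longrightarrow> peval f x > 0"
  shows "f \<in> M"
proof (rule ccontr)
  assume nf: "f \<notin> M"
  let ?J = "{p. \<forall>z\<in>S. p \<in> van2 z}" and ?u = "node_poly S"
  interpret pure_state M ?J ?u
  proof unfold_locales
    show "\<exists>N. pconst N * ?u - p \<in> M" if "p \<in> ?J" for p
      using node_poly_order_unit[OF S, of p] that by (auto simp: bdd_by_def)
    show "?u * p \<in> M" if "p \<in> M" for p by (intro SOS_mult_mem node_poly_SOS that)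
  qed (auto simp: van2_add van2_mult node_poly_van2 S)
  have fJ: "f \<in> ?J" using fS posdef_van2 by auto
  obtain h x where h: "\<And>p q. p \<in> ?J \<Longrightarrow> q \<in> ?J \<Longrightarrow> h (p + q) = h p + (h q :: real)" "h ?u = 1"
    "\<And>p. p \<in> M \<Longrightarrow> p \<in> ?J \<Longrightarrow> h p \<ge> 0" "\<And>a p. p \<in> ?J \<Longrightarrow> h (a * p) = peval a x * h p"
    "h f \<le> 0" "\<And>m. m \<in> M \<Longrightarrow> peval m x \<ge> 0"
    using state[OF fJ nf] by blast
  show False
  proof (cases "x \<in> S")
    case False
    \<comment> \<open>Both sides are the value of \<open>h\<close> on the product of
      \<open>?u\<close> and \<open>f\<close>, computed in two ways.\<close>
    have "peval ?u x * h f = peval f x"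
      using h(4)[OF fJ, of ?u] h(4)[OF u_J, of f] h(2) by (simp add: mult.commute)
    moreover have "peval f x > 0" by (rule pos[OF False h(6)])
    ultimately show False using node_poly_nz[OF S False] h(5) by (metis mult_nonneg_nonpos less_imp_le not_less)
  next
    case True
    \<comment> \<open>Strictness comes from \<open>d\<close>: the form stays positive definite after
      subtracting \<open>d ?u\<close>, so a nonnegative trace already gives
      \<open>h f \<ge> d\<close>, whatever the rank of the matrix \<open>m\<close> below.\<close>
    obtain d where d: "d > 0" "f - pconst d * ?u \<in> posdef x"
      using posdef_perturb[OF fS[OF True] node_poly_van2[OF S True]] by (metis less_imp_le order_refl)
    then obtain A where A: "f - pconst d * ?u = quad x A" "\<And>v. v \<noteq> 0 \<Longrightarrow> form_at x A v > 0"
      by (auto simp: posdef_def)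
    \<comment> \<open>This factor supplies the double zeros at the other nodes, so that products of
      two coordinates centred at \<open>x\<close> become elements of the ideal.\<close>
    let ?P = "node_poly (S - {x})"
    have PJ: "?P * (shift x i * shift x k) \<in> ?J" for i k
    proof -
      have "?P * (shift x i * shift x k) \<in> van2 z" if z: "z \<in> S" for z
      proof (cases "z = x")
        case True then show ?thesis by (simp add: van2_mult van2_prod)
      next
        case False then show ?thesis using z S by (simp add: van2_mult' node_poly_van2)
      qed
      then show ?thesis by simp
    qed
    have hsum: "h (\<Sum>i\<in>X. g i) = (\<Sum>i\<in>X. h (g i))" if "\<And>i. g i \<in> ?J" for g :: "'n \<Rightarrow> 'n mpoly" and X
    proof (induction X rule: infinite_finite_induct)
      case (insert j X)
      have "(\<Sum>i\<in>X. g i) \<in> ?J" using that by (auto intro!: van2_sum)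
      then show ?case using insert h(1)[OF that] by simp
    qed (use h(4)[OF u_J, of 0] in auto)
    define m where "m i k = h (?P * (shift x i * shift x k))" for i k
    have hquad: "h (?P * quad x B) = (\<Sum>i\<in>UNIV. \<Sum>k\<in>UNIV. peval (B i k) x * m i k)" for B
    proof -
      have "?P * quad x B = (\<Sum>i\<in>UNIV. \<Sum>k\<in>UNIV. B i k * (?P * (shift x i * shift x k)))"
        by (simp add: quad_def sum_distrib_left mult_ac)
      moreover have JJ: "B i k * (?P * (shift x i * shift x k)) \<in> ?J" for i k by (rule J_mult[OF PJ])
      moreover have "(\<Sum>k\<in>UNIV. B i k * (?P * (shift x i * shift x k))) \<in> ?J" for i
        using JJ by (auto intro!: van2_sum)
      ultimately show ?thesis by (simp only: hsum h(4)[OF PJ] m_def)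
    qed
    have mpsd: "(\<Sum>i\<in>UNIV. \<Sum>k\<in>UNIV. v i * v k * m i k) \<ge> 0" for v
    proof -
      let ?l = "\<Sum>i\<in>UNIV. shift x i * pconst (v i)"
      have l: "?l * ?l = quad x (\<lambda>i k. pconst (v i) * pconst (v k))" by (rule van_prod) auto
      have "?P * (?l * ?l) \<in> M"
        unfolding power2_eq_square[symmetric] by (intro SOS_mem SOS_mult node_poly_SOS SOS_sq)
      moreover have "?P * (?l * ?l) \<in> ?J"
        unfolding l
      proof (intro CollectI ballI)
        fix z assume z: "z \<in> S"
        show "?P * quad x (\<lambda>i k. pconst (v i) * pconst (v k)) \<in> van2 z"
          using z S by (cases "z = x") (auto intro: van2_mult van2_I van2_mult' node_poly_van2)
      qed
      ultimately have "0 \<le> h (?P * (?l * ?l))" by (rule h(3))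
      then show ?thesis unfolding l hquad by simp
    qed
    have msym: "m i k = m k i" for i k by (simp add: m_def mult.commute)
    \<comment> \<open>\<open>A\<close> may be asymmetric; adding the transpose doubles both the form
      and the trace.\<close>
    let ?B = "\<lambda>i k. peval (A i k) x + peval (A k i) x"
    have swap: "(\<Sum>i\<in>UNIV. \<Sum>k\<in>UNIV. g k i) = (\<Sum>i\<in>UNIV. \<Sum>k\<in>UNIV. g i k)" for g :: "'n \<Rightarrow> 'n \<Rightarrow> real"
      by (rule sum.swap)
    have "(\<Sum>i\<in>UNIV. \<Sum>k\<in>UNIV. ?B i k * m i k) \<ge> 0"
    proof (rule trace_prod_nonneg[OF _ _ _ mpsd])
      fix v :: "'n \<Rightarrow> real"
      have "form_at x A (\<chi> i. v i) \<ge> 0"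
        using A(2)[of "\<chi> i. v i"] by (cases "(\<chi> i. v i) = 0") (auto simp: form_at_def intro: less_imp_le)
      moreover have "(\<Sum>i\<in>UNIV. \<Sum>k\<in>UNIV. v i * v k * ?B i k) = 2 * form_at x A (\<chi> i. v i)"
        using swap[of "\<lambda>i k. v i * v k * peval (A i k) x"]
        by (simp add: form_at_def distrib_left sum.distrib mult_ac)
      ultimately show "(\<Sum>i\<in>UNIV. \<Sum>k\<in>UNIV. v i * v k * ?B i k) \<ge> 0" by simp
    qed (auto simp: add.commute)
    moreover have "(\<Sum>i\<in>UNIV. \<Sum>k\<in>UNIV. ?B i k * m i k) = 2 * h (?P * quad x A)"
      using swap[of "\<lambda>i k. peval (A i k) x * m i k"]
      by (simp add: hquad distrib_right sum.distrib msym[of _ _])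
    ultimately have "0 \<le> h (?P * (f - pconst d * ?u))" by (simp add: A(1))
    also have "\<dots> = peval ?P x * h (f + pconst (- d) * ?u)"
      using h(4)[of "f - pconst d * ?u" ?P] fJ u_J J_diff J_mult by (simp add: pconst_minus)
    also have "h (f + pconst (- d) * ?u) = h f - d"
      using h(1)[OF fJ J_mult[OF u_J, of "pconst (- d)"]] h(4)[OF u_J, of "pconst (- d)"] h(2) by simp
    finally have "0 \<le> peval ?P x * (h f - d)" .
    moreover have "peval ?P x > 0" by (rule node_poly_nz) (use S in auto)
    ultimately have "h f - d \<ge> 0" by (simp add: zero_le_mult_iff)
    then show False using d(1) h(5) by simp
  qed
qed

end

section \<open>Gradients and Hessians of polynomials\<close>

abbreviation grad :: "'n::finite mpoly \<Rightarrow> real ^ 'n \<Rightarrow> real ^ 'n" where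
  "grad p \<equiv> gradient (peval p)"

text \<open>The partial derivatives are again polynomials, which permits differentiating the
  gradient once more for the Hessian.\<close>

lemma formal_derivative:
  obtains D where "\<And>x. (peval p has_derivative (\<lambda>v. \<Sum>i\<in>UNIV. v $ i * peval (D i) x)) (at x)"
proof -
  have "\<exists>D. \<forall>x. (peval p has_derivative (\<lambda>v. \<Sum>i\<in>UNIV. v $ i * peval (D i) x)) (at x)"
  proof (induction p rule: mpoly_induct)
    case (const r)
    have "peval (pconst r) = (\<lambda>_. r)" by (simp add: fun_eq_iff)
    then show ?case by (intro exI[of _ "\<lambda>_. 0"]) simp
  next
    case (var j)
    have e: "peval (pvar j) = (\<lambda>x. x $ j)" by (simp add: fun_eq_iff)
    have "(\<Sum>i\<in>UNIV. v $ i * peval (if i = j then 1 else 0) x) = v $ j" for v x :: "real ^ 'a"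
      by (simp add: if_distrib[of "\<lambda>p. peval p x"] if_distrib[of "\<lambda>y. _ * y"] cong: if_cong)
    then show ?case unfolding e
      by (intro exI[of _ "\<lambda>i. if i = j then 1 else 0"])
        (auto intro!: bounded_linear_imp_has_derivative bounded_linear_vec_nth)
  next
    case (add p q)
    then obtain f g where f: "\<And>x. (peval p has_derivative (\<lambda>v. \<Sum>i\<in>UNIV. v $ i * peval (f i) x)) (at x)"
      and g: "\<And>x. (peval q has_derivative (\<lambda>v. \<Sum>i\<in>UNIV. v $ i * peval (g i) x)) (at x)" by blast
    have e: "peval (p + q) = (\<lambda>x. peval p x + peval q x)" by (simp add: fun_eq_iff)
    show ?case unfolding e
      using has_derivative_add[OF f g]
      by (intro exI[of _ "\<lambda>i. f i + g i"]) (simp add: distrib_left sum.distrib)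
  next
    case (mult p q)
    then obtain f g where f: "\<And>x. (peval p has_derivative (\<lambda>v. \<Sum>i\<in>UNIV. v $ i * peval (f i) x)) (at x)"
      and g: "\<And>x. (peval q has_derivative (\<lambda>v. \<Sum>i\<in>UNIV. v $ i * peval (g i) x)) (at x)" by blast
    have e: "peval (p * q) = (\<lambda>x. peval p x * peval q x)" by (simp add: fun_eq_iff)
    have s: "peval p x * (\<Sum>i\<in>UNIV. v $ i * peval (g i) x) + (\<Sum>i\<in>UNIV. v $ i * peval (f i) x) * peval q x =
       (\<Sum>i\<in>UNIV. v $ i * peval (p * g i + q * f i) x)" for v x :: "real ^ 'a"
      by (simp add: distrib_left sum.distrib sum_distrib_left sum_distrib_right mult_ac)
    show ?case unfolding e
      using has_derivative_mult[OF f g] unfolding s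
      by (intro exI[of _ "\<lambda>i. p * g i + q * f i"] allI)
  qed
  then show thesis using that by blast
qed

text \<open>\<open>gradient\<close> is a definite description, resolved by uniqueness of the
  derivative.\<close>

lemma gradient_eqI:
  assumes "(f has_derivative (\<lambda>v. v \<bullet> g)) (at x)"
  shows "gradient f x = g"
  unfolding gradient_def
proof (rule the_equality)
  show "GDERIV f x :> g" using assms by (simp add: gderiv_def)
  fix g' assume "GDERIV f x :> g'"
  then have "(\<lambda>v. v \<bullet> g') = (\<lambda>v. v \<bullet> g)"
    using assms by (auto simp: gderiv_def intro: has_derivative_unique)
  then have "v \<bullet> (g' - g) = 0" for v by (metis inner_diff_right right_minus_eq)
  then show "g' = g" by (metis inner_eq_zero_iff right_minus_eq)
qed

lemma inner_chi: "v \<bullet> (\<chi> i. f i) = (\<Sum>i\<in>UNIV. v $ i * f i)" for v :: "real ^ 'n::finite"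
  by (simp add: inner_vec_def)

lemma gradient_peval:
  obtains D where "grad p = (\<lambda>x. \<chi> i. peval (D i) x)"
proof -
  obtain D where "\<And>x. (peval p has_derivative (\<lambda>v. \<Sum>i\<in>UNIV. v $ i * peval (D i) x)) (at x)"
    using formal_derivative[of p] by blast
  then have "grad p x = (\<chi> i. peval (D i) x)" for x
    by (intro gradient_eqI) (simp add: inner_chi)
  then show thesis using that by blast
qed

lemma has_derivative_peval: "(peval p has_derivative (\<lambda>v. v \<bullet> grad p x)) (at x)"
proof -
  obtain D where D: "\<And>x. (peval p has_derivative (\<lambda>v. \<Sum>i\<in>UNIV. v $ i * peval (D i) x)) (at x)"
    using formal_derivative[of p] by blast
  then have "grad p x = (\<chi> i. peval (D i) x)"
    by (intro gradient_eqI) (simp add: inner_chi)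
  then show ?thesis using D by (simp add: inner_chi)
qed

lemma continuous_on_gradient: "continuous_on X (grad p)"
proof -
  obtain D where "grad p = (\<lambda>x. \<chi> i. peval (D i) x)" using gradient_peval by blast
  then show ?thesis by (simp add: continuous_on_vec_lambda continuous_on_peval)
qed

lemma has_derivative_shift_sum:
  assumes "p = pconst r + (\<Sum>i\<in>UNIV. shift z i * q i)"
  shows "(peval p has_derivative
    (\<lambda>v. \<Sum>i\<in>UNIV. v $ i * peval (q i) x + (x $ i - z $ i) * (v \<bullet> grad (q i) x))) (at x)"
proof -
  have e: "peval p = (\<lambda>x. r + (\<Sum>i\<in>UNIV. (x $ i - z $ i) * peval (q i) x))"
    by (subst assms) (simp add: fun_eq_iff)
  have "((\<lambda>x. x $ i - z $ i) has_derivative (\<lambda>v. v $ i)) (at x)" for i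
    by (auto intro!: derivative_eq_intros bounded_linear_imp_has_derivative bounded_linear_vec_nth)
  from has_derivative_mult[OF this has_derivative_peval]
  have d: "((\<lambda>x. (x $ i - z $ i) * peval (q i) x) has_derivative
      (\<lambda>v. v $ i * peval (q i) x + (x $ i - z $ i) * (v \<bullet> grad (q i) x))) (at x)" for i
    by (simp add: add.commute)
  show ?thesis
    unfolding e by (rule has_derivative_add[OF has_derivative_const has_derivative_sum[OF d], simplified])
qed

lemma gradient_taylor1:
  assumes "p = pconst r + (\<Sum>i\<in>UNIV. shift z i * q i)"
  shows "grad p z = (\<chi> i. peval (q i) z)"
  using has_derivative_shift_sum[OF assms, of z] by (intro gradient_eqI) (simp add: inner_chi)

lemma hessian_form:
  assumes "grad p = (\<lambda>x. \<chi> i. peval (D i) x)"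
  shows "v \<bullet> (hessian (peval p) z *v v) = (\<Sum>i\<in>UNIV. v $ i * (v \<bullet> grad (D i) z))"
proof -
  let ?L = "\<lambda>v. \<chi> i. v \<bullet> grad (D i) z"
  have L: "(grad p has_derivative ?L) (at z)"
    unfolding assms
    by (subst has_derivative_componentwise_within) (auto simp: Basis_vec_def inner_axis has_derivative_peval)
  then have "grad p differentiable (at z)" by (rule differentiableI)
  then have "(grad p has_derivative (\<lambda>h. hessian (peval p) z *v h)) (at z)"
    by (simp add: jacobian_works hessian_def)
  from has_derivative_unique[OF this L] have "hessian (peval p) z *v v = ?L v"
    by (rule fun_cong)
  then show ?thesis by (simp add: inner_chi)
qed

text \<open>Expanding \<open>p\<close> gives \<open>q\<close>, whose values at \<open>z\<close> form
  the gradient and so vanish; expanding each \<open>q i\<close> gives \<open>A\<close>. With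
  \<open>y = x - z\<close> the partial derivatives of \<open>p\<close> are the sums over
  \<open>k\<close> of \<open>y_k (A i k + B k i)\<close>, where \<open>B k i\<close> is a derivative
  of \<open>q k\<close> and equals \<open>A k i\<close> at \<open>z\<close>. Hence the Hessian at
  \<open>z\<close> is \<open>A\<close> plus its transpose.\<close>

lemma second_order_expansion:
  assumes p0: "peval p z = 0" and g0: "grad p z = 0"
  obtains A where "p = quad z A" "\<And>v. 2 * form_at z A v = v \<bullet> (hessian (peval p) z *v v)"
proof -
  obtain q where "p = (\<Sum>i\<in>UNIV. shift z i * q i)" using taylor_van[OF p0] by blast
  then have q: "p = pconst 0 + (\<Sum>i\<in>UNIV. shift z i * q i)" by simp
  have "peval (q i) z = 0" for i
    using gradient_taylor1[OF q] g0 by (simp add: vec_eq_iff)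
  then have "\<exists>a. q i = (\<Sum>k\<in>UNIV. shift z k * a k)" for i by (metis taylor_van)
  then obtain A where "\<And>i. q i = (\<Sum>k\<in>UNIV. shift z k * A i k)" by metis
  then have A: "q i = pconst 0 + (\<Sum>k\<in>UNIV. shift z k * A i k)" for i by simp
  have pA: "p = quad z A" by (subst q) (simp add: A quad_def sum_distrib_left mult.assoc)
  have "\<exists>D. grad (q k) = (\<lambda>x. \<chi> i. peval (D i) x)" for k using gradient_peval by metis
  then obtain B where B: "\<And>k. grad (q k) = (\<lambda>x. \<chi> i. peval (B k i) x)" by metis
  define D where "D i = pconst 0 + (\<Sum>k\<in>UNIV. shift z k * (A i k + B k i))" for i
  have D: "grad p = (\<lambda>x. \<chi> i. peval (D i) x)"
  proof
    fix x
    have "peval (D i) x = peval (q i) x + (\<Sum>k\<in>UNIV. (x $ k - z $ k) * peval (B k i) x)" for i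
      by (subst A) (simp add: D_def distrib_left sum.distrib)
    moreover have "(\<Sum>i\<in>UNIV. \<Sum>k\<in>UNIV. v $ i * ((x $ k - z $ k) * peval (B k i) x)) =
        (\<Sum>k\<in>UNIV. \<Sum>i\<in>UNIV. (x $ k - z $ k) * (v $ i * peval (B k i) x))" for v
      by (subst sum.swap) (simp add: mult_ac)
    ultimately have "v \<bullet> (\<chi> i. peval (D i) x) =
        (\<Sum>i\<in>UNIV. v $ i * peval (q i) x + (x $ i - z $ i) * (v \<bullet> grad (q i) x))" for v
      by (simp add: B inner_chi distrib_left sum.distrib sum_distrib_left)
    then show "grad p x = (\<chi> i. peval (D i) x)"
      using has_derivative_shift_sum[OF q, of x] by (intro gradient_eqI) simp
  qed
  have "peval (B k i) z = peval (A k i) z" for k i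
    using gradient_taylor1[OF A[of k]] by (simp add: B vec_eq_iff)
  then have g: "grad (D i) z = (\<chi> k. peval (A i k) z + peval (A k i) z)" for i
    using gradient_taylor1[OF D_def] by simp
  have "2 * form_at z A v = v \<bullet> (hessian (peval p) z *v v)" for v
  proof -
    have "(\<Sum>i\<in>UNIV. \<Sum>k\<in>UNIV. v $ i * (v $ k * peval (A k i) z)) = form_at z A v"
      unfolding form_at_def by (subst sum.swap) (simp add: mult_ac)
    then show ?thesis
      by (simp add: hessian_form[OF D] g inner_chi distrib_left sum.distrib sum_distrib_left)
        (simp add: form_at_def mult.assoc)
  qed
  then show thesis using that pA by blast
qed

section \<open>Dual families of linearly independent vectors\<close>

lemma span_family:
  fixes g :: "'j \<Rightarrow> 'a::real_vector"
  assumes "finite J" "y \<in> span (g ` J)"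
  obtains u where "y = (\<Sum>j\<in>J. u j *\<^sub>R g j)"
proof -
  let ?V = "{y. \<exists>u. y = (\<Sum>j\<in>J. u j *\<^sub>R g j)}"
  have "span (g ` J) \<subseteq> ?V"
  proof (rule span_minimal)
    show "g ` J \<subseteq> ?V"
    proof safe
      fix j assume "j \<in> J"
      then have "g j = (\<Sum>i\<in>J. (if i = j then 1 else 0) *\<^sub>R g i)"
        using assms(1) by (simp add: if_distrib[of "\<lambda>r. r *\<^sub>R _"] cong: if_cong)
      then show "\<exists>u. g j = (\<Sum>i\<in>J. u i *\<^sub>R g i)"
        by (intro exI[of _ "\<lambda>i. if i = j then 1 else 0"])
    qed
    show "subspace ?V"
      unfolding subspace_def
    proof safe
      show "\<exists>u. 0 = (\<Sum>j\<in>J. u j *\<^sub>R g j)" by (rule exI[of _ "\<lambda>_. 0"]) simp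
      show "\<exists>w. (\<Sum>j\<in>J. u j *\<^sub>R g j) + (\<Sum>j\<in>J. v j *\<^sub>R g j) = (\<Sum>j\<in>J. w j *\<^sub>R g j)" for u v
        by (rule exI[of _ "\<lambda>j. u j + v j"]) (simp add: scaleR_add_left sum.distrib)
      show "\<exists>w. c *\<^sub>R (\<Sum>j\<in>J. u j *\<^sub>R g j) = (\<Sum>j\<in>J. w j *\<^sub>R g j)" for c u
        by (rule exI[of _ "\<lambda>j. c * u j"]) (simp add: scaleR_sum_right)
    qed
  qed
  then show thesis using assms(2) that by blast
qed

text \<open>\<open>w j\<close> is the component of \<open>g j\<close> orthogonal to the span of the
  other vectors, rescaled. Pairing a stationarity equation with \<open>w j\<close> isolates the
  multiplier of \<open>j\<close>.\<close>

lemma dual_family: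
  fixes g :: "'j \<Rightarrow> 'a::euclidean_space"
  assumes fin: "finite J" and ind: "\<And>u. (\<Sum>j\<in>J. u j *\<^sub>R g j) = 0 \<Longrightarrow> \<forall>j\<in>J. u j = 0"
  obtains w where "\<And>i j. i \<in> J \<Longrightarrow> j \<in> J \<Longrightarrow> w j \<bullet> g i = (if i = j then 1 else 0)"
proof -
  have "\<exists>w. \<forall>i\<in>J. w \<bullet> g i = (if i = j then 1 else 0)" if j: "j \<in> J" for j
  proof -
    obtain y z where yz: "y \<in> span (g ` (J - {j}))" "\<And>w. w \<in> span (g ` (J - {j})) \<Longrightarrow> orthogonal z w" "g j = y + z"
      using orthogonal_subspace_decomp_exists[of "g ` (J - {j})" "g j"] by metis
    have "z \<noteq> 0"
    proof
      assume "z = 0"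
      obtain u where u: "y = (\<Sum>i\<in>J - {j}. u i *\<^sub>R g i)" using span_family[OF _ yz(1)] fin by auto
      let ?u = "\<lambda>i. if i = j then - 1 else u i"
      have "(\<Sum>i\<in>J. ?u i *\<^sub>R g i) = - g j + (\<Sum>i\<in>J - {j}. ?u i *\<^sub>R g i)"
        using fin j by (simp add: sum.remove)
      also have "(\<Sum>i\<in>J - {j}. ?u i *\<^sub>R g i) = y" unfolding u by (rule sum.cong) auto
      finally have "(\<Sum>i\<in>J. ?u i *\<^sub>R g i) = 0" using yz(3) \<open>z = 0\<close> by simp
      then show False using ind[of ?u] j by auto
    qed
    moreover have "z \<bullet> y = 0" using yz by (auto simp: orthogonal_def)
    ultimately have "((1 / (z \<bullet> z)) *\<^sub>R z) \<bullet> g j = 1" by (simp add: yz(3) inner_add_right)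
    moreover have "((1 / (z \<bullet> z)) *\<^sub>R z) \<bullet> g i = 0" if "i \<in> J" "i \<noteq> j" for i
      using yz(2)[of "g i"] that by (auto simp: orthogonal_def intro: span_base)
    ultimately show ?thesis by (intro exI[of _ "(1 / (z \<bullet> z)) *\<^sub>R z"]) auto
  qed
  then show thesis using that by metis
qed

section \<open>Existence of Lagrange multipliers\<close>

text \<open>Makes the penalty for an inequality differentiable across the boundary. The derivative
  is never positive, which later fixes the sign of the multipliers.\<close>

lemma min0_sq_derivative:
  "((\<lambda>t::real. (min t 0)\<^sup>2) has_real_derivative 2 * min t 0) (at t)"
proof (cases t "0::real" rule: linorder_cases)
  case less
  have "((\<lambda>t::real. t\<^sup>2) has_real_derivative 2 * min t 0) (at t)"
    using less by (auto intro!: derivative_eq_intros)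
  then show ?thesis
    by (rule DERIV_cong_ev[OF refl _ refl, THEN iffD1, rotated])
      (use less in \<open>auto simp: eventually_nhds intro!: exI[of _ "{..<0}"]\<close>)
next
  case greater
  have "((\<lambda>t::real. 0) has_real_derivative 2 * min t 0) (at t)" using greater by simp
  then show ?thesis
    by (rule DERIV_cong_ev[OF refl _ refl, THEN iffD1, rotated])
      (use greater in \<open>auto simp: eventually_nhds intro!: exI[of _ "{0<..}"]\<close>)
next
  case equal
  have "((\<lambda>h::real. (min h 0)\<^sup>2 / h) \<longlongrightarrow> 0) (at 0)"
  proof (rule Lim_null_comparison)
    have "norm ((min h 0)\<^sup>2 / h) \<le> \<bar>h\<bar>" for h :: real
      by (cases "h \<ge> 0") (auto simp: power2_eq_square min_def)
    then show "\<forall>\<^sub>F h in at (0::real). norm ((min h 0)\<^sup>2 / h) \<le> \<bar>h\<bar>" by simp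
    show "((\<lambda>h::real. \<bar>h\<bar>) \<longlongrightarrow> 0) (at 0)" by (rule tendsto_rabs_zero) (rule tendsto_ident_at)
  qed
  then show ?thesis using equal by (simp add: has_field_derivative_iff)
qed

text \<open>
  Minimizing \<open>F + \<bar>x - z\<bar>\<^sup>2 + n P\<close> with a quadratic penalty \<open>P\<close> near \<open>z\<close> gives points
  \<open>X n\<close> that converge to \<open>z\<close>; their stationarity equations are approximate multiplier
  equations, and LICQ makes the approximate multipliers converge.
\<close>

lemma multipliers_exist:
  fixes c :: "'j \<Rightarrow> 'n::finite mpoly"
  assumes fin: "finite E" "finite I" and disj: "E \<inter> I = {}"
    and z: "z \<in> feas_set E I c" and min: "\<And>x. x \<in> feas_set E I c \<Longrightarrow> peval F z \<le> peval F x"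
    and li: "licqc E I c z"
  obtains lam where "multipliers E I c F z lam"
proof -
  let ?A = "active E I c z" and ?g = "\<lambda>j. grad (c j)"
  have finA: "finite ?A" using fin by (simp add: active_def)
  have EA: "E \<subseteq> ?A" using z by (auto simp: active_def feas_set_def)
  obtain w where w: "\<And>i j. i \<in> ?A \<Longrightarrow> j \<in> ?A \<Longrightarrow> w j \<bullet> ?g i z = (if i = j then 1 else 0)"
    using dual_family[OF finA, of "\<lambda>j. ?g j z"] li by (auto simp: licqc_def)
  have gcont: "isCont (grad q) y" for q :: "'n mpoly" and y
    using continuous_on_gradient[of UNIV q] by (simp add: continuous_on_eq_continuous_at)
  have "\<forall>\<^sub>F x in nhds z. \<forall>j\<in>I - ?A. peval (c j) x > 0"
  proof (intro eventually_ball_finite ballI)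
    show "finite (I - ?A)" using fin by simp
    fix j assume "j \<in> I - ?A"
    then have "peval (c j) z > 0" using z by (force simp: active_def feas_set_def)
    then show "\<forall>\<^sub>F x in nhds z. peval (c j) x > 0"
      using isCont_peval[of z "c j"] by (intro order_tendstoD(1)[of _ "peval (c j) z"]) (auto simp: isCont_def tendsto_nhds_iff)
  qed
  \<comment> \<open>In this ball the inactive inequalities hold automatically, so the penalty
    \<open>Q\<close> involves active constraints only.\<close>
  then obtain r where r: "r > 0" "\<And>x j. dist x z \<le> r \<Longrightarrow> j \<in> I - ?A \<Longrightarrow> peval (c j) x > 0"
    unfolding eventually_nhds_metric_le by blast
  define psi where "psi j t = (if j \<in> E then t else min t 0)" for j and t :: real
  have psi: "((\<lambda>t. (psi j t)\<^sup>2) has_real_derivative 2 * psi j t) (at t)" for j t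
    using min0_sq_derivative[of t] by (cases "j \<in> E") (auto simp: psi_def intro!: derivative_eq_intros)
  define Q where "Q x = (\<Sum>j\<in>?A. (psi j (peval (c j) x))\<^sup>2)" for x
  \<comment> \<open>The squared distance makes \<open>z\<close> the strict minimizer of
    \<open>G\<close> on the feasible part of the ball, which forces convergence to
    \<open>z\<close>.\<close>
  define G where "G x = peval F x + (norm (x - z))\<^sup>2" for x
  have psic: "continuous_on X (\<lambda>x. psi j (peval (c j) x))" for X j
    unfolding psi_def by (cases "j \<in> E") (auto intro!: continuous_intros continuous_on_peval)
  have Qc: "continuous_on X Q" and Gc: "continuous_on X G" for X
    unfolding Q_def G_def by (intro continuous_intros continuous_on_peval psic)+
  have Q0: "Q x \<ge> 0" for x unfolding Q_def by (intro sum_nonneg) auto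
  have Qz: "Q z = 0" by (auto simp: Q_def active_def psi_def intro!: sum.neutral)
  have feas: "x \<in> feas_set E I c" if x: "dist x z \<le> r" "Q x = 0" for x
  proof -
    have v: "psi j (peval (c j) x) = 0" if "j \<in> ?A" for j
      using x(2) finA that by (simp add: Q_def sum_nonneg_eq_0_iff)
    have "peval (c j) x = 0" if "j \<in> E" for j
      using v[of j] that EA by (auto simp: psi_def)
    moreover have "peval (c j) x \<ge> 0" if j: "j \<in> I" for j
    proof (cases "j \<in> ?A")
      case True
      then show ?thesis using v[OF True] j disj by (auto simp: psi_def min_def split: if_splits)
    next
      case False
      then show ?thesis using r(2)[OF x(1)] j by (simp add: less_imp_le)
    qed
    ultimately show ?thesis by (auto simp: feas_set_def)
  qed
  have "\<exists>x\<in>cball z r. \<forall>y\<in>cball z r. G x + real n * Q x \<le> G y + real n * Q y" for n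
    by (rule continuous_attains_inf) (use r(1) in \<open>auto intro!: continuous_intros Qc Gc\<close>)
  then obtain X where X: "\<And>n. X n \<in> cball z r"
    "\<And>n y. y \<in> cball z r \<Longrightarrow> G (X n) + real n * Q (X n) \<le> G y + real n * Q y" by metis
  have Xlim: "X \<longlonglongrightarrow> z"
  proof (rule metric_LIMSEQ_I)
    fix e :: real assume e: "e > 0"
    have S: "compact (cball z r - ball z e)" by (intro compact_diff) auto
    have P: "G x - G z > 0" if "x \<in> cball z r - ball z e" "Q x = 0" for x
    proof -
      have "x \<noteq> z" using that(1) e by auto
      then have "(norm (x - z))\<^sup>2 > 0" by simp
      moreover have "peval F z \<le> peval F x" using that by (intro min feas) (auto simp: dist_commute)
      moreover have "G z = peval F z" by (simp add: G_def)
      ultimately show ?thesis unfolding G_def by linarith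
    qed
    obtain N where N: "N \<ge> 0" "\<And>n x. n \<ge> N \<Longrightarrow> x \<in> cball z r - ball z e \<Longrightarrow> (G x - G z) + n * Q x > 0"
      by (rule penalty_pos[OF S continuous_on_diff[OF Gc continuous_on_const] Qc Q0 P]) blast+
    have "dist (X n) z < e" if "n \<ge> nat \<lceil>N\<rceil>" for n
    proof (rule ccontr)
      assume "\<not> dist (X n) z < e"
      then have "X n \<in> cball z r - ball z e" using X(1) by (auto simp: dist_commute)
      then have "(G (X n) - G z) + real n * Q (X n) > 0" using that by (intro N(2)) linarith+
      moreover have "G (X n) + real n * Q (X n) \<le> G z" using X(2)[of z n] r(1) Qz by simp
      ultimately show False by simp
    qed
    then show "\<exists>N. \<forall>n\<ge>N. dist (X n) z < e" by blast
  qed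
  \<comment> \<open>Read off from the derivative of the penalty \<open>n Q\<close>. For an
    inequality \<open>psi\<close> is at most 0, so the estimate is nonnegative.\<close>
  define mu where "mu n j = - 2 * real n * psi j (peval (c j) (X n))" for n j
  define W where "W n = grad F (X n) + 2 *\<^sub>R (X n - z)" for n
  have stat: "W n = (\<Sum>j\<in>?A. mu n j *\<^sub>R ?g j (X n))" if n: "dist (X n) z < r" for n
  proof -
    let ?x = "X n"
    define V where "V = W n - (\<Sum>j\<in>?A. mu n j *\<^sub>R ?g j ?x)"
    have dc: "(peval (c j) has_derivative (\<lambda>v. v \<bullet> ?g j ?x)) (at ?x)" for j
      by (rule has_derivative_peval)
    have dQ: "((\<lambda>x. (psi j (peval (c j) x))\<^sup>2) has_derivative
        (\<lambda>v. v \<bullet> ((2 * psi j (peval (c j) ?x)) *\<^sub>R ?g j ?x))) (at ?x)" for j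
      using has_derivative_compose[OF dc[of j] psi[of j, unfolded has_field_derivative_def]]
      by (simp add: mult_ac)
    have dn: "((\<lambda>x. (norm (x - z))\<^sup>2) has_derivative (\<lambda>v. v \<bullet> (2 *\<^sub>R (?x - z)))) (at ?x)"
      unfolding power2_norm_eq_inner
      by (auto intro!: derivative_eq_intros simp: inner_commute)
    have d: "((\<lambda>x. G x + real n * Q x) has_derivative (\<lambda>v. v \<bullet> V)) (at ?x)"
    proof -
      have "((\<lambda>x. G x + real n * Q x) has_derivative
        (\<lambda>v. (v \<bullet> grad F ?x + v \<bullet> (2 *\<^sub>R (?x - z))) + real n *
          (\<Sum>j\<in>?A. v \<bullet> ((2 * psi j (peval (c j) ?x)) *\<^sub>R ?g j ?x)))) (at ?x)"
        unfolding G_def Q_def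
        by (intro has_derivative_add has_derivative_mult_right has_derivative_sum dQ dn has_derivative_peval)
      moreover have "(v \<bullet> grad F ?x + v \<bullet> (2 *\<^sub>R (?x - z))) + real n *
          (\<Sum>j\<in>?A. v \<bullet> ((2 * psi j (peval (c j) ?x)) *\<^sub>R ?g j ?x)) = v \<bullet> V" for v
        by (simp add: V_def W_def mu_def inner_add_right inner_diff_right inner_sum_right sum_distrib_left
            sum_negf mult.assoc mult.left_commute[of 2])
      ultimately show ?thesis by simp
    qed
    have "(\<lambda>v. v \<bullet> V) = (\<lambda>v. 0)"
      by (rule differential_zero_maxmin[of ?x "ball z r", OF _ open_ball d])
        (use n X(2)[of _ n] in \<open>auto simp: dist_commute\<close>)
    then have "V \<bullet> V = 0" by meson
    then show ?thesis by (simp add: V_def)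
  qed
  have Wlim: "W \<longlonglongrightarrow> grad F z"
  proof -
    have "W \<longlonglongrightarrow> grad F z + 2 *\<^sub>R (z - z)"
      unfolding W_def by (intro tendsto_intros Xlim isCont_tendsto_compose[OF gcont])
    then show ?thesis by simp
  qed
  \<comment> \<open>Measures how far the \<open>w j\<close> are from being dual to the gradients at
    \<open>X n\<close> rather than at \<open>z\<close>.\<close>
  define eta where "eta n = (\<Sum>j\<in>?A. \<Sum>i\<in>?A. \<bar>w j \<bullet> (?g i z - ?g i (X n))\<bar>)" for n
  have eta0: "eta \<longlonglongrightarrow> 0"
  proof -
    have "eta \<longlonglongrightarrow> (\<Sum>j\<in>?A. \<Sum>i\<in>?A. \<bar>w j \<bullet> (?g i z - ?g i z)\<bar>)"
      unfolding eta_def by (intro tendsto_intros Xlim isCont_tendsto_compose[OF gcont])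
    then show ?thesis by simp
  qed
  define m where "m n = (\<Sum>j\<in>?A. \<bar>mu n j\<bar>)" for n
  have m0: "m n \<ge> 0" for n by (simp add: m_def sum_nonneg)
  have err: "\<bar>mu n j - w j \<bullet> W n\<bar> \<le> m n * eta n" if n: "dist (X n) z < r" and j: "j \<in> ?A" for n j
  proof -
    have "(\<Sum>i\<in>?A. mu n i * (w j \<bullet> ?g i z)) = (\<Sum>i\<in>?A. if i = j then mu n i else 0)"
      by (rule sum.cong) (use w j in auto)
    also have "\<dots> = mu n j" using finA j by simp
    finally have "mu n j - w j \<bullet> W n = (\<Sum>i\<in>?A. mu n i * (w j \<bullet> (?g i z - ?g i (X n))))"
      by (simp add: stat[OF n] inner_sum_right inner_diff_right right_diff_distrib sum_subtractf)
    also have "\<bar>\<dots>\<bar> \<le> (\<Sum>i\<in>?A. \<bar>mu n i\<bar> * \<bar>w j \<bullet> (?g i z - ?g i (X n))\<bar>)"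
      by (rule order.trans[OF sum_abs]) (simp add: abs_mult)
    also have "\<dots> \<le> (\<Sum>i\<in>?A. \<bar>mu n i\<bar> * eta n)"
    proof (intro sum_mono mult_left_mono)
      fix i assume i: "i \<in> ?A"
      have "\<bar>w j \<bullet> (?g i z - ?g i (X n))\<bar> \<le> (\<Sum>i\<in>?A. \<bar>w j \<bullet> (?g i z - ?g i (X n))\<bar>)"
        by (rule member_le_sum[OF i _ finA]) auto
      also have "\<dots> \<le> eta n" unfolding eta_def
        by (rule member_le_sum[OF j _ finA]) (auto intro: sum_nonneg)
      finally show "\<bar>w j \<bullet> (?g i z - ?g i (X n))\<bar> \<le> eta n" .
    qed auto
    finally show ?thesis by (simp add: m_def sum_distrib_right)
  qed
  have near: "\<forall>\<^sub>F n in sequentially. dist (X n) z < r" by (rule tendstoD[OF Xlim r(1)])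
  define a where "a n = (\<Sum>j\<in>?A. \<bar>w j \<bullet> W n\<bar>)" for n
  have alim: "a \<longlonglongrightarrow> (\<Sum>j\<in>?A. \<bar>w j \<bullet> grad F z\<bar>)"
    unfolding a_def by (intro tendsto_intros Wlim)
  have "(\<lambda>n. real (card ?A) * eta n) \<longlonglongrightarrow> real (card ?A) * 0" by (intro tendsto_intros eta0)
  then have small: "\<forall>\<^sub>F n in sequentially. real (card ?A) * eta n < 1 / 2"
    by (rule order_tendstoD(2)) simp
  \<comment> \<open>Boundedness of the estimates has to precede their convergence: the errors
    \<open>m n * eta n\<close>, summed over the active set, eventually amount to at most half of
    \<open>m n\<close> and are absorbed.\<close>
  have mle: "\<forall>\<^sub>F n in sequentially. m n \<le> 2 * a n"
    using near small
  proof eventually_elim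
    case (elim n)
    have "m n \<le> (\<Sum>j\<in>?A. \<bar>w j \<bullet> W n\<bar> + m n * eta n)"
      unfolding m_def[of n] by (rule sum_mono) (use err[OF elim(1)] in \<open>fastforce simp: m_def\<close>)
    also have "\<dots> = a n + m n * (real (card ?A) * eta n)" by (simp add: sum.distrib a_def)
    also have "\<dots> \<le> a n + m n * (1 / 2)" using elim(2) m0[of n] by (intro add_left_mono mult_left_mono) auto
    finally show ?case by simp
  qed
  have "(\<lambda>n. 2 * a n * eta n) \<longlonglongrightarrow> 2 * (\<Sum>j\<in>?A. \<bar>w j \<bullet> grad F z\<bar>) * 0"
    by (intro tendsto_intros alim eta0)
  then have ae0: "(\<lambda>n. 2 * a n * eta n) \<longlonglongrightarrow> 0" by simp
  define lam where "lam j = w j \<bullet> grad F z" for j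
  have mulim: "(\<lambda>n. mu n j) \<longlonglongrightarrow> lam j" if j: "j \<in> ?A" for j
  proof -
    have "(\<lambda>n. mu n j - w j \<bullet> W n) \<longlonglongrightarrow> 0"
    proof (rule Lim_null_comparison[OF _ ae0])
      show "\<forall>\<^sub>F n in sequentially. norm (mu n j - w j \<bullet> W n) \<le> 2 * a n * eta n"
        using near mle
      proof eventually_elim
        case (elim n)
        have "eta n \<ge> 0" by (simp add: eta_def sum_nonneg)
        then have "m n * eta n \<le> 2 * a n * eta n" using elim(2) by (rule mult_right_mono[rotated])
        then show ?case using err[OF elim(1) j] by simp
      qed
    qed
    moreover have "(\<lambda>n. w j \<bullet> W n) \<longlonglongrightarrow> lam j" unfolding lam_def by (intro tendsto_intros Wlim)
    ultimately have "(\<lambda>n. (mu n j - w j \<bullet> W n) + w j \<bullet> W n) \<longlonglongrightarrow> 0 + lam j" by (rule tendsto_add)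
    then show ?thesis by simp
  qed
  have "(\<lambda>n. \<Sum>j\<in>?A. mu n j *\<^sub>R ?g j (X n)) \<longlonglongrightarrow> (\<Sum>j\<in>?A. lam j *\<^sub>R ?g j z)"
    by (intro tendsto_intros mulim Xlim isCont_tendsto_compose[OF gcont])
  moreover have "\<forall>\<^sub>F n in sequentially. (\<Sum>j\<in>?A. mu n j *\<^sub>R ?g j (X n)) = W n"
    using near by eventually_elim (simp add: stat)
  ultimately have "W \<longlonglongrightarrow> (\<Sum>j\<in>?A. lam j *\<^sub>R ?g j z)"
    by (rule Lim_transform_eventually)
  then have eq: "grad F z = (\<Sum>j\<in>?A. lam j *\<^sub>R ?g j z)"
    using LIMSEQ_unique[OF Wlim] by blast
  have pos: "lam j \<ge> 0" if "j \<in> I \<inter> ?A" for j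
  proof (rule LIMSEQ_le_const[OF mulim])
    show "j \<in> ?A" using that by simp
    show "\<exists>N. \<forall>n\<ge>N. 0 \<le> mu n j"
      using that disj by (auto simp: mu_def psi_def intro!: exI[of _ 0] mult_nonneg_nonpos)
  qed
  define lam' where "lam' j = (if j \<in> ?A then lam j else 0)" for j
  have "(\<Sum>j\<in>E \<union> I. lam' j *\<^sub>R ?g j z) = (\<Sum>j\<in>?A. lam j *\<^sub>R ?g j z)"
    by (rule sum.mono_neutral_cong_right) (use fin in \<open>auto simp: lam'_def active_def\<close>)
  then have "multipliers E I c F z lam'"
    unfolding multipliers_def using eq pos by (auto simp: lam'_def active_def)
  then show thesis by (rule that)
qed

section \<open>Representation of nonnegative polynomials\<close>

lemma gradient_lagrangian:
  "grad (lagrangian E I c F lam) x =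
     grad F x - (\<Sum>j\<in>E \<union> I. lam j *\<^sub>R grad (c j) x)"
proof (rule gradient_eqI)
  have e: "peval (lagrangian E I c F lam) = (\<lambda>x. peval F x - (\<Sum>j\<in>E \<union> I. lam j * peval (c j) x))"
    by (simp add: lagrangian_def fun_eq_iff)
  show "(peval (lagrangian E I c F lam) has_derivative
      (\<lambda>v. v \<bullet> (grad F x - (\<Sum>j\<in>E \<union> I. lam j *\<^sub>R grad (c j) x)))) (at x)"
    unfolding e inner_diff_right inner_sum_right inner_scaleR_right
    by (intro has_derivative_diff has_derivative_sum has_derivative_mult_right has_derivative_peval)
qed

text \<open>The form vanishes exactly in the directions orthogonal to the gradient, so squares of
  active constraints can augment the Lagrangian outside the subspace on which \<open>sosc\<close>
  gives positivity.\<close>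

lemma square_expansion:
  assumes "peval q z = 0"
  obtains B where "q\<^sup>2 = quad z B" "\<And>v. form_at z B v = (v \<bullet> grad q z)\<^sup>2"
proof -
  obtain C where C: "q = (\<Sum>i\<in>UNIV. shift z i * C i)" using taylor_van[OF assms] by blast
  then have "q = pconst 0 + (\<Sum>i\<in>UNIV. shift z i * C i)" by simp
  from gradient_taylor1[OF this] have g: "grad q z = (\<chi> i. peval (C i) z)" .
  have "form_at z (\<lambda>i k. C i * C k) v = (v \<bullet> grad q z)\<^sup>2" for v
    by (simp add: g inner_chi form_at_def power2_eq_square sum_product mult_ac)
  moreover have "q\<^sup>2 = quad z (\<lambda>i k. C i * C k)"
    unfolding power2_eq_square by (rule van_prod[OF C C])
  ultimately show thesis using that by blast
qed

text \<open>Let \<open>w\<close> be 1 at \<open>z\<close> with double zeros at the other points.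
  Then \<open>e = 1 - (1 - w)^2\<close> agrees with 1 to second order at \<open>z\<close>, and the
  factorization \<open>(2 - w) w\<close> keeps the double zeros. Around \<open>z\<close> the values
  of \<open>w\<close> lie between 0 and 2, which gives the bound on \<open>e\<close>.\<close>

lemma bump_polynomial:
  fixes S :: "(real ^ 'n::finite) set"
  assumes S: "finite S" "z \<in> S"
  obtains e where "1 - e \<in> van2 z" "\<And>z'. z' \<in> S \<Longrightarrow> z' \<noteq> z \<Longrightarrow> e \<in> van2 z'"
    "\<forall>\<^sub>F x in nhds z. \<bar>peval e x\<bar> \<le> 1"
proof -
  let ?P = "node_poly (S - {z})"
  have nz: "peval ?P z > 0" by (rule node_poly_nz) (use S in auto)
  define w where "w = pconst (1 / peval ?P z) * ?P"
  define e where "e = 1 - (1 - w) * (1 - w)"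
  have wz: "peval w z = 1" using nz by (simp add: w_def)
  have "1 - e \<in> van2 z" unfolding e_def by (simp add: van2_prod wz)
  moreover have "e \<in> van2 z'" if "z' \<in> S" "z' \<noteq> z" for z'
  proof -
    have "w \<in> van2 z'" unfolding w_def by (intro van2_mult node_poly_van2) (use S that in auto)
    moreover have "e = (2 - w) * w" by (simp add: e_def algebra_simps)
    ultimately show ?thesis by (simp add: van2_mult)
  qed
  moreover have "\<forall>\<^sub>F x in nhds z. \<bar>peval e x\<bar> \<le> 1"
  proof -
    have "(peval w \<longlongrightarrow> 1) (nhds z)"
      using isCont_peval[of z w] wz by (metis isCont_def tendsto_nhds_iff)
    then have "\<forall>\<^sub>F x in nhds z. peval w x > 0" "\<forall>\<^sub>F x in nhds z. peval w x < 2"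
      by (auto elim!: order_tendstoD)
    then show ?thesis
    proof eventually_elim
      case (elim x)
      then have "\<bar>1 - peval w x\<bar> \<le> 1" by auto
      then have "(1 - peval w x)\<^sup>2 \<le> 1" by (simp add: abs_square_le_1)
      then show ?case by (simp add: e_def power2_eq_square)
    qed
  qed
  ultimately show thesis using that by blast
qed

lemma van2_one_minus_power: "w \<in> van2 z \<Longrightarrow> 1 - (1 - w) ^ N \<in> van2 z"
proof (induction N)
  case (Suc N)
  have eq: "1 - (1 - w) ^ Suc N = (1 - (1 - w) ^ N) + (1 - w) ^ N * w" by (simp add: algebra_simps)
  show ?case unfolding eq by (intro van2_add van2_mult Suc)
qed (simp add: van2_0)

text \<open>As \<open>p\<close> is nonnegative on the feasible set, its zeros there, if any, are its
  minimizers; the optimality conditions are asked at these zeros. The set \<open>S\<close> of zeros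
  may be empty.\<close>

locale minimum_zero =
  fixes E I :: "'j set" and c :: "'j \<Rightarrow> 'n::finite mpoly" and p :: "'n mpoly"
  assumes fin: "finite E" "finite I" and disj: "E \<inter> I = {}"
    and nonneg: "x \<in> feas_set E I c \<Longrightarrow> peval p x \<ge> 0"
    and oc: "z \<in> feas_set E I c \<Longrightarrow> peval p z = 0 \<Longrightarrow> optimality_conditions E I c p z"
begin

abbreviation K where "K \<equiv> feas_set E I c"
abbreviation reduct where
  "reduct l r \<equiv> p - (\<Sum>j\<in>I. c j * (l j)\<^sup>2) - (\<Sum>j\<in>E. c j * r j)"
abbreviation S where "S \<equiv> {x\<in>K. peval p x = 0}"

text \<open>
  The polynomial \<open>l\<^sub>j\<^sup>2\<close> is \<open>\<lambda>\<^sub>j - \<rho> c\<^sub>j\<close> up to a multiple of \<open>c\<^sub>j\<^sup>2\<close>, so that to second order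
  there remains the Lagrangian augmented by \<open>\<rho> \<Sum> c\<^sub>j\<^sup>2\<close>, which is positive definite for large \<open>\<rho>\<close>.
  Strict complementarity makes \<open>\<surd>\<lambda>\<^sub>j\<close> nonzero.
\<close>

lemma local_certificate:
  assumes zS: "z \<in> S"
  obtains l r where "reduct l r \<in> posdef z"
    "\<And>j. j \<in> I \<Longrightarrow> peval (c j * (l j)\<^sup>2) z = 0"
proof -
  let ?A = "active E I c z"
  have z: "z \<in> K" and p0: "peval p z = 0" using zS by auto
  note oc = oc[OF z p0]
  have finA: "finite ?A" using fin by (simp add: active_def)
  obtain lam where lam: "multipliers E I c p z lam"
    using multipliers_exist[OF fin disj z, of p] nonneg p0 oc by (auto simp: optimality_conditions_def)
  have scc: "scc I c z lam" and sosc: "sosc E I c p z lam"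
    using oc lam by (auto simp: optimality_conditions_def)
  have cE: "peval (c j) z = 0" if "j \<in> E" for j using z that by (auto simp: feas_set_def)
  have lc: "lam j * peval (c j) z = 0" if "j \<in> E \<union> I" for j
    using lam cE that by (auto simp: multipliers_def)
  have lpos: "lam j > 0" if "j \<in> I \<inter> ?A" for j
    using scc that by (force simp: scc_def active_def)
  have l0: "lam j = 0" if "j \<in> I - ?A" for j
    using lc[of j] that by (auto simp: active_def)
  let ?L = "lagrangian E I c p lam"
  have "peval ?L z = 0" using p0 lc by (simp add: lagrangian_def sum.neutral)
  moreover have "grad ?L z = 0"
    using lam by (simp add: gradient_lagrangian multipliers_def)
  ultimately obtain A where A: "?L = quad z A"
    "\<And>v. 2 * form_at z A v = v \<bullet> (hessian (peval ?L) z *v v)"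
    using second_order_expansion by blast
  have "\<exists>B. (\<Sum>j\<in>X. (c j)\<^sup>2) = quad z B \<and> (\<forall>v. form_at z B v = (\<Sum>j\<in>X. (v \<bullet> grad (c j) z)\<^sup>2))"
    if "finite X" "X \<subseteq> ?A" for X
    using that
  proof (induction X rule: finite_induct)
    case empty
    show ?case by (rule exI[of _ "\<lambda>_ _. 0"]) (simp add: quad_def form_at_def)
  next
    case (insert j X)
    then obtain B where B: "(\<Sum>j\<in>X. (c j)\<^sup>2) = quad z B"
      "\<And>v. form_at z B v = (\<Sum>j\<in>X. (v \<bullet> grad (c j) z)\<^sup>2)" by auto
    obtain B' where B': "(c j)\<^sup>2 = quad z B'" "\<And>v. form_at z B' v = (v \<bullet> grad (c j) z)\<^sup>2"
      using square_expansion[of "c j" z] insert.prems by (auto simp: active_def)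
    show ?case
      by (rule exI[of _ "\<lambda>i k. B' i k + B i k"])
        (use insert.hyps in \<open>simp add: B B' quad_add[symmetric] form_at_add\<close>)
  qed
  from this[OF finA order.refl] obtain B where B: "(\<Sum>j\<in>?A. (c j)\<^sup>2) = quad z B"
    "\<And>v. form_at z B v = (\<Sum>j\<in>?A. (v \<bullet> grad (c j) z)\<^sup>2)" by auto
  define q where "q v = (\<Sum>j\<in>?A. (v \<bullet> grad (c j) z)\<^sup>2)" for v
  have q0: "q v \<ge> 0" for v by (simp add: q_def sum_nonneg)
  have pos: "form_at z A v > 0" if "v \<noteq> 0" "q v = 0" for v
  proof -
    have "\<forall>j\<in>?A. v \<bullet> grad (c j) z = 0"
      using that(2) finA by (simp add: q_def sum_nonneg_eq_0_iff)
    then have "v \<bullet> (hessian (peval ?L) z *v v) > 0" using sosc that(1) by (simp add: sosc_def)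
    then show ?thesis using A(2)[of v] by simp
  qed
  obtain rho where rho: "rho \<ge> 0" "\<And>v. v \<in> sphere 0 1 \<Longrightarrow> form_at z A v + rho * q v > 0"
  proof (rule penalty_pos[of "sphere 0 1" "form_at z A" q])
    show "continuous_on (sphere 0 1) q" unfolding q_def by (intro continuous_intros)
    show "form_at z A v > 0" if "v \<in> sphere 0 1" "q v = 0" for v
      using that by (intro pos) auto
  qed (use that q0 in \<open>auto simp: continuous_on_form_at\<close>)
  have pd: "form_at z A v + rho * q v > 0" if "v \<noteq> 0" for v
    by (rule form_pos_of_sphere[of "\<lambda>v. form_at z A v + rho * q v", OF _ rho(2) that])
      (simp_all add: q_def form_at_scale sum_distrib_left power_mult_distrib distrib_left mult_ac)
  have "?L + pconst rho * (\<Sum>j\<in>?A. (c j)\<^sup>2) = quad z (\<lambda>i k. A i k + pconst rho * B i k)"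
    by (simp add: A(1) B(1) quad_mult quad_add)
  moreover have "form_at z (\<lambda>i k. A i k + pconst rho * B i k) v = form_at z A v + rho * q v" for v
    unfolding form_at_add q_def B(2)[symmetric] by (simp add: form_at_def sum_distrib_left mult_ac)
  ultimately have main: "?L + pconst rho * (\<Sum>j\<in>?A. (c j)\<^sup>2) \<in> posdef z"
    unfolding posdef_def using pd by auto
  define l where "l j = (if j \<in> ?A then pconst (sqrt (lam j)) - pconst (rho / (2 * sqrt (lam j))) * c j else 0)" for j
  define r where "r j = pconst (lam j) - pconst rho * c j" for j
  define k :: "'j \<Rightarrow> 'n mpoly" where "k j = pconst ((rho / (2 * sqrt (lam j)))\<^sup>2)" for j
  have cl: "c j * (l j)\<^sup>2 = pconst (lam j) * c j - pconst rho * (c j)\<^sup>2 + k j * c j * (c j)\<^sup>2" if j: "j \<in> I \<inter> ?A" for j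
  proof -
    define s where "s = sqrt (lam j)"
    have s: "s > 0" "s\<^sup>2 = lam j" using lpos[OF j] by (simp_all add: s_def)
    define t where "t = rho / (2 * s)"
    have t: "2 * (s * t) = rho" using s by (simp add: t_def)
    have "c j * (l j)\<^sup>2 = c j * (pconst s - pconst t * c j)\<^sup>2" using j by (simp add: l_def s_def t_def)
    also have "\<dots> = pconst (s\<^sup>2) * c j - pconst (2 * (s * t)) * (c j)\<^sup>2 + pconst (t\<^sup>2) * c j * (c j)\<^sup>2"
      by (simp add: pconst_mult pconst_power power2_eq_square algebra_simps)
    finally show ?thesis by (simp only: s t k_def s_def[symmetric] t_def[symmetric])
  qed
  have "(\<Sum>j\<in>I. c j * (l j)\<^sup>2) = (\<Sum>j\<in>I \<inter> ?A. c j * (l j)\<^sup>2)"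
    by (rule sum.mono_neutral_right) (use fin in \<open>auto simp: l_def\<close>)
  also have "\<dots> = (\<Sum>j\<in>I \<inter> ?A. pconst (lam j) * c j) - pconst rho * (\<Sum>j\<in>I \<inter> ?A. (c j)\<^sup>2) + (\<Sum>j\<in>I \<inter> ?A. k j * c j * (c j)\<^sup>2)"
    by (simp add: cl sum.distrib sum_subtractf sum_distrib_left)
  also have "(\<Sum>j\<in>I \<inter> ?A. pconst (lam j) * c j) = (\<Sum>j\<in>I. pconst (lam j) * c j)"
    by (rule sum.mono_neutral_left) (use fin l0 in auto)
  finally have sI: "(\<Sum>j\<in>I. c j * (l j)\<^sup>2) = (\<Sum>j\<in>I. pconst (lam j) * c j) - pconst rho * (\<Sum>j\<in>I \<inter> ?A. (c j)\<^sup>2)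
      + (\<Sum>j\<in>I \<inter> ?A. k j * c j * (c j)\<^sup>2)" .
  have sE: "(\<Sum>j\<in>E. c j * r j) = (\<Sum>j\<in>E. pconst (lam j) * c j) - pconst rho * (\<Sum>j\<in>E. (c j)\<^sup>2)"
    by (simp add: r_def right_diff_distrib sum_subtractf sum_distrib_left power2_eq_square mult_ac)
  have AE: "?A = E \<union> (I \<inter> ?A)" using cE by (auto simp: active_def)
  have sA: "(\<Sum>j\<in>?A. (c j)\<^sup>2) = (\<Sum>j\<in>E. (c j)\<^sup>2) + (\<Sum>j\<in>I \<inter> ?A. (c j)\<^sup>2)"
    by (subst AE, rule sum.union_disjoint) (use fin disj in auto)
  have sL: "?L = p - ((\<Sum>j\<in>E. pconst (lam j) * c j) + (\<Sum>j\<in>I. pconst (lam j) * c j))"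
    unfolding lagrangian_def using fin disj by (simp add: sum.union_disjoint)
  have "reduct l r =
     (?L + pconst rho * (\<Sum>j\<in>?A. (c j)\<^sup>2)) + - (\<Sum>j\<in>I \<inter> ?A. k j * c j * (c j)\<^sup>2)"
    unfolding sI sE sA sL by (simp add: algebra_simps)
  \<comment> \<open>What remains beside the augmented Lagrangian is of third order, since the active
    \<open>c j\<close> vanish at \<open>z\<close>.\<close>
  also have "\<dots> \<in> posdef z"
  proof (rule posdef_add_van3[OF main], intro van3_minus van3_sum)
    fix j assume "j \<in> I \<inter> ?A"
    then have "peval (c j) z = 0" by (simp add: active_def)
    then show "k j * c j * (c j)\<^sup>2 \<in> van3 z"
      unfolding power2_eq_square by (intro van3_prod van2_prod) simp_all
  qed
  finally have "reduct l r \<in> posdef z" .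
  moreover have "peval (c j * (l j)\<^sup>2) z = 0" if "j \<in> I" for j
    by (auto simp: l_def active_def)
  ultimately show thesis using that by blast
qed

text \<open>On \<open>K\<close> the terms subtracted in \<open>reduct\<close> are nonnegative, so
  \<open>p\<close> is at least \<open>reduct\<close>, which is positive around \<open>z\<close>
  except at \<open>z\<close>. The zeros are therefore isolated, whereas an infinite compact set has
  an accumulation point in itself.\<close>

lemma finite_minimizers:
  assumes "compact K"
  shows "finite S"
proof (rule ccontr)
  assume "infinite S"
  moreover have "compact S"
  proof -
    have "closed {x. peval p x = 0}" by (intro closed_Collect_eq continuous_on_peval continuous_on_const)
    then have "compact (K \<inter> {x. peval p x = 0})" by (rule compact_Int_closed[OF assms])
    then show ?thesis by (simp add: Int_def)
  qed
  ultimately obtain z where z: "z \<in> S" "z islimpt S"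
    using compact_eq_Bolzano_Weierstrass by blast
  obtain l r where lr: "reduct l r \<in> posdef z"
    by (rule local_certificate[OF z(1)]) (rule that)
  obtain e where e: "e > 0" "\<And>x. dist x z < e \<Longrightarrow> x \<noteq> z \<Longrightarrow> peval (reduct l r) x > 0"
    using posdef_local_pos[OF lr] by blast
  obtain x where x: "x \<in> S" "x \<noteq> z" "dist x z < e"
    using z(2) e(1) by (auto simp: islimpt_approachable)
  have "(\<Sum>j\<in>E. peval (c j) x * peval (r j) x) = 0"
    by (rule sum.neutral) (use x in \<open>auto simp: feas_set_def\<close>)
  moreover have "(\<Sum>j\<in>I. peval (c j) x * (peval (l j) x)\<^sup>2) \<ge> 0"
    by (rule sum_nonneg) (use x in \<open>auto simp: feas_set_def\<close>)
  ultimately show False using e(2)[OF x(3,2)] x(1) by simp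
qed


text \<open>
  Near each zero \<open>z\<close> the polynomial \<open>p'\<close> dominates \<open>p - V\<^sub>z - \<Sum> V\<^sub>w e\<^sub>w\<^sup>2\<close> on \<open>K\<close>, where \<open>w\<close> runs
  over the other zeros, on a neighbourhood that does not depend on \<open>N\<close>; away from the zeros
  the factor \<open>(1 - \<bar>x - z\<bar>\<^sup>2 / D) ^ N\<close> makes the correction smaller than \<open>p\<close>.
\<close>

lemma global_certificate:
  assumes K: "compact K"
  obtains p' t q where "p = p' + (\<Sum>j\<in>E. c j * q j) + (\<Sum>j\<in>I. c j * t j)" "\<And>j. j \<in> I \<Longrightarrow> t j \<in> SOS"
    "\<And>z. z \<in> S \<Longrightarrow> p' \<in> posdef z" "\<And>x. x \<in> K - S \<Longrightarrow> peval p' x > 0"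
proof -
  have S: "finite S" by (rule finite_minimizers[OF K])
  define Q where "Q z l r \<longleftrightarrow> reduct l r \<in> posdef z \<and>
      (\<forall>j\<in>I. peval (c j * (l j)\<^sup>2) z = 0)" for z l r
  have "\<exists>l r. Q z l r" if z: "z \<in> S" for z
    by (rule local_certificate[OF z]) (auto simp: Q_def)
  then obtain l r where Q: "\<And>z. z \<in> S \<Longrightarrow> Q z (l z) (r z)" by metis
  define R where "R z e \<longleftrightarrow> 1 - e \<in> van2 z \<and> (\<forall>z'\<in>S. z' \<noteq> z \<longrightarrow> e \<in> van2 z') \<and>
      (\<forall>\<^sub>F x in nhds z. \<bar>peval e x\<bar> \<le> 1)" for z e
  have "\<exists>e. R z e" if "z \<in> S" for z
    by (rule bump_polynomial[OF S that]) (auto simp: R_def)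
  then obtain e where R: "\<And>z. z \<in> S \<Longrightarrow> R z (e z)" by metis
  have e: "\<And>z. z \<in> S \<Longrightarrow> 1 - e z \<in> van2 z"
    "\<And>z z'. z \<in> S \<Longrightarrow> z' \<in> S \<Longrightarrow> z' \<noteq> z \<Longrightarrow> e z \<in> van2 z'"
    "\<And>z. z \<in> S \<Longrightarrow> \<forall>\<^sub>F x in nhds z. \<bar>peval (e z) x\<bar> \<le> 1"
    using R unfolding R_def by blast+
  define V where "V z = (\<Sum>j\<in>I. c j * (l z j)\<^sup>2)" for z
  define U where "U z = (\<Sum>j\<in>E. c j * r z j)" for z
  have G: "p - V z - U z \<in> posdef z" if "z \<in> S" for z
    using Q[OF that] by (simp add: Q_def V_def U_def)
  have Vz: "peval (V z) z = 0" if "z \<in> S" for z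
    using Q[OF that] by (auto simp: Q_def V_def intro!: sum.neutral)
  have UK: "peval (U z) x = 0" if "x \<in> K" for z x
    using that by (auto simp: U_def feas_set_def intro!: sum.neutral)
  have VK: "peval (V z) x \<ge> 0" if "x \<in> K" for z x
    using that by (auto simp: V_def feas_set_def intro!: sum_nonneg)
  obtain D where D: "D > 0" "\<And>x z. x \<in> K \<Longrightarrow> z \<in> K \<Longrightarrow> (norm (x - z))\<^sup>2 \<le> D"
  proof -
    obtain B where B: "\<And>x. x \<in> K \<Longrightarrow> norm x \<le> B"
      using compact_imp_bounded[OF K] by (auto simp: bounded_iff)
    have "(norm (x - z))\<^sup>2 \<le> (2 * \<bar>B\<bar>)\<^sup>2 + 1" if "x \<in> K" "z \<in> K" for x z
    proof -
      have "norm (x - z) \<le> 2 * \<bar>B\<bar>"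
        using norm_triangle_ineq4[of x z] B[OF that(1)] B[OF that(2)] by linarith
      then have "(norm (x - z))\<^sup>2 \<le> (2 * \<bar>B\<bar>)\<^sup>2" by (intro power_mono) auto
      then show ?thesis by linarith
    qed
    moreover have "(2 * \<bar>B\<bar>)\<^sup>2 + 1 > 0" by (simp add: add_nonneg_pos)
    ultimately show thesis using that by blast
  qed
  define s where "s z = 1 - pconst (1 / D) * sqdist z" for z :: "real ^ 'n"
  have sK: "0 \<le> peval (s z) x" "peval (s z) x \<le> 1" if "x \<in> K" "z \<in> K" for x z
    using D(1) D(2)[OF that] by (simp_all add: s_def peval_sqdist)
  \<comment> \<open>\<open>e z\<close> separates the zeros to second order; \<open>s z\<close>
    equals 1 at \<open>z\<close> and stays between 0 and 1 on \<open>K\<close>, so its powers damp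
    the term away from \<open>z\<close>.\<close>
  define b where "b N z = e z * s z ^ N" for N z
  \<comment> \<open>\<open>U z\<close> vanishes on \<open>K\<close>, so it is weighted by
    \<open>e z\<close> alone: it corrects the expansion at the zeros and leaves the values on
    \<open>K\<close> unchanged.\<close>
  define p' where "p' N = p - (\<Sum>z\<in>S. V z * (b N z)\<^sup>2) - (\<Sum>z\<in>S. U z * (e z)\<^sup>2)" for N
  have van_e: "(e z')\<^sup>2 * q \<in> van3 z" "q * (e z')\<^sup>2 \<in> van3 z" if "z \<in> S" "z' \<in> S - {z}" for z z' q
  proof -
    have "e z' \<in> van2 z" using e(2)[of z' z] that by auto
    then have "e z' * e z' \<in> van3 z" by (rule van3_prod) (use van2_peval \<open>e z' \<in> van2 z\<close> in auto)
    then show "q * (e z')\<^sup>2 \<in> van3 z" by (simp add: power2_eq_square van3_mult)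
    then show "(e z')\<^sup>2 * q \<in> van3 z" by (simp add: mult.commute)
  qed
  have one_minus_sq: "1 - a\<^sup>2 \<in> van2 z" if "1 - a \<in> van2 z" for a z :: _
  proof -
    have "1 - a\<^sup>2 = (1 + a) * (1 - a)" by (simp add: power2_eq_square algebra_simps)
    then show ?thesis using that by (simp add: van2_mult)
  qed
  have pd: "p' N \<in> posdef z" if z: "z \<in> S" for N z
  proof -
    have b1: "1 - b N z \<in> van2 z"
    proof -
      have "1 - s z ^ N \<in> van2 z"
        unfolding s_def by (intro van2_one_minus_power van2_mult sqdist_van2)
      moreover have "1 - b N z = (1 - e z) + e z * (1 - s z ^ N)" by (simp add: b_def algebra_simps)
      ultimately show ?thesis using e(1)[OF z] by (simp only: van2_add van2_mult)
    qed
    \<comment> \<open>Relative to \<open>p - V z - U z\<close> only third order terms at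
      \<open>z\<close> appear: the weights of \<open>V z\<close> and \<open>U z\<close> are 1 to
      second order there, and those of the other zeros contain the square of a polynomial with a
      double zero at \<open>z\<close>.\<close>
    have "p' N = (p - V z - U z) + (V z * (1 - (b N z)\<^sup>2) + U z * (1 - (e z)\<^sup>2)
        - (\<Sum>z'\<in>S-{z}. V z' * (b N z')\<^sup>2) - (\<Sum>z'\<in>S-{z}. U z' * (e z')\<^sup>2))"
      unfolding p'_def sum.remove[OF S z] by (simp add: algebra_simps)
    also have "\<dots> \<in> posdef z"
    proof (intro posdef_add_van3 G z van3_add van3_diff van3_sum)
      show "V z * (1 - (b N z)\<^sup>2) \<in> van3 z" by (intro van3_prod one_minus_sq b1 Vz z)
      show "U z * (1 - (e z)\<^sup>2) \<in> van3 z" by (intro van3_prod one_minus_sq e UK z) (use z in auto)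
      show "V z' * (b N z')\<^sup>2 \<in> van3 z" if "z' \<in> S - {z}" for z'
        using van_e(2)[OF z that, of "V z' * (s z' ^ N)\<^sup>2"] by (simp add: b_def power_mult_distrib mult_ac)
      show "U z' * (e z')\<^sup>2 \<in> van3 z" if "z' \<in> S - {z}" for z' by (rule van_e(2)[OF z that])
    qed
    finally show ?thesis .
  qed
  have p'K: "peval (p' N) x = peval p x - (\<Sum>z\<in>S. peval (V z) x * (peval (b N z) x)\<^sup>2)" if "x \<in> K" for N x
    using UK[OF that] by (simp add: p'_def)
  have bK: "(peval (b N z) x)\<^sup>2 \<le> (peval (e z) x)\<^sup>2" if "x \<in> K" "z \<in> K" for N x z
  proof -
    have "0 \<le> peval (s z) x ^ N" "peval (s z) x ^ N \<le> 1" using sK[OF that] by (auto intro: power_le_one)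
    then have "(peval (s z) x ^ N)\<^sup>2 \<le> 1" by (simp add: power_le_one)
    then show ?thesis by (simp add: b_def power_mult_distrib mult_left_le)
  qed
  define near where "near z \<delta> \<longleftrightarrow> \<delta> > 0 \<and> (\<forall>x\<in>K. x \<noteq> z \<longrightarrow> dist x z < \<delta> \<longrightarrow> (\<forall>N. peval (p' N) x > 0))" for z \<delta>
  have "\<exists>\<delta>. near z \<delta>" if z: "z \<in> S" for z
  proof -
    have zK: "z \<in> K" using z by simp
    have "(p - V z - U z) + - (\<Sum>z'\<in>S-{z}. V z' * (e z')\<^sup>2) \<in> posdef z"
      by (intro posdef_add_van3 G z van3_minus van3_sum van_e(2))
    from posdef_local_pos[OF this] obtain d1 where d1: "d1 > 0"
      "\<And>x. dist x z < d1 \<Longrightarrow> x \<noteq> z \<Longrightarrow> peval (p - V z - U z + - (\<Sum>z'\<in>S-{z}. V z' * (e z')\<^sup>2)) x > 0"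
      by blast
    obtain d2 where d2: "d2 > 0" "\<And>x. dist x z < d2 \<Longrightarrow> \<bar>peval (e z) x\<bar> \<le> 1"
      using e(3)[OF z] by (auto simp: eventually_nhds_metric)
    have "peval (p' N) x > 0" if x: "x \<in> K" "x \<noteq> z" "dist x z < min d1 d2" for x N
    proof -
      have "0 < peval p x - (peval (V z) x * 1 + (\<Sum>z'\<in>S-{z}. peval (V z') x * (peval (e z') x)\<^sup>2))"
        using d1(2)[of x] x UK[OF x(1)] by simp
      also have "\<dots> \<le> peval p x - (peval (V z) x * (peval (b N z) x)\<^sup>2 + (\<Sum>z'\<in>S-{z}. peval (V z') x * (peval (b N z') x)\<^sup>2))"
      proof (intro diff_left_mono add_mono sum_mono mult_left_mono VK bK x)
        have "(peval (e z) x)\<^sup>2 \<le> 1" using d2(2)[of x] x(3) by (simp add: abs_square_le_1)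
        then show "(peval (b N z) x)\<^sup>2 \<le> 1" using bK[OF x(1) zK, of N] by linarith
      qed auto
      also have "\<dots> = peval (p' N) x" unfolding p'K[OF x(1)] sum.remove[OF S z] by simp
      finally show ?thesis .
    qed
    then show ?thesis using d1(1) d2(1) unfolding near_def by (intro exI[of _ "min d1 d2"]) auto
  qed
  then obtain del where near: "\<And>z. z \<in> S \<Longrightarrow> near z (del z)" by metis
  have del: "\<And>z. z \<in> S \<Longrightarrow> del z > 0"
    "\<And>z x N. z \<in> S \<Longrightarrow> x \<in> K \<Longrightarrow> x \<noteq> z \<Longrightarrow> dist x z < del z \<Longrightarrow> peval (p' N) x > 0"
    using near unfolding near_def by blast+
  define T where "T = K - (\<Union>z\<in>S. ball z (del z))"
  have T: "compact T" unfolding T_def by (intro compact_diff K open_UN) auto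
  have "\<exists>N. \<forall>x\<in>T. peval (p' N) x > 0"
  proof (cases "T = {}")
    case False
    obtain y where y: "y \<in> T" "\<And>x. x \<in> T \<Longrightarrow> peval p y \<le> peval p x"
      using continuous_attains_inf[OF T False continuous_on_peval] by blast
    have py: "peval p y > 0"
      using y(1) nonneg[of y] del(1) by (force simp: T_def)
    have "\<exists>C\<ge>0. \<forall>x\<in>K. peval (V z * (e z)\<^sup>2) x \<le> C" for z
    proof -
      have "bounded (peval (V z * (e z)\<^sup>2) ` K)"
        by (intro compact_imp_bounded compact_continuous_image continuous_on_peval K)
      then obtain C where "\<And>x. x \<in> K \<Longrightarrow> \<bar>peval (V z * (e z)\<^sup>2) x\<bar> \<le> C" by (auto simp: bounded_iff)
      then show ?thesis by (intro exI[of _ "\<bar>C\<bar>"]) fastforce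
    qed
    then obtain C where C: "\<And>z. C z \<ge> 0" "\<And>z x. x \<in> K \<Longrightarrow> peval (V z * (e z)\<^sup>2) x \<le> C z" by metis
    \<comment> \<open>An upper bound for \<open>s z\<close> on \<open>K\<close> outside the ball of
      radius \<open>del z\<close>; it is below 1, so its powers tend to 0.\<close>
    define h where "h z = max 0 (1 - (del z)\<^sup>2 / D)" for z
    have h: "0 \<le> h z" "h z < 1" if "z \<in> S" for z using del(1)[OF that] D(1) by (auto simp: h_def)
    have "(\<lambda>N. \<Sum>z\<in>S. C z * (h z ^ N)\<^sup>2) \<longlonglongrightarrow> (\<Sum>z\<in>S. C z * 0\<^sup>2)"
      by (intro tendsto_intros LIMSEQ_realpow_zero h)
    then have "\<forall>\<^sub>F N in sequentially. (\<Sum>z\<in>S. C z * (h z ^ N)\<^sup>2) < peval p y"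
      by (rule order_tendstoD(2)) (use py in simp)
    then obtain N where N: "(\<Sum>z\<in>S. C z * (h z ^ N)\<^sup>2) < peval p y" by (auto simp: eventually_sequentially)
    have "peval (p' N) x > 0" if x: "x \<in> T" for x
    proof -
      have xK: "x \<in> K" using x by (simp add: T_def)
      have "(\<Sum>z\<in>S. peval (V z) x * (peval (b N z) x)\<^sup>2) \<le> (\<Sum>z\<in>S. C z * (h z ^ N)\<^sup>2)"
      proof (rule sum_mono)
        fix z assume z: "z \<in> S"
        then have zK: "z \<in> K" by simp
        have "del z \<le> norm (x - z)" using x z by (force simp: T_def dist_norm norm_minus_commute)
        then have "(del z)\<^sup>2 \<le> (norm (x - z))\<^sup>2" using del(1)[OF z] by (intro power_mono) auto
        then have "peval (s z) x \<le> h z" using D(1) by (simp add: s_def peval_sqdist h_def divide_right_mono max.coboundedI2)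
        then have "(peval (s z) x ^ N)\<^sup>2 \<le> (h z ^ N)\<^sup>2" using sK(1)[OF xK zK] by (intro power_mono) auto
        then have "peval (V z * (e z)\<^sup>2) x * (peval (s z) x ^ N)\<^sup>2 \<le> C z * (h z ^ N)\<^sup>2"
          using C VK[OF xK, of z] xK by (intro mult_mono) auto
        then show "peval (V z) x * (peval (b N z) x)\<^sup>2 \<le> C z * (h z ^ N)\<^sup>2"
          by (simp add: b_def power_mult_distrib mult_ac)
      qed
      then show ?thesis using N y(2)[OF x] by (simp add: p'K[OF xK])
    qed
    then show ?thesis by blast
  qed simp
  then obtain N where N: "\<And>x. x \<in> T \<Longrightarrow> peval (p' N) x > 0" by blast
  have pos: "peval (p' N) x > 0" if x: "x \<in> K - S" for x
  proof (cases "x \<in> T")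
    case False
    then obtain z where z: "z \<in> S" "dist x z < del z" using x by (auto simp: T_def dist_commute)
    then have "x \<noteq> z" using x by auto
    then show ?thesis using del(2)[OF z(1)] x z(2) by blast
  qed (rule N)
  have "p = p' N + (\<Sum>j\<in>E. c j * (\<Sum>z\<in>S. r z j * (e z)\<^sup>2)) + (\<Sum>j\<in>I. c j * (\<Sum>z\<in>S. (l z j * b N z)\<^sup>2))"
  proof -
    have "(\<Sum>j\<in>E. c j * (\<Sum>z\<in>S. r z j * (e z)\<^sup>2)) = (\<Sum>z\<in>S. U z * (e z)\<^sup>2)"
      unfolding U_def sum_distrib_left sum_distrib_right by (subst sum.swap) (simp add: mult_ac)
    moreover have "(\<Sum>j\<in>I. c j * (\<Sum>z\<in>S. (l z j * b N z)\<^sup>2)) = (\<Sum>z\<in>S. V z * (b N z)\<^sup>2)"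
      unfolding V_def sum_distrib_left sum_distrib_right by (subst sum.swap) (simp add: power_mult_distrib mult_ac)
    ultimately show ?thesis by (simp add: p'_def)
  qed
  then show thesis
    using that[of "p' N" "\<lambda>j. \<Sum>z\<in>S. r z j * (e z)\<^sup>2" "\<lambda>j. \<Sum>z\<in>S. (l z j * b N z)\<^sup>2"] pd pos
    by (simp add: SOS_sum)
qed

end

section \<open>Truncated quadratic modules and pseudo-moments\<close>

abbreviation qmodule :: "('j \<Rightarrow> 'n::finite mpoly) \<Rightarrow> 'j set \<Rightarrow> 'j set \<Rightarrow> 'n mpoly set" where
  "qmodule c E I \<equiv> Ideal_of c E + QM c I"

lemma qmoduleI:
  "s \<in> SOS \<Longrightarrow> (\<And>j. j \<in> I \<Longrightarrow> t j \<in> SOS) \<Longrightarrow>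
    (\<Sum>j\<in>E. c j * q j) + (s + (\<Sum>j\<in>I. c j * t j)) \<in> qmodule c E I"
  unfolding set_plus_def Ideal_of_def QM_def by blast

lemma qmoduleE:
  assumes "m \<in> qmodule c E I"
  obtains q s t where "m = (\<Sum>j\<in>E. c j * q j) + (s + (\<Sum>j\<in>I. c j * t j))"
    "s \<in> SOS" "\<forall>j\<in>I. t j \<in> SOS"
  using assms unfolding set_plus_def Ideal_of_def QM_def by blast

lemma qmodule_add:
  assumes "m \<in> qmodule c E I" "m' \<in> qmodule c E I" shows "m + m' \<in> qmodule c E I"
proof -
  obtain q s t where 1: "m = (\<Sum>j\<in>E. c j * q j) + (s + (\<Sum>j\<in>I. c j * t j))"
    "s \<in> SOS" "\<forall>j\<in>I. t j \<in> SOS" using assms(1) by (rule qmoduleE)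
  obtain q' s' t' where 2: "m' = (\<Sum>j\<in>E. c j * q' j) + (s' + (\<Sum>j\<in>I. c j * t' j))"
    "s' \<in> SOS" "\<forall>j\<in>I. t' j \<in> SOS" using assms(2) by (rule qmoduleE)
  have "m + m' = (\<Sum>j\<in>E. c j * (q j + q' j)) + ((s + s') + (\<Sum>j\<in>I. c j * (t j + t' j)))"
    by (simp add: 1(1) 2(1) distrib_left sum.distrib)
  then show ?thesis by (simp only:) (intro qmoduleI SOS_add 1(2) 2(2) 1(3)[rule_format] 2(3)[rule_format])
qed

lemma qmodule_SOS_mult:
  assumes "r \<in> SOS" "m \<in> qmodule c E I" shows "r * m \<in> qmodule c E I"
proof -
  obtain q s t where 1: "m = (\<Sum>j\<in>E. c j * q j) + (s + (\<Sum>j\<in>I. c j * t j))"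
    "s \<in> SOS" "\<forall>j\<in>I. t j \<in> SOS" using assms(2) by (rule qmoduleE)
  have "r * m = (\<Sum>j\<in>E. c j * (r * q j)) + (r * s + (\<Sum>j\<in>I. c j * (r * t j)))"
    by (simp add: 1(1) distrib_left sum_distrib_left mult_ac)
  then show ?thesis by (simp only:) (intro qmoduleI SOS_mult 1(2) 1(3)[rule_format] assms)
qed

lemma qmodule_SOS: "s \<in> SOS \<Longrightarrow> s \<in> qmodule c E I"
  using qmoduleI[where t = "\<lambda>_. 0" and q = "\<lambda>_. 0"] by simp

lemma qmodule_eq_constraint:
  assumes "finite E" "j \<in> E" shows "c j * r \<in> qmodule c E I"
proof -
  have "(\<Sum>i\<in>E. c i * (if i = j then r else 0)) = c j * r"
    using assms by (simp add: if_distrib cong: if_cong)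
  then show ?thesis using qmoduleI[where s = 0 and t = "\<lambda>_. 0" and q = "\<lambda>i. if i = j then r else 0" and c = c and E = E and I = I] by simp
qed

lemma qmodule_ineq_constraint:
  assumes "finite I" "j \<in> I" shows "c j \<in> qmodule c E I"
proof -
  have "(\<Sum>i\<in>I. c i * (if i = j then 1 else 0)) = c j"
    using assms by (simp add: if_distrib cong: if_cong)
  then show ?thesis using qmoduleI[where s = 0 and q = "\<lambda>_. 0" and t = "\<lambda>i. if i = j then 1 else 0" and c = c and E = E and I = I] by simp
qed

lemma qmodule_nonneg:
  fixes c :: "'j \<Rightarrow> 'n::finite mpoly"
  assumes "m \<in> qmodule c E I" "x \<in> feas_set E I c" shows "peval m x \<ge> 0"
proof -
  have S: "peval s x \<ge> 0" if "s \<in> SOS" for s :: "'n mpoly"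
    using that by (induction rule: SOS_induct) auto
  obtain q s t where 1: "m = (\<Sum>j\<in>E. c j * q j) + (s + (\<Sum>j\<in>I. c j * t j))"
    "s \<in> SOS" "\<forall>j\<in>I. t j \<in> SOS" using assms(1) by (rule qmoduleE)
  show ?thesis unfolding 1(1) using assms(2) S[OF 1(2)] S[OF 1(3)[rule_format]]
    by (auto simp: feas_set_def intro!: add_nonneg_nonneg sum_nonneg)
qed

text \<open>Places the point of a state in \<open>K\<close>: for an equality constraint the module
  contains both \<open>c j\<close> and its negative.\<close>

lemma feas_setI_qmodule:
  assumes "finite E" "finite I" and m: "\<And>m. m \<in> qmodule c E I \<Longrightarrow> peval m x \<ge> 0"
  shows "x \<in> feas_set E I c"
proof -
  have "peval (c j) x = 0" if "j \<in> E" for j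
    using m[OF qmodule_eq_constraint[OF assms(1) that, of c 1]] m[OF qmodule_eq_constraint[OF assms(1) that, of c "- 1"]]
    by simp
  moreover have "peval (c j) x \<ge> 0" if "j \<in> I" for j
    by (rule m[OF qmodule_ineq_constraint[OF assms(2) that]])
  ultimately show ?thesis by (simp add: feas_set_def)
qed

lemma arch_qm_qmodule:
  fixes c :: "'j \<Rightarrow> 'n::finite mpoly"
  assumes "archimedean (qmodule c E I)" shows "arch_qm (qmodule c E I)"
proof -
  interpret quadratic_module "qmodule c E I"
    by unfold_locales (auto intro: qmodule_add qmodule_SOS_mult qmodule_SOS)
  show ?thesis by (rule archimedean_arch_qm[OF assms])
qed

lemma compact_feas_set:
  fixes c :: "'j \<Rightarrow> 'n::finite mpoly"
  assumes "archimedean (qmodule c E I)" shows "compact (feas_set E I c)"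
proof -
  obtain R where R: "pconst R - (\<Sum>i\<in>UNIV. (pvar i)\<^sup>2) \<in> qmodule c E I"
    using assms by (auto simp: archimedean_def)
  have "norm x \<le> sqrt R" if "x \<in> feas_set E I c" for x
    using qmodule_nonneg[OF R that] by (simp add: norm_vec_def L2_set_def)
  then have "bounded (feas_set E I c)" by (auto simp: bounded_iff)
  moreover have "closed (feas_set E I c)"
  proof -
    have "feas_set E I c = (\<Inter>j\<in>E. {x. peval (c j) x = 0}) \<inter> (\<Inter>j\<in>I. {x. 0 \<le> peval (c j) x})"
      by (auto simp: feas_set_def)
    then show ?thesis
      by (simp only:) (intro closed_Int closed_INT ballI closed_Collect_eq closed_Collect_le continuous_on_peval continuous_on_const)
  qed
  ultimately show ?thesis by (simp add: compact_eq_bounded_closed)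
qed

section \<open>Certificates with a subtracted square\<close>

context minimum_zero
begin

text \<open>It suffices to treat \<open>p'\<close> and to add the module part back at the end. What
  has to be found is one \<open>\<epsilon>\<close> for all of \<open>K\<close>: near a zero it comes
  from \<open>posdef_perturb\<close> and \<open>posdef_local_pos\<close>, on the compact rest
  \<open>T\<close> from comparing \<open>h^2\<close> with \<open>p'\<close> by
  \<open>penalty_pos\<close>.\<close>

theorem square_certificate:
  assumes ar: "archimedean (qmodule c E I)" and h: "\<And>z. z \<in> S \<Longrightarrow> peval h z = 0"
  obtains \<epsilon> where "\<epsilon> > 0" "p - pconst \<epsilon> * h\<^sup>2 \<in> qmodule c E I"
proof -
  let ?M = "qmodule c E I"
  interpret arch_qm ?M by (rule arch_qm_qmodule[OF ar])
  have cK: "compact K" by (rule compact_feas_set[OF ar])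
  have S: "finite S" by (rule finite_minimizers[OF cK])
  obtain p' t q where p': "p = p' + (\<Sum>j\<in>E. c j * q j) + (\<Sum>j\<in>I. c j * t j)" "\<And>j. j \<in> I \<Longrightarrow> t j \<in> SOS"
    "\<And>z. z \<in> S \<Longrightarrow> p' \<in> posdef z" "\<And>x. x \<in> K - S \<Longrightarrow> peval p' x > 0"
    by (rule global_certificate[OF cK]) auto
  define P where "P z d r \<longleftrightarrow> d > 0 \<and> r > 0 \<and> (\<forall>e. 0 \<le> e \<longrightarrow> e \<le> d \<longrightarrow> p' - pconst e * h\<^sup>2 \<in> posdef z) \<and>
    (\<forall>x. dist x z < r \<longrightarrow> x \<noteq> z \<longrightarrow> peval p' x - d * (peval h x)\<^sup>2 > 0)" for z d r
  have "\<exists>d r. P z d r" if z: "z \<in> S" for z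
  proof -
    have "h\<^sup>2 \<in> van2 z" unfolding power2_eq_square using h z by (intro van2_prod) auto
    then obtain d where d: "d > 0" "\<And>e. 0 \<le> e \<Longrightarrow> e \<le> d \<Longrightarrow> p' - pconst e * h\<^sup>2 \<in> posdef z"
      using posdef_perturb[of p' z "h\<^sup>2"] p'(3) z by blast
    then have "p' - pconst d * h\<^sup>2 \<in> posdef z" by simp
    from posdef_local_pos[OF this] obtain r where "r > 0"
      "\<And>x. dist x z < r \<Longrightarrow> x \<noteq> z \<Longrightarrow> peval (p' - pconst d * h\<^sup>2) x > 0" by blast
    then show ?thesis using d unfolding P_def by auto
  qed
  then obtain d r where dr: "\<And>z. z \<in> S \<Longrightarrow> P z (d z) (r z)" by metis
  define T where "T = K - (\<Union>z\<in>S. ball z (r z))"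
  have T: "compact T" unfolding T_def by (intro compact_diff cK open_UN) auto
  have p'T: "peval p' x > 0" if "x \<in> T" for x
  proof -
    have "x \<in> K" "x \<notin> S" using that dr by (auto simp: T_def P_def)
    then show ?thesis using p'(4) by auto
  qed
  have cont: "continuous_on T (\<lambda>x. - (peval h x)\<^sup>2)" by (intro continuous_intros continuous_on_peval)
  obtain N where N: "N \<ge> 0" "\<And>n x. n \<ge> N \<Longrightarrow> x \<in> T \<Longrightarrow> - (peval h x)\<^sup>2 + n * peval p' x > 0"
    by (rule penalty_pos[OF T cont continuous_on_peval[of T p']]) (use p'T in \<open>force intro: less_imp_le\<close>)+
  \<comment> \<open>The entry \<open>1 / (N + 1)\<close> handles \<open>T\<close> and keeps the
    minimum meaningful when there are no zeros.\<close>
  define \<epsilon> where "\<epsilon> = Min (insert (1 / (N + 1)) (d ` S))"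
  have e: "\<epsilon> > 0" "\<epsilon> \<le> 1 / (N + 1)" "\<And>z. z \<in> S \<Longrightarrow> \<epsilon> \<le> d z"
    using S N(1) dr by (auto simp: \<epsilon>_def P_def)
  have "p' - pconst \<epsilon> * h\<^sup>2 \<in> ?M"
  proof (rule nonneg_mem[OF S])
    show "p' - pconst \<epsilon> * h\<^sup>2 \<in> posdef z" if "z \<in> S" for z
      using dr[OF that] e(1) e(3)[OF that] by (simp add: P_def)
    fix x assume x: "x \<notin> S" "\<And>m. m \<in> ?M \<Longrightarrow> peval m x \<ge> 0"
    have xK: "x \<in> K" by (rule feas_setI_qmodule[OF fin x(2)])
    have "peval p' x - \<epsilon> * (peval h x)\<^sup>2 > 0"
    proof (cases "x \<in> T")
      case True
      have "- (peval h x)\<^sup>2 + (N + 1) * peval p' x > 0" by (rule N(2)) (use True in auto)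
      then have "(peval h x)\<^sup>2 < (N + 1) * peval p' x" by simp
      then have "(1 / (N + 1)) * (peval h x)\<^sup>2 < peval p' x" using N(1) by (simp add: field_simps)
      moreover have "\<epsilon> * (peval h x)\<^sup>2 \<le> (1 / (N + 1)) * (peval h x)\<^sup>2" using e(2) by (rule mult_right_mono) simp
      ultimately show ?thesis by simp
    next
      case False
      then obtain z where z: "z \<in> S" "dist x z < r z" using xK by (auto simp: T_def dist_commute)
      then have "x \<noteq> z" using x(1) by auto
      then have "peval p' x - d z * (peval h x)\<^sup>2 > 0" using dr[OF z(1)] z(2) by (simp add: P_def)
      moreover have "\<epsilon> * (peval h x)\<^sup>2 \<le> d z * (peval h x)\<^sup>2" using e(3)[OF z(1)] by (rule mult_right_mono) simp
      ultimately show ?thesis by simp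
    qed
    then show "peval (p' - pconst \<epsilon> * h\<^sup>2) x > 0" by simp
  qed
  moreover have "(\<Sum>j\<in>E. c j * q j) + (0 + (\<Sum>j\<in>I. c j * t j)) \<in> ?M"
    by (intro qmoduleI p') simp_all
  ultimately have "p' - pconst \<epsilon> * h\<^sup>2 + ((\<Sum>j\<in>E. c j * q j) + (0 + (\<Sum>j\<in>I. c j * t j))) \<in> ?M"
    by (rule qmodule_add)
  also have "p' - pconst \<epsilon> * h\<^sup>2 + ((\<Sum>j\<in>E. c j * q j) + (0 + (\<Sum>j\<in>I. c j * t j))) = p - pconst \<epsilon> * h\<^sup>2"
    by (subst p'(1)) simp
  finally show thesis using that e(1) by blast
qed

end

section \<open>Degree bounds and truncated certificates\<close>

lemma expo_size_add: "expo_size (\<alpha> + \<beta>) = expo_size \<alpha> + expo_size \<beta>"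
  by (simp add: expo_size_def lookup_add sum.distrib)

lemma polys_le_mono: "p \<in> polys_le d \<Longrightarrow> d \<le> d' \<Longrightarrow> p \<in> polys_le d'"
  by (force simp: polys_le_def)

lemma polys_le_tdeg: "p \<in> polys_le (int (tdeg p))"
  by (auto simp: polys_le_def tdeg_def)

lemma polys_le_add: "p \<in> polys_le d \<Longrightarrow> q \<in> polys_le d \<Longrightarrow> p + q \<in> polys_le d"
  using keys_add[of p q] by (auto simp: polys_le_def)

lemma polys_le_minus: "p \<in> polys_le d \<Longrightarrow> - p \<in> polys_le d"
  by (simp add: polys_le_def)

lemma polys_le_diff: "p \<in> polys_le d \<Longrightarrow> q \<in> polys_le d \<Longrightarrow> p - q \<in> polys_le d"
  using polys_le_add[of p d "- q"] polys_le_minus[of q d] by simp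

lemma polys_le_0 [simp]: "0 \<in> polys_le d" by (simp add: polys_le_def)

lemma polys_le_sum: "(\<And>i. i \<in> S \<Longrightarrow> f i \<in> polys_le d) \<Longrightarrow> (\<Sum>i\<in>S. f i) \<in> polys_le d"
  by (induction S rule: infinite_finite_induct) (auto intro: polys_le_add)

lemma polys_le_mult: "p \<in> polys_le d \<Longrightarrow> q \<in> polys_le d' \<Longrightarrow> p * q \<in> polys_le (d + d')"
  using keys_mult[of p q] by (force simp: polys_le_def expo_size_add)

lemma expo_size_0 [simp]: "expo_size 0 = 0" by (simp add: expo_size_def)

lemma polys_le_pconst: "d \<ge> 0 \<Longrightarrow> pconst r \<in> polys_le d"
  by (auto simp: polys_le_def pconst_def)

lemma polys_le_1: "d \<ge> 0 \<Longrightarrow> 1 \<in> polys_le d"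
  using polys_le_pconst[of d 1] by simp

lemma polys_le_pmonom: "int (expo_size \<alpha>) \<le> d \<Longrightarrow> pmonom \<alpha> \<in> polys_le d"
  by (auto simp: polys_le_def pmonom_def)

lemma polys_le_plin: "(\<And>i. a i \<in> polys_le (int d)) \<Longrightarrow> plin \<theta> a \<in> polys_le (int d)"
  unfolding plin_def using polys_le_mult[OF polys_le_pconst[of 0], of _ "int d"]
  by (intro polys_le_sum) auto

lemma polys_le_expos: "p \<in> polys_le (int d) \<longleftrightarrow> Poly_Mapping.keys p \<subseteq> expos d"
  by (auto simp: polys_le_def expos_def)

abbreviation qmodule_le :: "('j \<Rightarrow> 'n::finite mpoly) \<Rightarrow> 'j set \<Rightarrow> 'j set \<Rightarrow> nat \<Rightarrow> 'n mpoly set" where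
  "qmodule_le c E I k \<equiv> Ideal_le c E (2 * int k) + QM_le c I (2 * int k)"

text \<open>A single representation has finitely many terms; the sum of all their degrees is a crude
  order that suffices for it.\<close>

lemma qmodule_truncation:
  assumes fin: "finite E" "finite I" and m: "m \<in> qmodule c E I"
  obtains k0 where "\<And>k. k \<ge> k0 \<Longrightarrow> m \<in> qmodule_le c E I k"
proof -
  obtain q s t where 1: "m = (\<Sum>j\<in>E. c j * q j) + (s + (\<Sum>j\<in>I. c j * t j))"
    "s \<in> SOS" "\<forall>j\<in>I. t j \<in> SOS" using m by (rule qmoduleE)
  define k0 where "k0 = tdeg s + (\<Sum>j\<in>E. tdeg (c j) + tdeg (q j)) + (\<Sum>j\<in>I. tdeg (c j) + tdeg (t j))"
  have "m \<in> qmodule_le c E I k" if k: "k \<ge> k0" for k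
  proof -
    have "tdeg s \<le> 2 * k" using k by (simp add: k0_def)
    then have "s \<in> SOS_le (2 * int k)" using 1(2) polys_le_mono[OF polys_le_tdeg, of s "2 * int k"] by (simp add: SOS_le_def)
    moreover have "q j \<in> polys_le (2 * int k - int (tdeg (c j)))" if "j \<in> E" for j
    proof (rule polys_le_mono[OF polys_le_tdeg])
      have "tdeg (c j) + tdeg (q j) \<le> (\<Sum>j\<in>E. tdeg (c j) + tdeg (q j))"
        by (rule member_le_sum[OF that _ fin(1)]) simp
      then show "int (tdeg (q j)) \<le> 2 * int k - int (tdeg (c j))" using k by (simp add: k0_def)
    qed
    moreover have "t j \<in> SOS_le (2 * int k - int (tdeg (c j)))" if "j \<in> I" for j
    proof -
      have "tdeg (c j) + tdeg (t j) \<le> (\<Sum>j\<in>I. tdeg (c j) + tdeg (t j))"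
        by (rule member_le_sum[OF that _ fin(2)]) simp
      then have "int (tdeg (t j)) \<le> 2 * int k - int (tdeg (c j))" using k by (simp add: k0_def)
      then show ?thesis using 1(3)[rule_format, OF that] polys_le_mono[OF polys_le_tdeg, of "t j"] by (simp add: SOS_le_def)
    qed
    ultimately show ?thesis unfolding 1(1) set_plus_def Ideal_le_def QM_le_def by blast
  qed
  then show thesis using that by blast
qed

text \<open>
  No cancellation occurs among the leading terms of a sum of squares: an exponent \<open>a\<close> of maximal
  size and, among those, of maximal \<open>\<Sum> a\<^sub>i\<^sup>2\<close> is a vertex, so \<open>2a\<close> is only reached as \<open>a + a\<close>.
\<close>

lemma sum_squares_degree:
  fixes q :: "nat \<Rightarrow> 'n::finite mpoly"
  assumes "(\<Sum>i<N. (q i)\<^sup>2) \<in> polys_le d" and "l < N" "b \<in> Poly_Mapping.keys (q l)"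
  shows "2 * int (expo_size b) \<le> d"
proof -
  let ?e = "Poly_Mapping.lookup"
  define U where "U = (\<Union>i<N. Poly_Mapping.keys (q i))"
  have U: "finite U" "b \<in> U" using assms by (auto simp: U_def)
  define D where "D = Max (expo_size ` U)"
  have D: "expo_size r \<le> D" if "r \<in> U" for r using U that by (auto simp: D_def)
  define T where "T = {r\<in>U. expo_size r = D}"
  have "D \<in> expo_size ` U" unfolding D_def by (rule Max_in) (use U in auto)
  then have T: "finite T" "T \<noteq> {}" using U by (auto simp: T_def)
  define n2 where "n2 r = (\<Sum>i\<in>UNIV. (int (?e r i))\<^sup>2)" for r :: "'n expo"
  obtain a where a: "a \<in> T" "\<And>r. r \<in> T \<Longrightarrow> n2 r \<le> n2 a"
  proof -
    have "Max (n2 ` T) \<in> n2 ` T" by (rule Max_in) (use T in auto)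
    then obtain a where "a \<in> T" "n2 a = Max (n2 ` T)" by auto
    then show thesis using that T(1) by simp
  qed
  have vertex: "r = a \<and> s = a" if "r \<in> U" "s \<in> U" "r + s = a + a" for r s
  proof -
    have "expo_size r + expo_size s = 2 * D" using a(1) expo_size_add[of r s] expo_size_add[of a a] that(3) by (simp add: T_def)
    then have "r \<in> T" "s \<in> T" using D[OF that(1)] D[OF that(2)] that by (auto simp: T_def)
    then have le: "n2 r \<le> n2 a" "n2 s \<le> n2 a" using a(2) by auto
    have rs: "?e r i + ?e s i = 2 * ?e a i" for i
      using arg_cong[OF that(3), of "\<lambda>f. ?e f i"] by (simp add: lookup_add)
    have si: "int (?e s i) = 2 * int (?e a i) - int (?e r i)" for i
      using rs[of i] by linarith
    have "(\<Sum>i\<in>UNIV. (int (?e r i) - int (?e s i))\<^sup>2) = 2 * n2 r + 2 * n2 s - 4 * n2 a"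
      unfolding n2_def sum_distrib_left sum.distrib[symmetric] sum_subtractf[symmetric]
      by (rule sum.cong) (simp_all add: si power2_eq_square algebra_simps)
    also have "\<dots> \<le> 0" using le by linarith
    finally have "(\<Sum>i\<in>UNIV. (int (?e r i) - int (?e s i))\<^sup>2) = 0"
      by (simp add: sum_nonneg antisym)
    then have "?e r i = ?e s i" for i
      by (simp add: sum_nonneg_eq_0_iff)
    then have "?e r i = ?e a i" "?e s i = ?e a i" for i
      using rs[of i] by simp_all
    then show ?thesis by (simp add: poly_mapping_eqI)
  qed
  have sq: "?e ((q i)\<^sup>2) (a + a) = (?e (q i) a)\<^sup>2" if i: "i < N" for i
  proof -
    let ?f = "?e (q i)" and ?k = "Poly_Mapping.keys (q i)"
    have kU: "?k \<subseteq> U" using i by (auto simp: U_def)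
    have e: "q i = (\<Sum>r\<in>U. pconst (?f r) * pmonom r)" by (rule poly_expand[OF U(1) kU])
    have "(q i)\<^sup>2 = (\<Sum>r\<in>U. \<Sum>s\<in>U. Poly_Mapping.single (r + s) (?f r * ?f s))"
      unfolding power2_eq_square
      by (subst (1 2) e) (simp add: sum_product pconst_def pmonom_def mult_single)
    then have "?e ((q i)\<^sup>2) (a + a) = (\<Sum>r\<in>U. \<Sum>s\<in>U. if r + s = a + a then ?f r * ?f s else 0)"
      by (simp add: lookup_sum lookup_single when_def)
    also have "\<dots> = (\<Sum>r\<in>U. if r = a then (\<Sum>s\<in>U. if s = a then ?f a * ?f a else 0) else 0)"
    proof (rule sum.cong[OF refl])
      fix r assume g: "r \<in> U"
      show "(\<Sum>s\<in>U. if r + s = a + a then ?f r * ?f s else 0) =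
          (if r = a then (\<Sum>s\<in>U. if s = a then ?f a * ?f a else 0) else 0)"
      proof (cases "r = a")
        case True then show ?thesis by (auto intro!: sum.cong)
      next
        case False
        then have "r + s \<noteq> a + a" if "s \<in> U" for s using vertex[OF g that] by blast
        then show ?thesis using False by (simp add: sum.neutral)
      qed
    qed
    also have "\<dots> = (?f a)\<^sup>2" using a(1) U(1) by (simp add: T_def power2_eq_square)
    finally show ?thesis .
  qed
  obtain l' where l': "l' < N" "a \<in> Poly_Mapping.keys (q l')" using a(1) by (auto simp: T_def U_def)
  have "?e (\<Sum>i<N. (q i)\<^sup>2) (a + a) = (\<Sum>i<N. (?e (q i) a)\<^sup>2)"
    by (simp add: lookup_sum sq)
  also have "\<dots> > 0" by (rule sum_pos2[of _ l']) (use l' in \<open>auto simp: in_keys_iff\<close>)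
  finally have "a + a \<in> Poly_Mapping.keys (\<Sum>i<N. (q i)\<^sup>2)" by (simp add: in_keys_iff)
  then have "int (expo_size (a + a)) \<le> d" using assms(1) by (auto simp: polys_le_def)
  moreover have "expo_size a = D" using a(1) by (simp add: T_def)
  ultimately show ?thesis using D[OF U(2)] by (simp add: expo_size_add)
qed

text \<open>The degree bound on a sum of squares must pass to the single squares before the
  localizing matrix applies to them; this is \<open>sum_squares_degree\<close>.\<close>

lemma localizing_nonneg:
  assumes psd: "loc_psd k g v" and s: "s \<in> SOS_le (2 * int k - int (tdeg g))"
  shows "pairing (g * s) v \<ge> 0"
proof -
  obtain N q where q: "s = (\<Sum>i<(N::nat). (q i)\<^sup>2)" using s by (auto simp: SOS_le_def SOS_def)
  have "pairing (g * (q i)\<^sup>2) v \<ge> 0" if i: "i < N" for i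
  proof -
    have "\<forall>\<alpha>\<in>Poly_Mapping.keys (q i). 2 * int (expo_size \<alpha>) \<le> 2 * int k - int (tdeg g)"
      using sum_squares_degree[of q N _ i] s q i by (auto simp: SOS_le_def)
    from loc_mat_identity[OF this, of v] show ?thesis using psd by (metis psd_on_def)
  qed
  then show ?thesis by (auto simp: q sum_distrib_left pairing_sum intro!: sum_nonneg)
qed

text \<open>Weak duality at order \<open>k\<close>: the ideal part pairs to 0, the other parts are
  nonnegative by the localizing matrices, with the moment matrix for the pure sum of
  squares.\<close>

lemma relax_cone_nonneg:
  fixes c :: "'j \<Rightarrow> 'n::finite mpoly"
  assumes fin: "finite E" "finite I" and v: "v \<in> relax_cone k E I c"
    and m: "m \<in> qmodule_le c E I k"
  shows "pairing m v \<ge> 0"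
proof -
  obtain q s t where m: "m = (\<Sum>j\<in>E. c j * q j) + (s + (\<Sum>j\<in>I. c j * t j))"
    and q: "\<And>j. j \<in> E \<Longrightarrow> q j \<in> polys_le (2 * int k - int (tdeg (c j)))"
    and s: "s \<in> SOS_le (2 * int k)" and t: "\<And>j. j \<in> I \<Longrightarrow> t j \<in> SOS_le (2 * int k - int (tdeg (c j)))"
    using m unfolding set_plus_def Ideal_le_def QM_le_def by blast
  have "pairing (c j * q j) v = 0" if "j \<in> E" for j
    using loc_vec_identity[OF q[OF that], of v] v that by (simp add: relax_cone_def)
  moreover have "pairing (c j * t j) v \<ge> 0" if "j \<in> I" for j
    by (rule localizing_nonneg[OF _ t[OF that]]) (use v that in \<open>auto simp: relax_cone_def\<close>)
  moreover have "tdeg (1 :: 'n mpoly) = 0" by (simp add: tdeg_def)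
  then have "pairing (1 * s) v \<ge> 0"
    by (intro localizing_nonneg[of k]) (use v s in \<open>auto simp: relax_cone_def\<close>)
  ultimately show ?thesis using fin by (simp add: m pairing_add pairing_sum sum_nonneg)
qed

section \<open>Atomic optimal measures\<close>

text \<open>Moments of a finitely atomic measure. The atoms are indexed by \<open>T\<close> since
  different indices may share a point \<open>X t\<close>, as can happen for the two signs in
  \<open>atomic_optimum\<close>.\<close>

definition atomic_moments :: "nat \<Rightarrow> 't set \<Rightarrow> ('t \<Rightarrow> real) \<Rightarrow> ('t \<Rightarrow> real ^ 'n) \<Rightarrow> 'n::finite expo \<Rightarrow> real" where
  "atomic_moments s T u X = (\<lambda>\<alpha>\<in>expos s. \<Sum>t\<in>T. u t * monom_eval \<alpha> (X t))"

lemma pairing_atomic: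
  assumes "p \<in> polys_le (int s)"
  shows "pairing p (atomic_moments s T u X) = (\<Sum>t\<in>T. u t * peval p (X t))"
proof -
  have "pairing p (atomic_moments s T u X) =
      (\<Sum>\<alpha>\<in>Poly_Mapping.keys p. \<Sum>t\<in>T. u t * (Poly_Mapping.lookup p \<alpha> * monom_eval \<alpha> (X t)))"
    unfolding pairing_def
    by (rule sum.cong) (use assms in \<open>auto simp: polys_le_expos atomic_moments_def sum_distrib_left mult_ac\<close>)
  also have "\<dots> = (\<Sum>t\<in>T. u t * peval p (X t))"
    by (subst sum.swap) (simp add: peval_def sum_distrib_left)
  finally show ?thesis .
qed

lemma monom_eval_measurable: "monom_eval \<alpha> \<in> borel_measurable borel"
proof -
  have "monom_eval \<alpha> = peval (pmonom \<alpha>)" by (simp add: fun_eq_iff peval_pmonom)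
  then show ?thesis by (simp add: borel_measurable_continuous_onI continuous_on_peval)
qed

text \<open>The measure is the image under \<open>X\<close> of a point measure on \<open>T\<close>.
  Its support stays in \<open>K\<close> because the complement of the finite set of atoms is an open
  null set.\<close>

lemma atomic_moment_cone:
  assumes T: "finite T" and u: "\<And>t. t \<in> T \<Longrightarrow> u t \<ge> 0" and X: "\<And>t. t \<in> T \<Longrightarrow> X t \<in> K"
  shows "atomic_moments d T u X \<in> moment_cone d K"
proof -
  let ?P = "point_measure T u" and ?\<mu> = "distr (point_measure T u) borel X"
  have Xm: "X \<in> measurable ?P borel" by simp
  have "has_bochner_integral ?\<mu> (monom_eval \<alpha>) (atomic_moments d T u X \<alpha>)" if "\<alpha> \<in> expos d" for \<alpha>
    unfolding has_bochner_integral_iff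
  proof
    show "integrable ?\<mu> (monom_eval \<alpha>)"
      by (subst integrable_distr_eq[OF Xm monom_eval_measurable]) (rule integrable_point_measure_finite[OF T])
    show "integral\<^sup>L ?\<mu> (monom_eval \<alpha>) = atomic_moments d T u X \<alpha>"
      by (subst integral_distr[OF Xm monom_eval_measurable], subst lebesgue_integral_point_measure_finite)
        (use T u that in \<open>auto simp: atomic_moments_def\<close>)
  qed
  moreover have "msupport ?\<mu> \<subseteq> K"
  proof
    fix x assume x: "x \<in> msupport ?\<mu>"
    show "x \<in> K"
    proof (rule ccontr)
      assume "x \<notin> K"
      then have xX: "x \<notin> X ` T" using X by auto
      have o: "open (- (X ` T))" using T by (simp add: finite_imp_closed open_Compl)
      then have "emeasure ?\<mu> (- (X ` T)) > 0" using x xX unfolding msupport_def by blast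
      moreover have "X -` (- (X ` T)) \<inter> space ?P = {}" by (auto simp: space_point_measure)
      ultimately show False using o by (subst (asm) emeasure_distr[OF Xm]) auto
    qed
  qed
  ultimately show ?thesis
    unfolding moment_cone_def by (auto simp: atomic_moments_def intro!: exI[of _ ?\<mu>])
qed

lemma atomic_relax_cone:
  fixes c :: "'j \<Rightarrow> 'n::finite mpoly"
  assumes u: "\<And>t. t \<in> T \<Longrightarrow> u t \<ge> 0" and X: "\<And>t. t \<in> T \<Longrightarrow> X t \<in> feas_set E I c"
  shows "atomic_moments (2 * k) T u X \<in> relax_cone k E I c"
proof -
  let ?v = "atomic_moments (2 * k) T u X"
  have psd: "loc_psd k g ?v" if g: "\<And>t. t \<in> T \<Longrightarrow> peval g (X t) \<ge> 0" for g
  proof -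
    have "quad_form (loc_expos k g) (loc_mat k g ?v) a \<ge> 0" for a
    proof -
      let ?S = "loc_expos k g"
      define q where "q = (\<Sum>\<alpha>\<in>?S. pconst (a \<alpha>) * pmonom \<alpha>)"
      have q: "Poly_Mapping.lookup q \<alpha> = (if \<alpha> \<in> ?S then a \<alpha> else 0)" for \<alpha>
        by (simp add: q_def lookup_sum pconst_def pmonom_def mult_single lookup_single when_def)
      then have qk: "\<forall>\<alpha>\<in>Poly_Mapping.keys q. 2 * int (expo_size \<alpha>) \<le> 2 * int k - int (tdeg g)"
        by (force simp: in_keys_iff loc_expos_def split: if_splits)
      \<comment> \<open>Rounding down is harmless because degrees are integers, and twice this bound
        plus \<open>tdeg g\<close> stays within \<open>2 k\<close>.\<close>
      then have "q \<in> polys_le ((2 * int k - int (tdeg g)) div 2)"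
        by (force simp: polys_le_def)
      from polys_le_mult[OF polys_le_tdeg[of g] polys_le_mult[OF this this]]
      have "g * q\<^sup>2 \<in> polys_le (int (2 * k))"
        unfolding power2_eq_square by (rule polys_le_mono) linarith
      have "quad_form ?S (loc_mat k g ?v) a = quad_form ?S (loc_mat k g ?v) (Poly_Mapping.lookup q)"
        unfolding quad_form_def by (intro sum.cong refl) (simp add: q)
      also have "\<dots> = (\<Sum>t\<in>T. u t * peval (g * q\<^sup>2) (X t))"
        unfolding loc_mat_identity[OF qk] by (rule pairing_atomic) fact
      also have "\<dots> \<ge> 0" by (auto intro!: sum_nonneg mult_nonneg_nonneg u g)
      finally show ?thesis .
    qed
    then show ?thesis by (simp add: psd_on_def loc_mat_sym)
  qed
  have "loc_vec k (c j) ?v \<alpha> = 0" if j: "j \<in> E" and a: "\<alpha> \<in> locvec_expos k (c j)" for j \<alpha>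
  proof -
    have "c j * pmonom \<alpha> \<in> polys_le (int (tdeg (c j)) + int (expo_size \<alpha>))"
      by (intro polys_le_mult polys_le_tdeg polys_le_pmonom) auto
    then have "c j * pmonom \<alpha> \<in> polys_le (int (2 * k))"
      by (rule polys_le_mono) (use a in \<open>simp add: locvec_expos_def\<close>)
    then show ?thesis using X j a by (simp add: loc_vec_def pairing_atomic feas_set_def)
  qed
  then show ?thesis
    unfolding relax_cone_def using psd[of 1] psd[of "c _"] X
    by (auto simp: feas_set_def atomic_moments_def)
qed

text \<open>Every point off the support has an open null neighbourhood; by the Lindelof property
  countably many of these cover the complement of the support, which is therefore null.\<close>

lemma msupport_AE:
  fixes \<mu> :: "'a::second_countable_topology measure"
  assumes sets: "sets \<mu> = sets borel" and supp: "msupport \<mu> \<subseteq> K"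
  shows "AE x in \<mu>. x \<in> K"
proof -
  let ?F = "{U. open U \<and> emeasure \<mu> U = 0}"
  obtain F where F: "F \<subseteq> ?F" "countable F" "\<Union>F = \<Union>?F" by (rule Lindelof[of ?F]) auto
  have "(\<Union>U\<in>F. U) \<in> null_sets \<mu>"
    by (rule null_sets_UN') (use F sets in \<open>auto intro!: null_setsI\<close>)
  then have "\<Union>F \<in> null_sets \<mu>" by simp
  moreover have "{x \<in> space \<mu>. x \<notin> K} \<subseteq> \<Union>F"
  proof
    fix x assume "x \<in> {x \<in> space \<mu>. x \<notin> K}"
    then have "x \<notin> msupport \<mu>" using supp by auto
    then obtain U where "open U" "x \<in> U" "emeasure \<mu> U = 0" by (auto simp: msupport_def zero_less_iff_neq_zero)
    then show "x \<in> \<Union>F" unfolding F(3) by blast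
  qed
  ultimately show ?thesis by (rule AE_I')
qed

lemma moment_cone_nonneg:
  assumes y: "y \<in> moment_cone d K" and p: "p \<in> nonneg_polys d K"
  shows "pairing p y \<ge> 0"
proof -
  obtain \<mu> where \<mu>: "sets \<mu> = sets borel" "msupport \<mu> \<subseteq> K"
    "\<And>\<alpha>. \<alpha> \<in> expos d \<Longrightarrow> has_bochner_integral \<mu> (monom_eval \<alpha>) (y \<alpha>)"
    using y by (auto simp: moment_cone_def)
  have kp: "Poly_Mapping.keys p \<subseteq> expos d" using p by (simp add: nonneg_polys_def polys_le_expos)
  have "has_bochner_integral \<mu> (\<lambda>x. \<Sum>\<alpha>\<in>Poly_Mapping.keys p. Poly_Mapping.lookup p \<alpha> * monom_eval \<alpha> x)
      (\<Sum>\<alpha>\<in>Poly_Mapping.keys p. Poly_Mapping.lookup p \<alpha> * y \<alpha>)"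
    by (intro has_bochner_integral_sum has_bochner_integral_mult_right \<mu>(3)) (use kp in auto)
  then have "integral\<^sup>L \<mu> (peval p) = pairing p y"
    by (simp add: has_bochner_integral_iff peval_def[abs_def] pairing_def)
  moreover have "AE x in \<mu>. 0 \<le> peval p x"
    using msupport_AE[OF \<mu>(1,2)] by eventually_elim (use p in \<open>simp add: nonneg_polys_def\<close>)
  ultimately show ?thesis using integral_nonneg_AE by metis
qed

lemma peval_eq_inner: "peval (plin \<theta> a) x = \<theta> \<bullet> (\<chi> i. peval (a i) x)"
  by (simp add: peval_plin inner_chi)

text \<open>
  (SD) maximizes \<open>b \<bullet> \<theta>\<close> over the polar of \<open>{\<plusminus> a(x) | x \<in> K}\<close>, so by the bipolar theorem \<open>b\<close>
  lies in the optimal value times the convex hull of this set, which is compact.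
\<close>

lemma atomic_optimum:
  fixes a :: "'m::finite \<Rightarrow> 'n::finite mpoly" and b \<theta>s :: "real ^ 'm"
  assumes K: "compact K" and deg: "\<And>i. a i \<in> polys_le (int d)" and ind: "lin_indep_on K a"
    and opt: "is_arg_max (SD_objective b) (\<lambda>\<theta>. \<theta> \<in> SD_feasible d K a) \<theta>s"
  obtains T :: "(real ^ 'm) set" and u w and X :: "real ^ 'm \<Rightarrow> real ^ 'n" where
    "finite T" "\<And>t. t \<in> T \<Longrightarrow> u t \<ge> 0" "\<And>t. t \<in> T \<Longrightarrow> w t \<ge> 0" "\<And>t. t \<in> T \<Longrightarrow> X t \<in> K"
    "\<And>i. (\<Sum>t\<in>T. u t * peval (a i) (X t)) - (\<Sum>t\<in>T. w t * peval (a i) (X t)) = b $ i"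
    "(\<Sum>t\<in>T. u t) + (\<Sum>t\<in>T. w t) = SD_objective b \<theta>s"
proof -
  define V where "V = SD_objective b \<theta>s"
  have obj: "SD_objective b \<theta> = b \<bullet> \<theta>" for \<theta> :: "real ^ 'm" by (simp add: SD_objective_def inner_vec_def)
  define A where "A x = (\<chi> i. peval (a i) x)" for x
  have feas: "\<theta> \<in> SD_feasible d K a" if "\<And>x. x \<in> K \<Longrightarrow> \<bar>\<theta> \<bullet> A x\<bar> \<le> 1" for \<theta>
    using that
    by (fastforce simp: SD_feasible_def nonneg_polys_def peval_eq_inner A_def[symmetric] abs_le_iff
        intro!: polys_le_diff polys_le_add polys_le_1 polys_le_plin deg)
  have max: "b \<bullet> \<theta> \<le> V" if "\<theta> \<in> SD_feasible d K a" for \<theta>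
    using opt that by (auto simp: is_arg_max_def V_def obj not_less)
  have V0: "V \<ge> 0" using max[OF feas[of 0]] by simp
  define D where "D = (\<lambda>(s, x). s *\<^sub>R A x) ` ({-1, 1} \<times> K)"
  have Acont: "continuous_on Y A" for Y unfolding A_def by (intro continuous_on_vec_lambda continuous_on_peval)
  have D: "compact D" unfolding D_def
    by (intro compact_continuous_image compact_Times K)
      (auto simp: case_prod_unfold intro!: continuous_intros continuous_on_compose2[OF Acont[of UNIV]])
  define H where "H = (\<lambda>h. V *\<^sub>R h) ` (convex hull D)"
  have H: "compact H" "convex H" unfolding H_def
    by (intro compact_scaling compact_convex_hull D convex_scaling convex_convex_hull)+
  have "b \<in> H"
  proof (rule ccontr)
    assume "b \<notin> H"
    then obtain g \<beta> where g: "g \<bullet> b < \<beta>" "\<And>h. h \<in> H \<Longrightarrow> g \<bullet> h > \<beta>"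
      using separating_hyperplane_closed_point[OF H(2) compact_imp_closed[OF H(1)]] by blast
    have sep: "V * (s * (g \<bullet> A x)) > \<beta>" if "x \<in> K" "s = 1 \<or> s = -1" for s x
    proof -
      have "s *\<^sub>R A x \<in> D" using that unfolding D_def by force
      then have "V *\<^sub>R (s *\<^sub>R A x) \<in> H" unfolding H_def by (intro imageI hull_inc)
      from g(2)[OF this] show ?thesis by simp
    qed
    have bound: "V * \<bar>g \<bullet> A x\<bar> < - \<beta>" if "x \<in> K" for x
      using sep[OF that, of 1] sep[OF that, of "-1"] by (cases "g \<bullet> A x \<ge> 0") auto
    \<comment> \<open>Over an empty \<open>K\<close> every combination vanishes, which contradicts
      independence because the index type is inhabited.\<close>
    have Kne: "K \<noteq> {}"
    proof
      assume "K = {}"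
      then show False using ind[unfolded lin_indep_on_def, rule_format, of "\<lambda>_. 1"] by simp
    qed
    obtain x0 where x0: "x0 \<in> K" "\<And>x. x \<in> K \<Longrightarrow> \<bar>g \<bullet> A x\<bar> \<le> \<bar>g \<bullet> A x0\<bar>"
    proof -
      have "continuous_on K (\<lambda>x. \<bar>g \<bullet> A x\<bar>)" by (intro continuous_intros Acont)
      from continuous_attains_sup[OF K Kne this] show thesis using that by blast
    qed
    define m where "m = \<bar>g \<bullet> A x0\<bar>"
    have less: "V * m < - (g \<bullet> b)" using bound[OF x0(1)] g(1) by (simp add: m_def)
    \<comment> \<open>If \<open>g\<close> is orthogonal to all \<open>A x\<close>, independence
      makes it 0 and it separates nothing. Otherwise \<open>-g / m\<close> is feasible for (SD) with
      a value above the optimum.\<close>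
    show False
    proof (cases "m = 0")
      case True
      then have "\<forall>x\<in>K. (\<Sum>i\<in>UNIV. g $ i * peval (a i) x) = 0"
        using x0(2) by (fastforce simp: m_def A_def inner_chi)
      then have "\<forall>i. g $ i = 0" using ind by (simp add: lin_indep_on_def)
      then have "g = 0" by (simp add: vec_eq_iff)
      then show False using less True by simp
    next
      case False
      then have m: "m > 0" by (simp add: m_def)
      have "(- (1 / m)) *\<^sub>R g \<in> SD_feasible d K a"
        by (rule feas) (use x0(2) m in \<open>auto simp: m_def[symmetric] abs_mult\<close>)
      from max[OF this] have "- (g \<bullet> b) / m \<le> V" by (simp add: inner_commute)
      then show False using less m by (simp add: field_simps)
    qed
  qed
  then obtain h where h: "h \<in> convex hull D" "b = V *\<^sub>R h" by (auto simp: H_def)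
  obtain T q where T: "finite T" "T \<subseteq> D" "\<forall>t\<in>T. 0 \<le> q t" "sum q T = 1" "(\<Sum>t\<in>T. q t *\<^sub>R t) = h"
    using h(1) unfolding convex_hull_explicit by blast
  define R where "R t s x \<longleftrightarrow> (s = 1 \<or> s = - 1) \<and> x \<in> K \<and> t = s *\<^sub>R A x" for t s x
  have "\<exists>s x. R t s x" if "t \<in> T" for t
  proof -
    have "t \<in> D" using that T(2) by blast
    then show ?thesis unfolding D_def R_def by auto
  qed
  then obtain s X where R: "\<And>t. t \<in> T \<Longrightarrow> R t (s t) (X t)" by metis
  have sX: "(s t = 1 \<or> s t = - 1) \<and> X t \<in> K \<and> t = s t *\<^sub>R A (X t)" if "t \<in> T" for t
    using R[OF that] unfolding R_def .
  \<comment> \<open>Points taken with sign 1 go to the first measure and the others to the second,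
    with weights scaled by the optimal value.\<close>
  define u where "u t = V * q t * (if s t = 1 then 1 else 0)" for t
  define w where "w t = V * q t * (if s t = 1 then 0 else 1)" for t
  show thesis
  proof (rule that[of T u w X])
    show "finite T" by (rule T)
    show "u t \<ge> 0" "w t \<ge> 0" "X t \<in> K" if "t \<in> T" for t
      using that T(3) V0 sX[OF that] by (auto simp: u_def w_def)
    have uw: "u t + w t = V * q t" "u t - w t = V * q t * s t" if "t \<in> T" for t
      using sX[OF that] by (auto simp: u_def w_def)
    have "(\<Sum>t\<in>T. u t) + (\<Sum>t\<in>T. w t) = (\<Sum>t\<in>T. V * q t)"
      unfolding sum.distrib[symmetric] by (rule sum.cong) (simp_all add: uw)
    also have "\<dots> = V" using T(4) by (simp add: sum_distrib_left[symmetric])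
    finally show "(\<Sum>t\<in>T. u t) + (\<Sum>t\<in>T. w t) = SD_objective b \<theta>s" by (simp add: V_def)
    fix i
    have "(\<Sum>t\<in>T. u t * peval (a i) (X t)) - (\<Sum>t\<in>T. w t * peval (a i) (X t)) = (\<Sum>t\<in>T. V * (q t * t $ i))"
      unfolding sum_subtractf[symmetric]
    proof (rule sum.cong)
      fix t assume t: "t \<in> T"
      have "t $ i = s t * peval (a i) (X t)"
      proof -
        have "t = s t *\<^sub>R A (X t)" using sX[OF t] by blast
        then have "t $ i = (s t *\<^sub>R A (X t)) $ i" by (rule arg_cong)
        then show ?thesis by (simp add: A_def)
      qed
      then show "u t * peval (a i) (X t) - w t * peval (a i) (X t) = V * (q t * t $ i)"
        unfolding left_diff_distrib[symmetric] uw(2)[OF t] by simp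
    qed simp
    also have "\<dots> = b $ i" unfolding h(2) T(5)[symmetric] by (simp add: sum_distrib_left)
    finally show "(\<Sum>t\<in>T. u t * peval (a i) (X t)) - (\<Sum>t\<in>T. w t * peval (a i) (X t)) = b $ i" .
  qed
qed

section \<open>Flat truncation\<close>

text \<open>By \<open>rel\<close> the rows indexed by \<open>S'\<close> span the row space. By
  symmetry the same relations hold between columns, so a vector of the row space is determined by
  its entries in \<open>S'\<close>, and cutting off the remaining columns is injective on
  it.\<close>

lemma rank_on_eqI:
  fixes A A' :: "'i \<Rightarrow> 'i \<Rightarrow> real"
  assumes sub: "S' \<subseteq> S" and fin: "finite S'" and sym: "sym_on S A"
    and agree: "\<And>\<alpha> \<beta>. \<alpha> \<in> S' \<Longrightarrow> \<beta> \<in> S' \<Longrightarrow> A' \<alpha> \<beta> = A \<alpha> \<beta>"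
    and rel: "\<And>\<alpha> \<beta>. \<alpha> \<in> S \<Longrightarrow> \<beta> \<in> S \<Longrightarrow> A \<alpha> \<beta> = (\<Sum>\<gamma>\<in>S'. q \<alpha> \<gamma> * A \<gamma> \<beta>)"
  shows "rank_on S' A' = rank_on S A"
proof -
  let ?sc = "\<lambda>(r::real) (f::'i \<Rightarrow> real) i. r * f i"
  interpret V: vector_space ?sc by (rule vector_space_fun)
  define row where "row \<alpha> = (\<lambda>\<beta>. if \<beta> \<in> S then A \<alpha> \<beta> else 0)" for \<alpha>
  define row' where "row' \<alpha> = (\<lambda>\<beta>. if \<beta> \<in> S' then A' \<alpha> \<beta> else 0)" for \<alpha>
  define pi where "pi f = (\<lambda>\<beta>. if \<beta> \<in> S' then f \<beta> else 0)" for f :: "'i \<Rightarrow> real"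
  have sum_app: "(\<Sum>\<gamma>\<in>X. f \<gamma>) \<beta> = (\<Sum>\<gamma>\<in>X. f \<gamma> \<beta>)" for f :: "'i \<Rightarrow> 'i \<Rightarrow> real" and X \<beta>
    by (induction X rule: infinite_finite_induct) auto
  let ?R = "row ` S'"
  have span_row: "row \<alpha> \<in> V.span ?R" if "\<alpha> \<in> S" for \<alpha>
  proof -
    have "row \<alpha> = (\<Sum>\<gamma>\<in>S'. ?sc (q \<alpha> \<gamma>) (row \<gamma>))"
      using rel[OF that] by (auto simp: fun_eq_iff sum_app row_def)
    also have "\<dots> \<in> V.span ?R" by (intro V.span_sum V.span_scale V.span_base) auto
    finally show ?thesis .
  qed
  have spanS: "V.span (row ` S) = V.span ?R"
    unfolding V.span_eq using span_row sub by (auto intro: V.span_base)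
  obtain B where B: "B \<subseteq> ?R" "V.independent B" "?R \<subseteq> V.span B" by (rule V.basis_exists)
  have spanB: "V.span B = V.span ?R" unfolding V.span_eq using B by (auto intro: V.span_base)
  have dimS: "V.dim (row ` S) = card B"
    by (rule V.dim_eq_card) (use B spanB spanS in auto)
  interpret P: Vector_Spaces.linear ?sc ?sc pi
    by unfold_locales (auto simp: pi_def fun_eq_iff)
  let ?Q = "{f. \<forall>\<alpha>. f \<alpha> = (if \<alpha> \<in> S then \<Sum>\<gamma>\<in>S'. q \<alpha> \<gamma> * f \<gamma> else 0)}"
  have "V.span ?R \<subseteq> ?Q"
  proof (rule V.span_minimal)
    show "?R \<subseteq> ?Q"
    proof safe
      fix \<delta> \<alpha> assume d: "\<delta> \<in> S'"
      have "A \<delta> \<alpha> = (\<Sum>\<gamma>\<in>S'. q \<alpha> \<gamma> * A \<delta> \<gamma>)" if "\<alpha> \<in> S"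
      proof -
        have s: "A \<delta> \<gamma> = A \<gamma> \<delta>" if "\<gamma> \<in> S" for \<gamma>
          using sym d sub that unfolding sym_on_def by blast
        have "A \<delta> \<alpha> = (\<Sum>\<gamma>\<in>S'. q \<alpha> \<gamma> * A \<gamma> \<delta>)"
          using rel[OF that, of \<delta>] s[OF that] d sub by auto
        also have "\<dots> = (\<Sum>\<gamma>\<in>S'. q \<alpha> \<gamma> * A \<delta> \<gamma>)"
          by (rule sum.cong) (use s sub in auto)
        finally show ?thesis .
      qed
      moreover have "(\<Sum>\<gamma>\<in>S'. q \<alpha> \<gamma> * row \<delta> \<gamma>) = (\<Sum>\<gamma>\<in>S'. q \<alpha> \<gamma> * A \<delta> \<gamma>)"
        by (rule sum.cong) (use sub in \<open>auto simp: row_def\<close>)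
      ultimately show "row \<delta> \<alpha> = (if \<alpha> \<in> S then \<Sum>\<gamma>\<in>S'. q \<alpha> \<gamma> * row \<delta> \<gamma> else 0)"
        by (simp add: row_def)
    qed
    show "V.subspace ?Q"
      by (auto simp: V.subspace_def distrib_left sum.distrib sum_distrib_left mult_ac)
  qed
  then have Q: "f \<alpha> = (if \<alpha> \<in> S then \<Sum>\<gamma>\<in>S'. q \<alpha> \<gamma> * f \<gamma> else 0)" if "f \<in> V.span B" for f \<alpha>
    using that spanB by blast
  have inj: "inj_on pi (V.span B)"
  proof (rule inj_onI)
    fix f g assume f: "f \<in> V.span B" and g: "g \<in> V.span B" and e: "pi f = pi g"
    have "f \<gamma> = g \<gamma>" if "\<gamma> \<in> S'" for \<gamma>
      using fun_cong[OF e, of \<gamma>] that by (simp add: pi_def)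
    then have "(\<Sum>\<gamma>\<in>S'. q \<alpha> \<gamma> * f \<gamma>) = (\<Sum>\<gamma>\<in>S'. q \<alpha> \<gamma> * g \<gamma>)" for \<alpha> by (intro sum.cong) auto
    then show "f = g" using Q[OF f] Q[OF g] by (metis ext)
  qed
  have "pi (row \<alpha>) = row' \<alpha>" if "\<alpha> \<in> S'" for \<alpha>
    using that sub agree by (auto simp: pi_def row_def row'_def fun_eq_iff)
  then have "row' ` S' = pi ` ?R" by (auto simp: image_image)
  then have "V.span (row' ` S') = V.span (pi ` B)"
    by (simp add: P.span_image spanB)
  then have "V.dim (row' ` S') = card (pi ` B)"
    by (intro V.dim_eq_card P.independent_injective_image B inj) simp
  also have "\<dots> = card B"
    by (intro card_image inj_on_subset[OF inj] V.span_superset)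
  finally show ?thesis using dimS unfolding rank_on_def row_def row'_def by simp
qed

section \<open>Kernel vectors of moment matrices and interpolation at the zeros\<close>

lemma tdeg_1 [simp]: "tdeg 1 = 0"
  by (simp add: tdeg_def)

lemma loc_expos_1: "loc_expos k 1 = expos k"
  by (auto simp: loc_expos_def expos_def)

lemma pairing_square_nonneg:
  fixes p :: "'n::finite mpoly"
  assumes "v \<in> relax_cone k E I c" "p \<in> polys_le (int k)"
  shows "pairing (p\<^sup>2) v \<ge> 0"
proof -
  have "\<forall>\<alpha>\<in>Poly_Mapping.keys p. 2 * int (expo_size \<alpha>) \<le> 2 * int k - int (tdeg (1 :: 'n mpoly))"
    using assms(2) by (auto simp: polys_le_def)
  from loc_mat_identity[OF this, of v] show ?thesis
    using assms(1) by (simp add: relax_cone_def psd_on_def) metis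
qed

text \<open>The Cauchy-Schwarz argument: nonnegativity on \<open>(r p + q)^2\<close> for all real
  \<open>r\<close> leaves \<open>2 r s + t \<ge> 0\<close>, which forces \<open>s = 0\<close>. So
  \<open>p\<close> is a kernel vector of the moment matrix.\<close>

lemma pairing_square_kernel:
  fixes p q :: "'n::finite mpoly"
  assumes v: "v \<in> relax_cone k E I c" and pq: "p \<in> polys_le (int k)" "q \<in> polys_le (int k)"
    and z: "pairing (p\<^sup>2) v = 0"
  shows "pairing (p * q) v = 0"
proof -
  define s t where "s = pairing (p * q) v" and "t = pairing (q\<^sup>2) v"
  have "2 * r * s + t \<ge> 0" for r
  proof -
    have "pconst r * p + q \<in> polys_le (int k)"
      using polys_le_mult[OF polys_le_pconst[of 0 r] pq(1)] pq(2) by (intro polys_le_add) auto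
    then have "0 \<le> pairing ((pconst r * p + q)\<^sup>2) v" by (rule pairing_square_nonneg[OF v])
    also have "(pconst r * p + q)\<^sup>2 = pconst (r\<^sup>2) * p\<^sup>2 + (pconst (2 * r) * (p * q) + q\<^sup>2)"
      by (simp add: pconst_mult power2_eq_square algebra_simps)
    finally show ?thesis by (simp add: pairing_add pairing_pconst z s_def t_def)
  qed
  from this[of "- (t + 1) / (2 * s)"] have "s = 0" by (cases "s = 0") (auto simp: field_simps)
  then show ?thesis by (simp add: s_def)
qed

text \<open>Each \<open>x^\<alpha> - q \<alpha>\<close> is a kernel vector of the moment matrix of
  order \<open>k\<close>. Pairing its product with \<open>x^\<beta>\<close> expresses row
  \<open>\<alpha>\<close> by rows of degree at most \<open>t - dK\<close>, the coefficients being
  those of \<open>q \<alpha>\<close>; this is the relation required by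
  \<open>rank_on_eqI\<close>.\<close>

lemma flat_truncationI:
  fixes v :: "'n::finite expo \<Rightarrow> real"
  assumes v: "v \<in> relax_cone k E I c" and t: "d0 \<le> t" "t \<le> k"
    and q: "\<And>\<alpha>. \<alpha> \<in> expos t \<Longrightarrow> q \<alpha> \<in> polys_le (int (t - dK))"
    and z: "\<And>\<alpha>. \<alpha> \<in> expos t \<Longrightarrow> pairing ((pmonom \<alpha> - q \<alpha>)\<^sup>2) v = 0"
  shows "flat_truncation dK d0 k v"
proof -
  let ?w = "restrict v (expos (2 * t))"
  have entry: "loc_mat s 1 ?w \<alpha> \<beta> = v (\<alpha> + \<beta>)" if "\<alpha> \<in> expos s" "\<beta> \<in> expos s" "s \<le> t" for s \<alpha> \<beta>
  proof -
    have "\<alpha> + \<beta> \<in> expos (2 * t)" using that by (simp add: expos_def expo_size_add)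
    then show ?thesis using that by (simp add: loc_mat_def loc_expos_1 pmonom_add[symmetric] pairing_pmonom)
  qed
  have sub: "expos (t - dK) \<subseteq> (expos t :: 'n expo set)" by (auto simp: expos_def)
  have rel: "v (\<alpha> + \<beta>) = (\<Sum>\<gamma>\<in>expos (t - dK). Poly_Mapping.lookup (q \<alpha>) \<gamma> * v (\<gamma> + \<beta>))"
    if a: "\<alpha> \<in> expos t" and b: "\<beta> \<in> expos t" for \<alpha> \<beta>
  proof -
    have qk: "q \<alpha> \<in> polys_le (int k)" by (rule polys_le_mono[OF q[OF a]]) (use t in simp)
    have ak: "pmonom \<alpha> \<in> polys_le (int k)" and bk: "pmonom \<beta> \<in> polys_le (int k)"
      using a b t by (auto simp: expos_def intro!: polys_le_pmonom)
    have "pairing ((pmonom \<alpha> - q \<alpha>) * pmonom \<beta>) v = 0"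
      by (rule pairing_square_kernel[OF v polys_le_diff[OF ak qk] bk z[OF a]])
    then have "v (\<alpha> + \<beta>) = pairing (q \<alpha> * pmonom \<beta>) v"
      by (simp add: left_diff_distrib pairing_diff pmonom_add[symmetric] pairing_pmonom)
    also have "q \<alpha> * pmonom \<beta> = (\<Sum>\<gamma>\<in>expos (t - dK). pconst (Poly_Mapping.lookup (q \<alpha>) \<gamma>) * pmonom (\<gamma> + \<beta>))"
    proof -
      have "q \<alpha> = (\<Sum>\<gamma>\<in>expos (t - dK). pconst (Poly_Mapping.lookup (q \<alpha>) \<gamma>) * pmonom \<gamma>)"
        by (rule poly_expand[OF finite_expos]) (use q[OF a] in \<open>simp add: polys_le_expos\<close>)
      from arg_cong[OF this, of "\<lambda>p. p * pmonom \<beta>"] show ?thesis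
        by (simp only: sum_distrib_right pmonom_add mult.assoc)
    qed
    finally show ?thesis by (simp add: pairing_sum finite_expos pairing_pconst pairing_pmonom)
  qed
  have "rank_on (expos (t - dK)) (loc_mat (t - dK) 1 ?w) = rank_on (expos t) (loc_mat t 1 ?w)"
  proof (rule rank_on_eqI[OF sub finite_expos, where q = "\<lambda>\<alpha>. Poly_Mapping.lookup (q \<alpha>)"])
    show "sym_on (expos t) (loc_mat t 1 ?w)" using loc_mat_sym[of t 1 ?w] by (simp add: loc_expos_1)
    show "loc_mat (t - dK) 1 ?w \<alpha> \<beta> = loc_mat t 1 ?w \<alpha> \<beta>"
      if "\<alpha> \<in> expos (t - dK)" "\<beta> \<in> expos (t - dK)" for \<alpha> \<beta>
      using that sub by (simp add: entry subset_iff)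
    show "loc_mat t 1 ?w \<alpha> \<beta> = (\<Sum>\<gamma>\<in>expos (t - dK). Poly_Mapping.lookup (q \<alpha>) \<gamma> * loc_mat t 1 ?w \<gamma> \<beta>)"
      if "\<alpha> \<in> expos t" "\<beta> \<in> expos t" for \<alpha> \<beta>
    proof -
      have "(\<Sum>\<gamma>\<in>expos (t - dK). Poly_Mapping.lookup (q \<alpha>) \<gamma> * loc_mat t 1 ?w \<gamma> \<beta>) =
          (\<Sum>\<gamma>\<in>expos (t - dK). Poly_Mapping.lookup (q \<alpha>) \<gamma> * v (\<gamma> + \<beta>))"
        by (rule sum.cong) (use sub that in \<open>auto simp: entry subset_iff\<close>)
      then show ?thesis using rel[OF that] that by (simp add: entry)
    qed
  qed
  then show ?thesis unfolding flat_truncation_def loc_expos_1 using t by blast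
qed

text \<open>Lagrange interpolation by normalized products over the other points. The bound depends
  on the points and not on the values, so the truncation order \<open>t\<close> can be fixed before
  all monomials up to degree \<open>t\<close> are interpolated.\<close>

lemma interpolation_degree:
  fixes S :: "(real ^ 'n::finite) set"
  assumes S: "finite S"
  obtains r where "\<And>f. \<exists>q\<in>polys_le (int r). \<forall>z\<in>S. peval q z = f z"
proof -
  define L where "L z = pconst (1 / peval (node_poly (S - {z})) z) * node_poly (S - {z})" for z :: "real ^ 'n"
  have L: "peval (L z) z' = (if z' = z then 1 else 0)" if "z \<in> S" "z' \<in> S" for z z'
  proof (cases "z' = z")
    case True
    have "peval (node_poly (S - {z})) z > 0" by (rule node_poly_nz) (use S in auto)
    then show ?thesis using True by (simp add: L_def)
  next
    case False
    then have "peval (node_poly (S - {z})) z' = 0" using S that by (intro van2_peval node_poly_van2) auto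
    then show ?thesis using False by (simp add: L_def)
  qed
  define r where "r = (\<Sum>z\<in>S. tdeg (L z))"
  have "\<exists>q\<in>polys_le (int r). \<forall>z\<in>S. peval q z = f z" for f
  proof
    have "pconst (f z) * L z \<in> polys_le (int r)" if "z \<in> S" for z
    proof -
      have "tdeg (L z) \<le> r" unfolding r_def by (rule member_le_sum[OF that _ S]) simp
      then have "L z \<in> polys_le (int r)" by (intro polys_le_mono[OF polys_le_tdeg]) simp
      then show ?thesis using polys_le_mult[OF polys_le_pconst[of 0]] by fastforce
    qed
    then show "(\<Sum>z\<in>S. pconst (f z) * L z) \<in> polys_le (int r)" by (rule polys_le_sum)
    show "\<forall>z'\<in>S. peval (\<Sum>z\<in>S. pconst (f z) * L z) z' = f z'"
    proof
      fix z' assume z': "z' \<in> S"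
      have "(\<Sum>z\<in>S. f z * peval (L z) z') = (\<Sum>z\<in>S. if z = z' then f z else 0)"
        by (rule sum.cong) (use L z' in auto)
      then show "peval (\<Sum>z\<in>S. pconst (f z) * L z) z' = f z'" using S z' by simp
    qed
  qed
  then show thesis using that by blast
qed

context minimum_zero
begin

text \<open>
  Every \<open>x\<^sup>\<alpha>\<close> of degree at most \<open>t\<close> agrees on the zeros of \<open>p\<close> with a polynomial \<open>q\<^sub>\<alpha>\<close> of degree at
  most \<open>t - dK\<close>. Then \<open>p - \<epsilon> (x\<^sup>\<alpha> - q\<^sub>\<alpha>)\<^sup>2\<close> lies in the quadratic module, so that
  \<open>\<langle>p, v\<rangle> = 0\<close> puts \<open>x\<^sup>\<alpha> - q\<^sub>\<alpha>\<close> into the kernel of the moment matrix.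
\<close>

theorem flat_truncation_of_zero_pairing:
  assumes ar: "archimedean (qmodule c E I)"
  obtains k0 where "\<And>k v. k \<ge> k0 \<Longrightarrow> v \<in> relax_cone k E I c \<Longrightarrow> pairing p v = 0 \<Longrightarrow> flat_truncation dK d0 k v"
proof -
  have cK: "compact K" by (rule compact_feas_set[OF ar])
  have S: "finite S" by (rule finite_minimizers[OF cK])
  obtain r where r: "\<And>f. \<exists>q\<in>polys_le (int r). \<forall>z\<in>S. peval q z = f z"
    using interpolation_degree[OF S] by blast
  \<comment> \<open>The summand \<open>dK\<close> leaves room for interpolants of degree
    \<open>r\<close> below the shifted order \<open>t - dK\<close>.\<close>
  define t where "t = max d0 (r + dK)"
  have "\<exists>q. q \<in> polys_le (int r) \<and> (\<forall>z\<in>S. peval q z = monom_eval \<alpha> z)" for \<alpha> using r by blast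
  then obtain q where q: "\<And>\<alpha>. q \<alpha> \<in> polys_le (int r)" "\<And>\<alpha> z. z \<in> S \<Longrightarrow> peval (q \<alpha>) z = monom_eval \<alpha> z"
    by metis
  define h where "h \<alpha> = pmonom \<alpha> - q \<alpha>" for \<alpha>
  define P where "P \<alpha> e k0 \<longleftrightarrow> e > 0 \<and>
    (\<forall>k\<ge>k0. p - pconst e * (h \<alpha>)\<^sup>2 \<in> qmodule_le c E I k)" for \<alpha> e k0
  have "\<exists>e k0. P \<alpha> e k0" for \<alpha>
  proof -
    obtain e where e: "e > 0" "p - pconst e * (h \<alpha>)\<^sup>2 \<in> qmodule c E I"
      by (rule square_certificate[OF ar, of "h \<alpha>"]) (use q(2)[of _ \<alpha>] in \<open>simp_all add: h_def peval_pmonom\<close>)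
    obtain k0 where "\<And>k. k \<ge> k0 \<Longrightarrow> p - pconst e * (h \<alpha>)\<^sup>2 \<in> qmodule_le c E I k"
      using qmodule_truncation[OF fin e(2)] by blast
    then show ?thesis using e(1) unfolding P_def by blast
  qed
  then obtain e k1 where P: "\<And>\<alpha>. P \<alpha> (e \<alpha>) (k1 \<alpha>)" by metis
  define k0 where "k0 = t + (\<Sum>\<alpha>\<in>expos t. k1 \<alpha>)"
  have "flat_truncation dK d0 k v" if k: "k \<ge> k0" and v: "v \<in> relax_cone k E I c" and z: "pairing p v = 0" for k v
  proof (rule flat_truncationI[OF v, where t = t and q = q])
    show "d0 \<le> t" "t \<le> k" using k by (auto simp: t_def k0_def)
    show "q \<alpha> \<in> polys_le (int (t - dK))" for \<alpha>
      by (rule polys_le_mono[OF q(1)]) (simp add: t_def)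
    fix \<alpha> :: "'n expo" assume a: "\<alpha> \<in> expos t"
    have "k1 \<alpha> \<le> (\<Sum>\<alpha>\<in>expos t. k1 \<alpha>)" by (rule member_le_sum[OF a _ finite_expos]) simp
    then have "k1 \<alpha> \<le> k" using k by (simp add: k0_def)
    then have "0 \<le> pairing (p - pconst (e \<alpha>) * (h \<alpha>)\<^sup>2) v"
      using P[of \<alpha>] by (intro relax_cone_nonneg[OF fin v]) (simp add: P_def)
    then have "e \<alpha> * pairing ((h \<alpha>)\<^sup>2) v \<le> 0" by (simp add: pairing_diff pairing_pconst z)
    then have "pairing ((h \<alpha>)\<^sup>2) v \<le> 0" using P[of \<alpha>] by (simp add: P_def mult_le_0_iff)
    moreover have "h \<alpha> \<in> polys_le (int k)"
    proof -
      have "q \<alpha> \<in> polys_le (int k)" by (rule polys_le_mono[OF q(1)]) (use k in \<open>simp add: k0_def t_def\<close>)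
      then show ?thesis unfolding h_def using a k
        by (intro polys_le_diff polys_le_pmonom) (auto simp: expos_def k0_def)
    qed
    then have "pairing ((h \<alpha>)\<^sup>2) v \<ge> 0" by (rule pairing_square_nonneg[OF v])
    ultimately show "pairing ((pmonom \<alpha> - q \<alpha>)\<^sup>2) v = 0" by (simp add: h_def)
  qed
  then show thesis using that by blast
qed

theorem eventually_membership_and_flatness:
  assumes ar: "archimedean (qmodule c E I)"
  obtains k0 where "\<And>k. k \<ge> k0 \<Longrightarrow> p \<in> qmodule_le c E I k"
    "\<And>k v. k \<ge> k0 \<Longrightarrow> v \<in> relax_cone k E I c \<Longrightarrow> pairing p v = 0 \<Longrightarrow> flat_truncation dK d0 k v"
proof -
  obtain e where "e > 0" "p - pconst e * 0\<^sup>2 \<in> qmodule c E I"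
    by (rule square_certificate[OF ar, of 0]) auto
  then obtain k1 where k1: "\<And>k. k \<ge> k1 \<Longrightarrow> p \<in> qmodule_le c E I k"
    using qmodule_truncation[OF fin, of p] by auto
  obtain k2 where k2: "\<And>k v. k \<ge> k2 \<Longrightarrow> v \<in> relax_cone k E I c \<Longrightarrow> pairing p v = 0 \<Longrightarrow> flat_truncation dK d0 k v"
    by (rule flat_truncation_of_zero_pairing[OF ar]) blast
  show thesis by (rule that[of "max k1 k2"]) (use k1 k2 in auto)
qed

end

text \<open>Only the linear constraints enter, so the identity serves moments and pseudo-moments
  alike. In its uses both summands on the left are nonnegative, hence a zero gap makes both
  vanish.\<close>

lemma duality_gap:
  assumes "\<forall>i. pairing (a i) y - pairing (a i) z = b $ i"
  shows "pairing (1 - plin \<theta> a) y + pairing (1 + plin \<theta> a) z = S_objective (y, z) - SD_objective b \<theta>"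
proof -
  have "SD_objective b \<theta> = (\<Sum>i\<in>UNIV. (pairing (a i) y - pairing (a i) z) * \<theta> $ i)"
    using assms by (simp add: SD_objective_def)
  also have "\<dots> = pairing (plin \<theta> a) y - pairing (plin \<theta> a) z"
    by (simp add: pairing_plin right_diff_distrib sum_subtractf mult.commute)
  finally show ?thesis by (simp add: pairing_add pairing_diff S_objective_def)
qed

theorem theorem5p1:
  fixes E I :: "'j set"
    and c :: "'j \<Rightarrow> 'n::finite mpoly"
    and a :: "'m::finite \<Rightarrow> 'n mpoly"
    and b \<theta>s :: "real ^ 'm"
    and d :: nat
    and K :: "(real ^ 'n) set"
  assumes "finite E" and "finite I" and "E \<inter> I = {}"
    and K: "K = feas_set E I c"
    and "\<forall>i. a i \<in> polys_le (int d)"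
    and "lin_indep_on K a"
    and "archimedean (Ideal_of c E + QM c I)"
    and "is_arg_max (SD_objective b) (\<lambda>\<theta>. \<theta> \<in> SD_feasible d K a) \<theta>s"
    and "\<forall>x. is_arg_min (peval (1 - plin \<theta>s a)) (\<lambda>x. x \<in> K) x \<longrightarrow>
             optimality_conditions E I c (1 - plin \<theta>s a) x"
    and "\<forall>x. is_arg_min (peval (1 + plin \<theta>s a)) (\<lambda>x. x \<in> K) x \<longrightarrow>
             optimality_conditions E I c (1 + plin \<theta>s a) x"
  shows "(\<exists>k0\<ge>max d (d_K E I c). \<forall>k\<ge>k0.
            SDk_value k E I c a b = Sk_value k E I c a b \<and>
            Sk_value k E I c a b = SD_value d K a b \<and>
            SD_value d K a b = S_value d K a b) \<and>
         (\<exists>k0\<ge>max d (d_K E I c). \<forall>k\<ge>k0. \<forall>v w.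
            is_arg_min S_objective (\<lambda>vw. vw \<in> Sk_feasible k E I c a b) (v, w) \<longrightarrow>
            flat_truncation (d_K E I c) (d_0 E I c a) k v \<and>
            flat_truncation (d_K E I c) (d_0 E I c a) k w)"
proof -
  note fin = assms(1,2) and disj = assms(3) and ar = assms(7) and opt = assms(8)
  define p1 p2 where "p1 = 1 - plin \<theta>s a" and "p2 = 1 + plin \<theta>s a"
  define V where "V = SD_objective b \<theta>s"
  have deg: "\<And>i. a i \<in> polys_le (int d)" using assms(5) by blast
  have cK: "compact K" unfolding K by (rule compact_feas_set[OF ar])
  have feas: "\<theta>s \<in> SD_feasible d K a" and max: "\<And>\<theta>. \<theta> \<in> SD_feasible d K a \<Longrightarrow> SD_objective b \<theta> \<le> V"
    using opt by (auto simp: is_arg_max_def V_def not_less)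
  have nn: "\<And>x. x \<in> K \<Longrightarrow> peval p1 x \<ge> 0" "\<And>x. x \<in> K \<Longrightarrow> peval p2 x \<ge> 0"
    using feas by (auto simp: SD_feasible_def nonneg_polys_def p1_def p2_def)
  \<comment> \<open>A zero of a polynomial that is nonnegative on \<open>K\<close> is a global
    minimizer, so the hypothesis applies to it.\<close>
  have oc1: "optimality_conditions E I c p1 z" if "z \<in> K" "peval p1 z = 0" for z
    using assms(9) nn(1) that unfolding p1_def[symmetric] by (auto simp: is_arg_min_def not_less)
  have oc2: "optimality_conditions E I c p2 z" if "z \<in> K" "peval p2 z = 0" for z
    using assms(10) nn(2) that unfolding p2_def[symmetric] by (auto simp: is_arg_min_def not_less)
  interpret P1: minimum_zero E I c p1
    by unfold_locales (use fin disj nn(1) oc1 K in auto)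
  interpret P2: minimum_zero E I c p2
    by unfold_locales (use fin disj nn(2) oc2 K in auto)
  let ?flat = "\<lambda>k. flat_truncation (d_K E I c) (d_0 E I c a) k"
  obtain k1 where k1: "\<And>k. k \<ge> k1 \<Longrightarrow> p1 \<in> qmodule_le c E I k"
    "\<And>k v. k \<ge> k1 \<Longrightarrow> v \<in> relax_cone k E I c \<Longrightarrow> pairing p1 v = 0 \<Longrightarrow> ?flat k v"
    by (rule P1.eventually_membership_and_flatness[OF ar]) blast
  obtain k2 where k2: "\<And>k. k \<ge> k2 \<Longrightarrow> p2 \<in> qmodule_le c E I k"
    "\<And>k v. k \<ge> k2 \<Longrightarrow> v \<in> relax_cone k E I c \<Longrightarrow> pairing p2 v = 0 \<Longrightarrow> ?flat k v"
    by (rule P2.eventually_membership_and_flatness[OF ar]) blast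
  define k0 where "k0 = Max {d, d_K E I c, k1, k2}"
  have k0: "k0 \<ge> max d (d_K E I c)" "\<And>k. k \<ge> k0 \<Longrightarrow> k \<ge> d \<and> k \<ge> k1 \<and> k \<ge> k2"
    by (auto simp: k0_def)
  obtain T :: "(real ^ 'm) set" and u w X where T: "finite T" "\<And>t. t \<in> T \<Longrightarrow> u t \<ge> 0" "\<And>t. t \<in> T \<Longrightarrow> w t \<ge> 0"
    "\<And>t. t \<in> T \<Longrightarrow> X t \<in> K"
    "\<And>i. (\<Sum>t\<in>T. u t * peval (a i) (X t)) - (\<Sum>t\<in>T. w t * peval (a i) (X t)) = b $ i"
    "(\<Sum>t\<in>T. u t) + (\<Sum>t\<in>T. w t) = V"
    by (rule atomic_optimum[OF cK deg assms(6) opt]) (auto simp: V_def)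
  have one: "1 \<in> polys_le (int s)" for s by (simp add: polys_le_1)
  \<comment> \<open>The same atoms, truncated at degree \<open>s\<close>, serve (S) with
    \<open>s = d\<close> and the relaxation with \<open>s = 2 k\<close>.\<close>
  have at_obj: "S_objective (atomic_moments s T u X, atomic_moments s T w X) = V" for s
    by (simp add: S_objective_def pairing_atomic[OF one] T(6))
  have at_eq: "pairing (a i) (atomic_moments s T u X) - pairing (a i) (atomic_moments s T w X) = b $ i"
    if "s \<ge> d" for s i
    by (simp add: pairing_atomic[OF polys_le_mono[OF deg]] that T(5))
  have at_S: "(atomic_moments d T u X, atomic_moments d T w X) \<in> S_feasible d K a b"
    unfolding S_feasible_def
    using atomic_moment_cone[OF T(1,2,4)] atomic_moment_cone[OF T(1,3,4)] at_eq by simp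
  have at_Sk: "(atomic_moments (2 * k) T u X, atomic_moments (2 * k) T w X) \<in> Sk_feasible k E I c a b"
    if "k \<ge> d" for k
    unfolding Sk_feasible_def
    using atomic_relax_cone[of T u X E I c k, OF T(2) T(4)[unfolded K]]
      atomic_relax_cone[of T w X E I c k, OF T(3) T(4)[unfolded K]] at_eq[of "2 * k"] that by simp
  have SD: "SD_value d K a b = ereal V"
    unfolding SD_value_def
    by (rule antisym, rule SUP_least, simp add: max, rule SUP_upper2[OF feas], simp add: V_def)
  have S: "S_value d K a b = ereal V"
  proof (rule antisym)
    show "S_value d K a b \<le> ereal V" unfolding S_value_def by (rule INF_lower2[OF at_S]) (simp add: at_obj)
    show "ereal V \<le> S_value d K a b"
      unfolding S_value_def
    proof (rule INF_greatest)
      fix yz assume "yz \<in> S_feasible d K a b"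
      then obtain y z where yz: "yz = (y, z)" "y \<in> moment_cone d K" "z \<in> moment_cone d K"
        "\<forall>i. pairing (a i) y - pairing (a i) z = b $ i" by (auto simp: S_feasible_def)
      have "pairing (1 - plin \<theta>s a) y \<ge> 0" "pairing (1 + plin \<theta>s a) z \<ge> 0"
        using feas yz by (auto intro!: moment_cone_nonneg simp: SD_feasible_def)
      then show "ereal V \<le> ereal (S_objective yz)"
        using duality_gap[OF yz(4), of \<theta>s] by (simp add: yz(1) V_def)
    qed
  qed
  \<comment> \<open>The chain \<open>V \<le> SDk_value \<le> Sk_value \<le> V\<close> closes: by
    feasibility of \<open>\<theta>s\<close>, by weak duality and by the atomic pair.\<close>
  have vals: "SDk_value k E I c a b = ereal V \<and> Sk_value k E I c a b = ereal V" if k: "k \<ge> k0" for k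
  proof -
    have kk: "k \<ge> d" "k \<ge> k1" "k \<ge> k2" using k0(2)[OF k] by auto
    have "\<theta>s \<in> SDk_feasible k E I c a"
      using k1(1)[OF kk(2)] k2(1)[OF kk(3)] by (simp add: SDk_feasible_def p1_def p2_def)
    then have 1: "ereal V \<le> SDk_value k E I c a b"
      unfolding SDk_value_def by (rule SUP_upper2) (simp add: V_def)
    have 2: "Sk_value k E I c a b \<le> ereal V"
      unfolding Sk_value_def by (rule INF_lower2[OF at_Sk[OF kk(1)]]) (simp add: at_obj)
    have 3: "SDk_value k E I c a b \<le> Sk_value k E I c a b"
      unfolding SDk_value_def Sk_value_def
    proof (intro SUP_least INF_greatest)
      fix \<theta> vw assume th: "\<theta> \<in> SDk_feasible k E I c a" and "vw \<in> Sk_feasible k E I c a b"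
      then obtain v w where vw: "vw = (v, w)" "v \<in> relax_cone k E I c" "w \<in> relax_cone k E I c"
        "\<forall>i. pairing (a i) v - pairing (a i) w = b $ i" by (auto simp: Sk_feasible_def)
      have "pairing (1 - plin \<theta> a) v \<ge> 0" "pairing (1 + plin \<theta> a) w \<ge> 0"
        using th by (auto intro!: relax_cone_nonneg[OF fin] vw simp: SDk_feasible_def)
      then show "ereal (SD_objective b \<theta>) \<le> ereal (S_objective vw)"
        using duality_gap[OF vw(4), of \<theta>] by (simp add: vw(1))
    qed
    show ?thesis using 1 2 3 by (meson order.trans antisym)
  qed
  have flat: "?flat k v \<and> ?flat k w"
    if k: "k \<ge> k0" and m: "is_arg_min S_objective (\<lambda>vw. vw \<in> Sk_feasible k E I c a b) (v, w)" for k v w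
  proof -
    have kk: "k \<ge> d" "k \<ge> k1" "k \<ge> k2" using k0(2)[OF k] by auto
    have vw: "v \<in> relax_cone k E I c" "w \<in> relax_cone k E I c"
      "\<forall>i. pairing (a i) v - pairing (a i) w = b $ i"
      using m by (auto simp: is_arg_min_def Sk_feasible_def)
    \<comment> \<open>A minimizer does no worse than the atomic pair, so its gap to
      \<open>\<theta>s\<close> is at most 0.\<close>
    have "S_objective (v, w) \<le> V"
      using m at_Sk[OF kk(1)] at_obj[of "2 * k"] by (metis is_arg_min_def not_less)
    then have "pairing p1 v + pairing p2 w \<le> 0"
      using duality_gap[OF vw(3), of \<theta>s] by (simp add: p1_def p2_def V_def)
    moreover have "pairing p1 v \<ge> 0" "pairing p2 w \<ge> 0"
      by (rule relax_cone_nonneg[OF fin vw(1) k1(1)[OF kk(2)]], rule relax_cone_nonneg[OF fin vw(2) k2(1)[OF kk(3)]])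
    ultimately have "pairing p1 v = 0" "pairing p2 w = 0" by linarith+
    then show ?thesis using k1(2)[OF kk(2) vw(1)] k2(2)[OF kk(3) vw(2)] by blast
  qed
  show ?thesis
    using k0(1) vals SD S flat by (intro conjI exI[of _ k0]) auto
qed

end
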